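(* Let $k\geq r\geq 2$ be integers and let $p\geq r$ be real. Then there is $n_0$ such that for every $F_{k+1}^{(r)}$-free $r$-graph $H$ on $n>n_0$ vertices, \[ \lambda^{(p)}(H)\leq\lambda^{(p)}(T_r(n,k)), \] with equality if and only if $H\cong T_r(n,k)$.
   Context: An $r$-graph is an $r$-uniform hypergraph. For an $r$-graph $H$ on vertex set $[n]$ and real $p\geq1$, $\lambda^{(p)}(H)=\max_{\bm{x}\in\mathbb{R}^n,\ \|\bm{x}\|_p=1} r!\sum_{e\in E(H)}\prod_{v\in e}x_v$. $T_r(n,k)$ is the complete $k$-partite $r$-graph on $n$ vertices with part sizes differing by at most one (edges: all $r$-sets with at most one vertex in each part). $F_{k+1}^{(r)}$ is the $r$-graph whose edges are $[r]=\{1,\dots,r\}$ together with $E_{ij}\cup\{i,j\}$ for all pairs $\{i,j\}\in\binom{[k+1]}{2}\setminus\binom{[r]}{2}$, where the $E_{ij}$ are pairwise disjoint $(r-2)$-sets disjoint from $[k+1]$. $H$ is $F$-free if it has no subgraph isomorphic to $F$. *)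

theory Defs
  imports "HOL-Analysis.Analysis"
begin

type_synonym 'a hgraph = "'a set \<times> 'a set set"

abbreviation hverts :: "'a hgraph \<Rightarrow> 'a set" where "hverts \<equiv> fst"
abbreviation hedges :: "'a hgraph \<Rightarrow> 'a set set" where "hedges \<equiv> snd"

definition r_graph :: "nat \<Rightarrow> 'a hgraph \<Rightarrow> bool" where
  "r_graph r H \<longleftrightarrow> finite (hverts H) \<and> (\<forall>e\<in>hedges H. e \<subseteq> hverts H \<and> card e = r)"

definition hsubgraph :: "'a hgraph \<Rightarrow> 'a hgraph \<Rightarrow> bool" where
  "hsubgraph G H \<longleftrightarrow>
     hverts G \<subseteq> hverts H \<and> hedges G \<subseteq> hedges H \<and> (\<forall>e\<in>hedges G. e \<subseteq> hverts G)"

definition hgraph_iso :: "'a hgraph \<Rightarrow> 'b hgraph \<Rightarrow> bool" where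
  "hgraph_iso G H \<longleftrightarrow>
     (\<exists>f. bij_betw f (hverts G) (hverts H) \<and> (\<lambda>e. f ` e) ` hedges G = hedges H)"

definition hgraph_free :: "'b hgraph \<Rightarrow> 'a hgraph \<Rightarrow> bool" where
  "hgraph_free F H \<longleftrightarrow> \<not> (\<exists>G. hsubgraph G H \<and> hgraph_iso G F)"


definition p_norm :: "real \<Rightarrow> 'a set \<Rightarrow> ('a \<Rightarrow> real) \<Rightarrow> real" where
  "p_norm p V x = (\<Sum>v\<in>V. \<bar>x v\<bar> powr p) powr (1 / p)"

definition graph_form :: "nat \<Rightarrow> 'a hgraph \<Rightarrow> ('a \<Rightarrow> real) \<Rightarrow> real" where
  "graph_form r H x = fact r * (\<Sum>e\<in>hedges H. \<Prod>v\<in>e. x v)"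

text \<open>Vectors are functions of which only the values on the vertex set matter. The supremum is
  a maximum; see \<open>p_spectral_radius_attained\<close> below.\<close>

definition p_spectral_radius :: "nat \<Rightarrow> real \<Rightarrow> 'a hgraph \<Rightarrow> real" where
  "p_spectral_radius r p H = (SUP x \<in> {x. p_norm p (hverts H) x = 1}. graph_form r H x)"


definition complete_partite :: "nat \<Rightarrow> 'a set \<Rightarrow> ('a \<Rightarrow> 'c) \<Rightarrow> 'a hgraph" where
  "complete_partite r V c = (V, {e. e \<subseteq> V \<and> card e = r \<and> inj_on c e})"

text \<open>The parts are the residue classes modulo \<open>k\<close>; they are balanced by
  \<open>turan_part_sizes\<close> below.\<close>

definition turan :: "nat \<Rightarrow> nat \<Rightarrow> nat \<Rightarrow> nat hgraph" where
  "turan r n k = complete_partite r {..<n} (\<lambda>v. v mod k)"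


text \<open>The vertex \<open>Inl i\<close> is the core vertex \<open>i\<close>, and \<open>E\<^sub>i\<^sub>j\<close> consists of the
  \<open>r - 2\<close> vertices \<open>Inr ({i, j}, l)\<close>. The expanded graph \<open>F\<close> with
  superscript \<open>(r)\<close> and subscript \<open>k + 1\<close> is \<open>expanded_clique r (k + 1)\<close>.\<close>

definition pairs_upto :: "nat \<Rightarrow> nat set set" where
  "pairs_upto m = {P. P \<subseteq> {1..m} \<and> card P = 2}"

definition pair_ext :: "nat \<Rightarrow> nat set \<Rightarrow> (nat + nat set \<times> nat) set" where
  "pair_ext r P = (\<lambda>l. Inr (P, l)) ` {..<r - 2}"

definition expanded_clique :: "nat \<Rightarrow> nat \<Rightarrow> (nat + nat set \<times> nat) hgraph" where
  "expanded_clique r m =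
     (Inl ` {1..m} \<union> (\<Union>P\<in>pairs_upto m - pairs_upto r. pair_ext r P),
      {Inl ` {1..r}} \<union> (\<lambda>P. pair_ext r P \<union> Inl ` P) ` (pairs_upto m - pairs_upto r))"


lemma expanded_clique_r_graph:
  assumes "2 \<le> r" "r \<le> m"
  shows "r_graph r (expanded_clique r m)"
proof -
  have fin: "finite (pairs_upto m)"
    by (rule finite_subset[of _ "Pow {1..m}"]) (auto simp: pairs_upto_def)
  have cext: "card (pair_ext r P) = r - 2" "finite (pair_ext r P)" for P
    by (auto simp: pair_ext_def card_image inj_on_def)
  have c: "card (pair_ext r P \<union> Inl ` P) = r" if "P \<in> pairs_upto m" for P
  proof -
    from that have P: "card P = 2" "finite P"
      by (auto simp: pairs_upto_def intro: finite_subset)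
    have "card (pair_ext r P \<union> Inl ` P) = card (pair_ext r P) + card (Inl ` P :: (nat + nat set \<times> nat) set)"
      by (rule card_Un_disjoint) (auto simp: cext P, auto simp: pair_ext_def)
    with P cext assms show ?thesis by (simp add: card_image)
  qed
  show ?thesis
    using assms c fin cext
    by (auto simp: r_graph_def expanded_clique_def card_image) (auto simp: pairs_upto_def)
qed

lemma turan_part_sizes:
  assumes "i < k"
  shows "card {v \<in> {..<n}. v mod k = i} \<in> {n div k, n div k + 1}"
proof -
  have "{v \<in> {..<n}. v mod k = i} = (\<lambda>q. q * k + i) ` {q. q * k + i < n}"
  proof (intro equalityI subsetI)
    fix v assume v: "v \<in> {v \<in> {..<n}. v mod k = i}"
    then have "v = (v div k) * k + i" using div_mult_mod_eq[of v k] by simp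
    with v show "v \<in> (\<lambda>q. q * k + i) ` {q. q * k + i < n}"
      by (intro image_eqI[of _ _ "v div k"]) auto
  qed (use assms in auto)
  moreover have "inj_on (\<lambda>q. q * k + i) {q. q * k + i < n}"
    using assms by (auto simp: inj_on_def)
  ultimately have card: "card {v \<in> {..<n}. v mod k = i} = card {q. q * k + i < n}"
    by (simp add: card_image)
  have sub1: "{..<n div k} \<subseteq> {q. q * k + i < n}"
  proof
    fix q assume "q \<in> {..<n div k}"
    then have "(q + 1) * k \<le> (n div k) * k" by (intro mult_right_mono) auto
    also have "\<dots> \<le> n" by (rule div_times_less_eq_dividend)
    finally have "q * k + k \<le> n" by (simp add: algebra_simps)
    then show "q \<in> {q. q * k + i < n}" using assms by simp
  qed
  have sub2: "{q. q * k + i < n} \<subseteq> {..<n div k + 1}"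
  proof
    fix q assume "q \<in> {q. q * k + i < n}"
    then have "q * k \<le> n" by simp
    then have "q \<le> n div k" using assms by (simp add: less_eq_div_iff_mult_less_eq)
    then show "q \<in> {..<n div k + 1}" by simp
  qed
  have "n div k \<le> card {q. q * k + i < n}"
    using card_mono[OF finite_subset[OF sub2] sub1] by simp
  moreover have "card {q. q * k + i < n} \<le> n div k + 1"
    using card_mono[OF _ sub2] by simp
  ultimately show ?thesis unfolding card by auto
qed

lemma p_spectral_radius_attained:
  assumes H: "r_graph r H" and V: "hverts H \<noteq> {}" and p: "1 \<le> p"
  obtains x where "p_norm p (hverts H) x = 1" "graph_form r H x = p_spectral_radius r p H"
    and "\<And>y. p_norm p (hverts H) y = 1 \<Longrightarrow> graph_form r H y \<le> graph_form r H x"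
proof -
  define V where "V = hverts H"
  have fV: "finite V" and sub: "\<And>e. e \<in> hedges H \<Longrightarrow> e \<subseteq> V" and ne: "V \<noteq> {}"
    using H V by (auto simp: V_def r_graph_def)
  have coord: "continuous_on A (\<lambda>x::'a \<Rightarrow> real. x v)" for A v
    by (rule continuous_on_subset[OF continuous_on_product_coordinates]) auto
  define B where "B = Pi\<^sub>E UNIV (\<lambda>v. if v \<in> V then {-1..1::real} else {0})"
  have "compactin (product_topology (\<lambda>_. euclidean) UNIV) B"
    unfolding B_def by (subst compactin_PiE) auto
  then have cB: "compact B"
    by (simp add: euclidean_product_topology)
  have contn: "continuous_on A (p_norm p V)" for A
    unfolding p_norm_def using p
    by (intro continuous_on_powr' continuous_on_sum continuous_intros coord) (auto intro: sum_nonneg)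
  have conth: "continuous_on A (graph_form r H)" for A
    unfolding graph_form_def by (intro continuous_intros coord)
  define S where "S = {x \<in> B. p_norm p V x = 1}"
  have "compact (B \<inter> p_norm p V -` {1})"
    by (rule compact_Int_closed[OF cB closed_vimage[OF closed_singleton contn]])
  moreover have "S = B \<inter> p_norm p V -` {1}" by (auto simp: S_def)
  ultimately have cS: "compact S" by simp
  have bnd: "\<bar>x v\<bar> \<le> 1" if x: "p_norm p V x = 1" and v: "v \<in> V" for x v
  proof -
    have "0 \<le> (\<Sum>v\<in>V. \<bar>x v\<bar> powr p)"
      by (intro sum_nonneg) simp
    then have "(\<Sum>v\<in>V. \<bar>x v\<bar> powr p) = p_norm p V x powr p"
      using p by (simp add: p_norm_def powr_powr)
    then have s: "(\<Sum>v\<in>V. \<bar>x v\<bar> powr p) = 1"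
      using x by simp
    have "\<bar>x v\<bar> powr p \<le> 1"
      unfolding s[symmetric] by (rule member_le_sum) (use v fV in auto)
    moreover have "1 < \<bar>x v\<bar> powr p" if "1 < \<bar>x v\<bar>"
      using that p by (intro gr_one_powr) auto
    ultimately show ?thesis by linarith
  qed
  have restr: "(\<lambda>v. if v \<in> V then x v else 0) \<in> S
       \<and> graph_form r H (\<lambda>v. if v \<in> V then x v else 0) = graph_form r H x"
    if x: "p_norm p V x = 1" for x
  proof
    have "p_norm p V (\<lambda>v. if v \<in> V then x v else 0) = 1"
      using x by (simp add: p_norm_def)
    then show "(\<lambda>v. if v \<in> V then x v else 0) \<in> S"
      using bnd[OF x] by (auto simp: S_def B_def PiE_iff abs_le_iff minus_le_iff)
    show "graph_form r H (\<lambda>v. if v \<in> V then x v else 0) = graph_form r H x"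
      unfolding graph_form_def
      by (intro arg_cong2[where f = "(*)"] sum.cong prod.cong refl) (use sub in auto)
  qed
  obtain v0 where v0: "v0 \<in> V" using ne by auto
  have "p_norm p V (\<lambda>v. if v = v0 then 1 else 0) = 1"
  proof -
    have "(\<Sum>v\<in>V. \<bar>(if v = v0 then 1 else 0)::real\<bar> powr p) = (\<Sum>v\<in>V. if v = v0 then 1 else 0)"
      by (intro sum.cong) auto
    then show ?thesis using fV v0 by (simp add: p_norm_def)
  qed
  then have "S \<noteq> {}" using restr by blast
  then obtain x where x: "x \<in> S" "\<And>y. y \<in> S \<Longrightarrow> graph_form r H y \<le> graph_form r H x"
    using continuous_attains_sup[OF cS _ conth] by blast
  have x1: "p_norm p V x = 1" using x(1) by (simp add: S_def)
  have mx: "graph_form r H y \<le> graph_form r H x" if "p_norm p V y = 1" for y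
    using restr[OF that] x(2) by metis
  have "p_spectral_radius r p H = graph_form r H x"
    unfolding p_spectral_radius_def V_def[symmetric]
    by (rule cSup_eq_maximum) (use x1 mx in auto)
  then show ?thesis using that[of x] x1 mx by (simp add: V_def)
qed

end

theory Submission
  imports Defs "HOL-Real_Asymp.Real_Asymp"
begin

text \<open>
  Degree stability: call a pair of vertices heavy if edges cover it robustly, that is, even after
  forbidding a bounded number of other vertices, and keep only the edges all of whose pairs are
  heavy. Such an edge lies in no \<open>(k + 1)\<close>-clique of the shadow of the remaining hypergraph, so the
  Motzkin--Straus bound, applied to links, shows that every vertex has at most about \<open>n / k\<close>
  non-neighbours in the shadow. An edge extends to a \<open>k\<close>-clique whose members have no
  common neighbour, hence the non-neighbourhoods of adjacent vertices are almost disjoint; this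
  yields a partition into \<open>k\<close> almost equal classes. Two vertices of one class cannot lie in a
  common edge, as this would complete a copy of the expanded clique. Boundedly many vertices may
  lie in too many discarded edges; a first pass without them shows that they are not
  exceptional after all.

  Spectral part: let \<open>x\<close> be a nonnegative maximizer. If every \<open>x v powr p\<close> is at least
  \<open>(1 - \<delta>) / n\<close>, the eigenvalue equation forces large minimum degree, so the hypergraph is
  \<open>k\<close>-partite and the comparison with the balanced complete \<open>k\<close>-partite hypergraph is a concavity
  argument. Otherwise deleting a vertex of small weight does not decrease the ratio of the spectral
  radius to \<open>n powr \<gamma>\<close>, for some exponent \<open>\<gamma> < r - r / p\<close>. For a
  Turan hypergraph this ratio grows like a positive power of \<open>n\<close> up to a factor
  \<open>1 - O(1 / n\<^sup>2)\<close>, so it grows strictly faster.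
\<close>

section \<open>Elementary symmetric sums\<close>

definition esym :: "nat \<Rightarrow> 'i set \<Rightarrow> ('i \<Rightarrow> 'b::comm_semiring_1) \<Rightarrow> 'b" where
  "esym s I x = (\<Sum>S | S \<subseteq> I \<and> card S = s. \<Prod>i\<in>S. x i)"

lemma finite_subsets_card: "finite I \<Longrightarrow> finite {S. S \<subseteq> I \<and> card S = s}"
  by (rule finite_subset[of _ "Pow I"]) auto

lemma esym_0 [simp]: "finite I \<Longrightarrow> esym 0 I x = 1"
proof -
  assume "finite I"
  then have "{S. S \<subseteq> I \<and> card S = 0} = {{}}" by (auto dest: finite_subset)
  then show ?thesis by (simp add: esym_def)
qed

lemma esym_empty [simp]: "esym (Suc s) {} x = 0"
proof -
  have "{S. S \<subseteq> {} \<and> card S = Suc s} = {}" by auto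
  then show ?thesis unfolding esym_def by (metis sum.empty)
qed

lemma subsets_card_Suc_insert:
  assumes "finite I" "a \<notin> I"
  shows "{S. S \<subseteq> insert a I \<and> card S = Suc s}
    = {S. S \<subseteq> I \<and> card S = Suc s} \<union> insert a ` {S. S \<subseteq> I \<and> card S = s}"
proof (intro equalityI subsetI)
  fix S assume S: "S \<in> {S. S \<subseteq> insert a I \<and> card S = Suc s}"
  show "S \<in> {S. S \<subseteq> I \<and> card S = Suc s} \<union> insert a ` {S. S \<subseteq> I \<and> card S = s}"
  proof (cases "a \<in> S")
    case True
    then have "S = insert a (S - {a})" "S - {a} \<subseteq> I" "card (S - {a}) = s"
      using S by (auto simp: card_Diff_singleton)
    then show ?thesis by blast
  qed (use S in auto)
next
  fix S assume "S \<in> {S. S \<subseteq> I \<and> card S = Suc s} \<union> insert a ` {S. S \<subseteq> I \<and> card S = s}"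
  moreover have "card (insert a T) = Suc (card T)" if "T \<subseteq> I" for T
    using assms that finite_subset[OF that] by (intro card_insert_disjoint) auto
  ultimately show "S \<in> {S. S \<subseteq> insert a I \<and> card S = Suc s}" by auto
qed

lemma esym_insert:
  assumes "finite I" "a \<notin> I"
  shows "esym (Suc s) (insert a I) x = esym (Suc s) I x + x a * esym s I x"
proof -
  have "esym (Suc s) (insert a I) x
      = esym (Suc s) I x + (\<Sum>S\<in>insert a ` {S. S \<subseteq> I \<and> card S = s}. \<Prod>i\<in>S. x i)"
    unfolding esym_def subsets_card_Suc_insert[OF assms] using assms
    by (intro sum.union_disjoint finite_imageI finite_subsets_card) auto
  also have "(\<Sum>S\<in>insert a ` {S. S \<subseteq> I \<and> card S = s}. \<Prod>i\<in>S. x i)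
      = (\<Sum>S | S \<subseteq> I \<and> card S = s. \<Prod>i\<in>insert a S. x i)"
    using assms by (subst sum.reindex) (auto simp: inj_on_def)
  also have "\<dots> = (\<Sum>S | S \<subseteq> I \<and> card S = s. x a * (\<Prod>i\<in>S. x i))"
    using assms by (intro sum.cong refl prod.insert) (auto dest: finite_subset)
  finally show ?thesis by (simp add: esym_def sum_distrib_left)
qed

lemma esym_insert_pair:
  assumes "finite J" "a \<notin> J" "b \<notin> J" "a \<noteq> b"
  shows "esym (Suc (Suc s)) (insert a (insert b J)) x
    = esym (Suc (Suc s)) J x + (x a + x b) * esym (Suc s) J x + x a * x b * esym s J x"
  using assms by (simp add: esym_insert algebra_simps)

lemma esym_nonneg:
  fixes x :: "'i \<Rightarrow> 'b::linordered_idom"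
  shows "(\<And>i. i \<in> I \<Longrightarrow> 0 \<le> x i) \<Longrightarrow> 0 \<le> esym s I x"
  unfolding esym_def by (intro sum_nonneg prod_nonneg) auto

lemma esym_cong: "(\<And>i. i \<in> I \<Longrightarrow> x i = y i) \<Longrightarrow> esym s I x = esym s I y"
  unfolding esym_def by (intro sum.cong refl prod.cong) auto

lemma esym_mono:
  fixes x y :: "'i \<Rightarrow> 'b::linordered_idom"
  assumes "\<And>i. i \<in> I \<Longrightarrow> 0 \<le> x i" "\<And>i. i \<in> I \<Longrightarrow> x i \<le> y i"
  shows "esym s I x \<le> esym s I y"
  unfolding esym_def using assms by (intro sum_mono prod_mono) auto

lemma esym_const: "finite I \<Longrightarrow> esym s I (\<lambda>_. a) = of_nat (card I choose s) * a ^ s"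
  using n_subsets[of I s] by (simp add: esym_def)

lemma esym_scale: "esym s I (\<lambda>i. a * x i) = a ^ s * esym s I x"
  unfolding esym_def sum_distrib_left by (intro sum.cong refl) (auto simp: prod.distrib)

lemma esym_pos:
  fixes x :: "'i \<Rightarrow> 'b::linordered_idom"
  assumes "finite I" "\<And>i. i \<in> I \<Longrightarrow> 0 \<le> x i" and "s \<le> card {i\<in>I. 0 < x i}"
  shows "0 < esym s I x"
proof -
  obtain S where S: "S \<subseteq> {i\<in>I. 0 < x i}" "card S = s" "finite S"
    using obtain_subset_with_card_n[OF assms(3)] by auto
  have "0 < (\<Prod>i\<in>S. x i)" using S by (intro prod_pos) auto
  also have "\<dots> \<le> esym s I x"
    unfolding esym_def
    by (rule member_le_sum[where f = "\<lambda>S. prod x S"])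
      (use S assms(1,2) finite_subsets_card in \<open>auto intro!: prod_nonneg\<close>)
  finally show ?thesis .
qed

lemma esym_pos_diff_pair:
  fixes f :: "'i \<Rightarrow> 'b::linordered_idom"
  assumes "finite I" "\<And>i. i \<in> I \<Longrightarrow> 0 \<le> f i" and many: "Suc (Suc s) \<le> card {i\<in>I. 0 < f i}"
  shows "0 < esym s (I - {a, b}) f"
proof (rule esym_pos)
  have "Suc (Suc s) - card {a, b} \<le> card ({i\<in>I. 0 < f i} - {a, b})"
    using many diff_card_le_card_Diff[of "{a, b}" "{i\<in>I. 0 < f i}"] by simp
  moreover have "card {a, b} \<le> 2" by (simp add: card_insert_if)
  moreover have "{i\<in>I. 0 < f i} - {a, b} = {i\<in>I - {a, b}. 0 < f i}" by auto
  ultimately show "s \<le> card {i\<in>I - {a, b}. 0 < f i}" by simp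
qed (use assms in auto)

lemma esym_reindex:
  assumes "finite J" "inj_on \<pi> J"
  shows "esym s (\<pi> ` J) x = esym s J (\<lambda>j. x (\<pi> j))"
  using assms
proof (induction J arbitrary: s rule: finite_induct)
  case empty
  then show ?case by (cases s) simp_all
next
  case (insert j J)
  then have "\<pi> j \<notin> \<pi> ` J" by auto
  then show ?case using insert by (cases s) (simp_all add: esym_insert)
qed

lemma esym_1: "finite I \<Longrightarrow> esym (Suc 0) I x = sum x I"
  by (induction I rule: finite_induct) (simp_all add: esym_insert add.commute)

lemma sum_eq_pair_plus_rest:
  fixes f :: "'i \<Rightarrow> 'b::comm_monoid_add"
  assumes "finite I" "a \<in> I" "b \<in> I" "a \<noteq> b"
  shows "sum f I = f a + (f b + sum f (I - {a, b}))"
  using assms by (simp add: sum.remove[of I a] sum.remove[of "I - {a}" b] Diff_insert2[symmetric])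

lemma esym_diff_pair:
  fixes x y :: "'i \<Rightarrow> 'b::comm_ring_1"
  assumes "finite I" "a \<in> I" "b \<in> I" "a \<noteq> b" and agree: "\<And>i. i \<in> I - {a, b} \<Longrightarrow> y i = x i"
  shows "esym (Suc (Suc s)) I y - esym (Suc (Suc s)) I x
    = (y a + y b - (x a + x b)) * esym (Suc s) (I - {a, b}) x
      + (y a * y b - x a * x b) * esym s (I - {a, b}) x"
proof -
  have I: "I = insert a (insert b (I - {a, b}))" using assms by auto
  have "esym t (I - {a, b}) y = esym t (I - {a, b}) x" for t
    using agree by (rule esym_cong)
  then show ?thesis
    using assms(1,4) by (subst (1 2) I) (simp add: esym_insert_pair algebra_simps)
qed

lemma esym_mono_pair:
  fixes x y :: "'i \<Rightarrow> 'b::linordered_idom"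
  assumes I: "finite I" "a \<in> I" "b \<in> I" "a \<noteq> b" and agree: "\<And>i. i \<in> I - {a, b} \<Longrightarrow> y i = x i"
    and nonneg: "\<And>i. i \<in> I \<Longrightarrow> 0 \<le> x i"
    and le: "x a + x b \<le> y a + y b" "x a * x b \<le> y a * y b"
  shows "esym s I x \<le> esym s I y"
proof -
  have nonneg': "0 \<le> esym t (I - {a, b}) x" for t using nonneg by (intro esym_nonneg) auto
  consider "s = 0" | "s = Suc 0" | t where "s = Suc (Suc t)" by (metis not0_implies_Suc)
  then show ?thesis
  proof cases
    case 2
    have "sum y (I - {a, b}) = sum x (I - {a, b})" using agree by (intro sum.cong) auto
    then show ?thesis
      unfolding 2 esym_1[OF I(1)] sum_eq_pair_plus_rest[OF I] using le(1)
      by (simp flip: add.assoc)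
  next
    case (3 t)
    have "0 \<le> (y a + y b - (x a + x b)) * esym (Suc t) (I - {a, b}) x
      + (y a * y b - x a * x b) * esym t (I - {a, b}) x"
      using le nonneg' by (intro add_nonneg_nonneg mult_nonneg_nonneg) auto
    with esym_diff_pair[where s = t and x = x and y = y, OF I agree] show ?thesis
      unfolding 3 by simp
  qed (use I in simp)
qed

lemma esym_strict_mono_pair:
  fixes x y :: "'i \<Rightarrow> 'b::linordered_idom"
  assumes I: "finite I" "a \<in> I" "b \<in> I" "a \<noteq> b" and agree: "\<And>i. i \<in> I - {a, b} \<Longrightarrow> y i = x i"
    and nonneg: "\<And>i. i \<in> I \<Longrightarrow> 0 \<le> x i"
    and le: "x a + x b \<le> y a + y b" and less: "x a * x b < y a * y b"
    and pos: "0 < esym s (I - {a, b}) x"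
  shows "esym (Suc (Suc s)) I x < esym (Suc (Suc s)) I y"
proof -
  have "0 \<le> esym (Suc s) (I - {a, b}) x" using nonneg by (intro esym_nonneg) auto
  then have "0 < (y a + y b - (x a + x b)) * esym (Suc s) (I - {a, b}) x
      + (y a * y b - x a * x b) * esym s (I - {a, b}) x"
    using le less pos by (intro add_nonneg_pos mult_nonneg_nonneg mult_pos_pos) auto
  with esym_diff_pair[where s = s and x = x and y = y, OF I agree] show ?thesis by simp
qed

lemma mean_strictly_between:
  fixes x :: "'i \<Rightarrow> real"
  assumes "finite I" "i \<in> I" "x i \<noteq> sum x I / card I"
  obtains a b where "a \<in> I" "b \<in> I" "x a < sum x I / card I" "sum x I / card I < x b"
proof -
  define \<mu> where "\<mu> = sum x I / card I"
  have "card I \<noteq> 0" using assms by auto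
  then have sum_\<mu>: "sum x I = (\<Sum>i\<in>I. \<mu>)" by (simp add: \<mu>_def)
  have "\<exists>a\<in>I. x a < \<mu>"
  proof (rule ccontr)
    assume "\<not> (\<exists>a\<in>I. x a < \<mu>)"
    then have "(\<Sum>i\<in>I. \<mu>) < sum x I"
      using assms by (intro sum_strict_mono_ex1) (force simp: \<mu>_def)+
    then show False using sum_\<mu> by simp
  qed
  moreover have "\<exists>b\<in>I. \<mu> < x b"
  proof (rule ccontr)
    assume "\<not> (\<exists>b\<in>I. \<mu> < x b)"
    then have "sum x I < (\<Sum>i\<in>I. \<mu>)"
      using assms by (intro sum_strict_mono_ex1) (force simp: \<mu>_def)+
    then show False using sum_\<mu> by simp
  qed
  ultimately show ?thesis using that by (auto simp: \<mu>_def)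
qed

text \<open>Smoothing: moving one entry to the mean while keeping the sum increases the product of
  the two entries that change.\<close>

lemma maclaurin_esym:
  fixes x :: "'i \<Rightarrow> real"
  assumes "finite I" "I \<noteq> {}" and "\<And>i. i \<in> I \<Longrightarrow> 0 \<le> x i"
  shows "esym s I x \<le> (card I choose s) * (sum x I / card I) ^ s"
  using assms(3)
proof (induction "card {i\<in>I. x i \<noteq> sum x I / card I}" arbitrary: x rule: less_induct)
  case less
  define \<mu> where "\<mu> = sum x I / card I"
  show ?case
  proof (cases "\<forall>i\<in>I. x i = \<mu>")
    case True
    then have "esym s I x = esym s I (\<lambda>_. \<mu>)" by (intro esym_cong) auto
    also have "\<dots> = (card I choose s) * \<mu> ^ s" by (rule esym_const[OF assms(1)])
    finally show ?thesis by (simp add: \<mu>_def)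
  next
    case False
    then obtain a b where ab: "a \<in> I" "b \<in> I" "x a < \<mu>" "\<mu> < x b"
      using mean_strictly_between[OF assms(1), of _ x] unfolding \<mu>_def by blast
    then have "a \<noteq> b" by auto
    define y where "y = x(a := \<mu>, b := x a + x b - \<mu>)"
    have y: "y a = \<mu>" "y b = x a + x b - \<mu>" "\<And>i. i \<notin> {a, b} \<Longrightarrow> y i = x i"
      using ab by (auto simp: y_def)
    have nonneg: "0 \<le> y i" if "i \<in> I" for i
      using less.prems[OF that] less.prems[OF ab(1)] ab by (cases "i \<in> {a, b}") (auto simp: y)
    have sum: "sum y I = sum x I"
      using ab \<open>a \<noteq> b\<close> assms(1) y by (simp add: sum_eq_pair_plus_rest[of I a b])
    have "{i\<in>I. y i \<noteq> \<mu>} \<subset> {i\<in>I. x i \<noteq> \<mu>}"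
    proof (rule psubsetI)
      show "{i\<in>I. y i \<noteq> \<mu>} \<subseteq> {i\<in>I. x i \<noteq> \<mu>}" using ab by (auto simp: y_def split: if_splits)
      have "a \<in> {i\<in>I. x i \<noteq> \<mu>}" "a \<notin> {i\<in>I. y i \<noteq> \<mu>}" using ab y(1) by auto
      then show "{i\<in>I. y i \<noteq> \<mu>} \<noteq> {i\<in>I. x i \<noteq> \<mu>}" by metis
    qed
    then have "card {i\<in>I. y i \<noteq> sum y I / card I} < card {i\<in>I. x i \<noteq> sum x I / card I}"
      using assms(1) unfolding sum \<mu>_def by (intro psubset_card_mono) auto
    then have "esym s I y \<le> (card I choose s) * (sum x I / card I) ^ s"
      using less.hyps[of y] nonneg by (simp add: sum)
    moreover have "esym s I x \<le> esym s I y"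
    proof (rule esym_mono_pair[OF assms(1) ab(1,2)])
      have "0 \<le> (\<mu> - x a) * (x b - \<mu>)" using ab by simp
      then show "x a * x b \<le> y a * y b" by (simp add: y algebra_simps)
    qed (use less.prems ab y in auto)
    ultimately show ?thesis by linarith
  qed
qed

lemma binomial_le_binomial_times_ratio_power:
  assumes "j \<le> t"
  shows "real (j choose s) \<le> (t choose s) * (j / t) ^ s"
proof (cases "t = 0")
  case False
  define x :: "nat \<Rightarrow> real" where "x = (\<lambda>i. if i < j then 1 else 0)"
  have "real (j choose s) = esym s {..<j} x"
    using esym_const[of "{..<j}" s "1::real"]
    by (subst esym_cong[of _ x "\<lambda>_. 1"]) (auto simp: x_def)
  also have "\<dots> \<le> esym s {..<t} x"
    unfolding esym_def using assms
    by (intro sum_mono2 prod_nonneg finite_subsets_card) (auto simp: x_def)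
  also have "\<dots> \<le> (card {..<t} choose s) * (sum x {..<t} / card {..<t}) ^ s"
    using False by (intro maclaurin_esym) (auto simp: x_def)
  also have "sum x {..<t} = (\<Sum>i<j. 1)"
    using assms unfolding x_def by (intro sum.mono_neutral_cong_right) auto
  finally show ?thesis by simp
qed (use assms in \<open>cases s; auto\<close>)

lemma esym_le_choose:
  fixes x :: "'i \<Rightarrow> real"
  assumes "finite I" "card I \<le> t" "\<And>i. i \<in> I \<Longrightarrow> 0 \<le> x i"
  shows "esym s I x \<le> (t choose s) * (sum x I / t) ^ s"
proof (cases "I = {}")
  case False
  then have card: "card I > 0" using assms(1) by (simp add: card_gt_0_iff)
  have "esym s I x \<le> (card I choose s) * (sum x I / card I) ^ s"
    using assms False by (intro maclaurin_esym) auto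
  also have "\<dots> \<le> ((t choose s) * (card I / t) ^ s) * (sum x I / card I) ^ s"
    using binomial_le_binomial_times_ratio_power[OF assms(2)] assms(3)
    by (intro mult_right_mono zero_le_power divide_nonneg_nonneg sum_nonneg) auto
  also have "\<dots> = (t choose s) * (sum x I / t) ^ s"
    using card by (simp add: power_divide)
  finally show ?thesis .
qed (cases s; simp)

section \<open>The Motzkin--Straus bound\<close>

definition edge_sum :: "'a set set \<Rightarrow> ('a \<Rightarrow> 'b::comm_semiring_1) \<Rightarrow> 'b" where
  "edge_sum E x = (\<Sum>e\<in>E. \<Prod>v\<in>e. x v)"

definition adjacent :: "'a hgraph \<Rightarrow> 'a \<Rightarrow> 'a \<Rightarrow> bool" where
  "adjacent H u v \<longleftrightarrow> u \<noteq> v \<and> (\<exists>e\<in>hedges H. u \<in> e \<and> v \<in> e)"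

definition neighbours :: "'a hgraph \<Rightarrow> 'a \<Rightarrow> 'a set" where
  "neighbours H v = {u. adjacent H v u}"

definition hdegree :: "'a hgraph \<Rightarrow> 'a \<Rightarrow> nat" where
  "hdegree H v = card {e\<in>hedges H. v \<in> e}"

definition link :: "'a hgraph \<Rightarrow> 'a \<Rightarrow> 'a hgraph" where
  "link H v = (neighbours H v, (\<lambda>e. e - {v}) ` {e\<in>hedges H. v \<in> e})"

definition delete_vertex :: "'a \<Rightarrow> 'a hgraph \<Rightarrow> 'a hgraph" where
  "delete_vertex v H = (hverts H - {v}, {e\<in>hedges H. v \<notin> e})"

definition clique :: "'a hgraph \<Rightarrow> 'a set \<Rightarrow> bool" where
  "clique H K \<longleftrightarrow> K \<subseteq> hverts H \<and> pairwise (adjacent H) K"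

definition edge_cliques_bounded :: "nat \<Rightarrow> 'a hgraph \<Rightarrow> bool" where
  "edge_cliques_bounded k H \<longleftrightarrow> (\<forall>K e. clique H K \<longrightarrow> e \<in> hedges H \<longrightarrow> e \<subseteq> K \<longrightarrow> card K \<le> k)"

lemma r_graph_finite_verts: "r_graph r H \<Longrightarrow> finite (hverts H)"
  by (simp add: r_graph_def)

lemma r_graph_edge:
  assumes "r_graph r H" "e \<in> hedges H"
  shows "e \<subseteq> hverts H" "card e = r" "finite e"
  using assms by (auto simp: r_graph_def intro: finite_subset)

lemma r_graph_finite_edges: "r_graph r H \<Longrightarrow> finite (hedges H)"
  by (rule finite_subset[of _ "Pow (hverts H)"]) (auto simp: r_graph_def)

lemma adjacent_irrefl [simp]: "\<not> adjacent H v v"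
  by (simp add: adjacent_def)

lemma adjacent_sym: "adjacent H u v \<Longrightarrow> adjacent H v u"
  by (auto simp: adjacent_def)

lemma adjacent_in_verts: "r_graph r H \<Longrightarrow> adjacent H u v \<Longrightarrow> u \<in> hverts H \<and> v \<in> hverts H"
  by (auto simp: adjacent_def r_graph_def)

lemma neighbours_subset: "r_graph r H \<Longrightarrow> neighbours H v \<subseteq> hverts H"
  by (auto simp: neighbours_def dest: adjacent_in_verts)

lemma edge_clique: "r_graph r H \<Longrightarrow> e \<in> hedges H \<Longrightarrow> clique H e"
  by (auto simp: clique_def r_graph_edge pairwise_def adjacent_def)

lemma finite_clique: "r_graph r H \<Longrightarrow> clique H K \<Longrightarrow> finite K"
  by (auto simp: clique_def r_graph_def intro: finite_subset)

lemma clique_insert: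
  assumes "clique H K" "w \<in> hverts H" "\<And>u. u \<in> K \<Longrightarrow> adjacent H u w"
  shows "clique H (insert w K)"
  using assms by (auto simp: clique_def pairwise_insert intro: adjacent_sym)

lemma inj_on_remove: "inj_on (\<lambda>e. e - {v}) {e\<in>E. v \<in> e}"
  by (auto simp: inj_on_def)

lemma card_link_edges: "card (hedges (link H v)) = hdegree H v"
  by (simp add: link_def hdegree_def card_image inj_on_remove)

lemma r_graph_link:
  assumes "r_graph r H"
  shows "r_graph (r - 1) (link H v)"
  using assms finite_subset[OF neighbours_subset[OF assms] r_graph_finite_verts[OF assms]]
  by (auto simp: r_graph_def link_def neighbours_def adjacent_def card_Diff_singleton)

lemma edge_sum_split_vertex:
  assumes "r_graph r H"
  shows "edge_sum (hedges H) x
    = edge_sum (hedges (delete_vertex v H)) x + x v * edge_sum (hedges (link H v)) x"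
proof -
  have "edge_sum (hedges H) x = edge_sum {e\<in>hedges H. v \<notin> e} x + edge_sum {e\<in>hedges H. v \<in> e} x"
    unfolding edge_sum_def using r_graph_finite_edges[OF assms]
    by (subst sum.union_disjoint[symmetric]) (auto intro: sum.cong)
  also have "edge_sum {e\<in>hedges H. v \<in> e} x = (\<Sum>e\<in>{e\<in>hedges H. v \<in> e}. x v * prod x (e - {v}))"
    unfolding edge_sum_def using r_graph_edge(3)[OF assms] by (intro sum.cong refl prod.remove) auto
  also have "\<dots> = x v * edge_sum (hedges (link H v)) x"
    by (simp add: edge_sum_def link_def sum.reindex[OF inj_on_remove] sum_distrib_left)
  finally show ?thesis by (simp add: delete_vertex_def)
qed

lemma edge_sum_cong:
  assumes "\<And>e v. e \<in> E \<Longrightarrow> v \<in> e \<Longrightarrow> x v = y v"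
  shows "edge_sum E x = edge_sum E y"
  unfolding edge_sum_def using assms by (intro sum.cong prod.cong refl) auto

lemma edge_sum_link_cong:
  assumes "\<And>w. w \<noteq> v \<Longrightarrow> adjacent H v w \<Longrightarrow> x w = y w"
  shows "edge_sum (hedges (link H v)) x = edge_sum (hedges (link H v)) y"
  using assms by (intro edge_sum_cong) (auto simp: link_def adjacent_def)

text \<open>Between two non-adjacent vertices the form is linear along the segment that moves weight from
  one to the other.\<close>

lemma edge_sum_move_weight_le:
  fixes x :: "'a \<Rightarrow> 'b::linordered_idom"
  assumes H: "r_graph r H" and uv: "u \<noteq> v" "\<not> adjacent H u v" and "0 \<le> x v"
    and le: "edge_sum (hedges (link H v)) x \<le> edge_sum (hedges (link H u)) x"
  shows "edge_sum (hedges H) x \<le> edge_sum (hedges H) (x(u := x u + x v, v := 0))"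
proof -
  define y where "y = x(u := x u + x v, v := 0)"
  define rest where "rest z = edge_sum (hedges (delete_vertex u (delete_vertex v H))) z"
    for z :: "'a \<Rightarrow> 'b"
  have "r_graph r (delete_vertex v H)" using H by (auto simp: r_graph_def delete_vertex_def)
  moreover have "hedges (link (delete_vertex v H) u) = hedges (link H u)"
    using uv by (auto simp: link_def delete_vertex_def adjacent_def)
  ultimately have split: "edge_sum (hedges H) z = rest z + z u * edge_sum (hedges (link H u)) z
      + z v * edge_sum (hedges (link H v)) z" for z :: "'a \<Rightarrow> 'b"
    unfolding rest_def using edge_sum_split_vertex[OF H, of z v]
      edge_sum_split_vertex[of r "delete_vertex v H" z u] by simp
  have "rest y = rest x"
    unfolding rest_def by (intro edge_sum_cong) (auto simp: delete_vertex_def y_def)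
  moreover have "edge_sum (hedges (link H u)) y = edge_sum (hedges (link H u)) x"
    using uv by (intro edge_sum_link_cong) (auto simp: y_def)
  moreover have "x v * edge_sum (hedges (link H v)) x \<le> x v * edge_sum (hedges (link H u)) x"
    using le assms(4) by (rule mult_left_mono)
  ultimately have "edge_sum (hedges H) x \<le> edge_sum (hedges H) y"
    using uv unfolding split[of x] split[of y] by (simp add: y_def distrib_right)
  then show ?thesis unfolding y_def .
qed

lemma exists_clique_supported_weights:
  fixes x :: "'a \<Rightarrow> 'b::linordered_idom"
  assumes H: "r_graph r H" and "\<And>v. v \<in> hverts H \<Longrightarrow> 0 \<le> x v"
  shows "\<exists>y. (\<forall>v\<in>hverts H. 0 \<le> y v) \<and> sum y (hverts H) = sum x (hverts H) \<and>
    edge_sum (hedges H) x \<le> edge_sum (hedges H) y \<and> clique H {v\<in>hverts H. y v \<noteq> 0}"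
  using assms(2)
proof (induction "card {v\<in>hverts H. x v \<noteq> 0}" arbitrary: x rule: less_induct)
  case less
  note fin = r_graph_finite_verts[OF H]
  show ?case
  proof (cases "clique H {v\<in>hverts H. x v \<noteq> 0}")
    case True
    then show ?thesis using less.prems by (intro exI[of _ x]) auto
  next
    case False
    then obtain u v where "u \<in> hverts H" "v \<in> hverts H" "x u \<noteq> 0" "x v \<noteq> 0" "u \<noteq> v"
      "\<not> adjacent H u v"
      unfolding clique_def pairwise_def by auto
    then obtain u v where uv: "u \<in> hverts H" "v \<in> hverts H" "x u \<noteq> 0" "x v \<noteq> 0" "u \<noteq> v"
      "\<not> adjacent H u v" "edge_sum (hedges (link H v)) x \<le> edge_sum (hedges (link H u)) x"
      by (metis adjacent_sym linear)
    define y where "y = x(u := x u + x v, v := 0)"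
    have nonneg: "0 \<le> y w" if "w \<in> hverts H" for w
      using less.prems that uv(1,2) by (auto simp: y_def)
    have sum: "sum y (hverts H) = sum x (hverts H)"
      using uv fin by (simp add: sum_eq_pair_plus_rest[of _ u v] y_def add.assoc)
    have le: "edge_sum (hedges H) x \<le> edge_sum (hedges H) y"
      unfolding y_def using edge_sum_move_weight_le[OF H uv(5,6) less.prems[OF uv(2)] uv(7)] .
    have "{w\<in>hverts H. y w \<noteq> 0} \<subset> {w\<in>hverts H. x w \<noteq> 0}"
      using uv by (auto simp: y_def split: if_splits)
    then have "card {w\<in>hverts H. y w \<noteq> 0} < card {w\<in>hverts H. x w \<noteq> 0}"
      using fin by (intro psubset_card_mono) auto
    from less.hyps[OF this nonneg] show ?thesis
      using sum le by (metis (no_types, lifting) order_trans)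
  qed
qed

theorem motzkin_straus:
  fixes x :: "'a \<Rightarrow> real"
  assumes H: "r_graph r H" and bound: "edge_cliques_bounded t H"
    and nonneg: "\<And>v. v \<in> hverts H \<Longrightarrow> 0 \<le> x v"
  shows "edge_sum (hedges H) x \<le> (t choose r) * (sum x (hverts H) / t) ^ r"
proof -
  note fin = r_graph_finite_verts[OF H]
  obtain y where y: "\<forall>v\<in>hverts H. 0 \<le> y v" "sum y (hverts H) = sum x (hverts H)"
    "edge_sum (hedges H) x \<le> edge_sum (hedges H) y" "clique H {v\<in>hverts H. y v \<noteq> 0}"
    using exists_clique_supported_weights[where x = x, OF H nonneg] by blast
  define S where "S = {v\<in>hverts H. y v \<noteq> 0}"
  have "finite S" using fin by (simp add: S_def)
  have "edge_sum (hedges H) y = edge_sum {e\<in>hedges H. e \<subseteq> S} y"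
    unfolding edge_sum_def using r_graph_edge[OF H] r_graph_finite_edges[OF H]
    by (intro sum.mono_neutral_right) (auto simp: S_def)
  also have "\<dots> \<le> (t choose r) * (sum y (hverts H) / t) ^ r"
  proof (cases "\<exists>e\<in>hedges H. e \<subseteq> S")
    case True
    then have "card S \<le> t" using bound y(4) by (auto simp: edge_cliques_bounded_def S_def)
    have "edge_sum {e\<in>hedges H. e \<subseteq> S} y \<le> esym r S y"
      unfolding esym_def edge_sum_def using \<open>finite S\<close> r_graph_edge(2)[OF H] y(1)
      by (intro sum_mono2 prod_nonneg finite_subsets_card) (auto simp: S_def)
    also have "\<dots> \<le> (t choose r) * (sum y S / t) ^ r"
      using \<open>finite S\<close> \<open>card S \<le> t\<close> y(1) by (intro esym_le_choose) (auto simp: S_def)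
    also have "sum y S = sum y (hverts H)"
      using fin by (intro sum.mono_neutral_left) (auto simp: S_def)
    finally show ?thesis .
  next
    case False
    then have "edge_sum {e\<in>hedges H. e \<subseteq> S} y = 0"
      unfolding edge_sum_def by (intro sum.neutral) auto
    then show ?thesis using sum_nonneg[of "hverts H" y] y(1) by simp
  qed
  finally show ?thesis using y(2,3) by simp
qed

lemma edge_cliques_bounded_link:
  assumes H: "r_graph r H" and bound: "edge_cliques_bounded k H" and v: "v \<in> hverts H"
  shows "edge_cliques_bounded (k - 1) (link H v)"
  unfolding edge_cliques_bounded_def
proof (intro allI impI)
  fix K e assume K: "clique (link H v) K" and e: "e \<in> hedges (link H v)" "e \<subseteq> K"
  have nbr: "adjacent H v u" if "u \<in> K" for u
    using K that by (auto simp: clique_def link_def neighbours_def)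
  have "adjacent H u w" if "adjacent (link H v) u w" for u w
    using that by (auto simp: adjacent_def link_def)
  then have "clique H K"
    using K adjacent_in_verts[OF H nbr] by (auto simp: clique_def pairwise_def)
  then have "clique H (insert v K)" using v nbr by (auto intro: clique_insert adjacent_sym)
  moreover have "insert v e \<in> hedges H" using e by (auto simp: link_def insert_absorb)
  ultimately have "card (insert v K) \<le> k"
    using bound e(2) by (auto simp: edge_cliques_bounded_def)
  moreover have "v \<notin> K" using nbr by (auto simp: adjacent_def)
  ultimately show "card K \<le> k - 1" using finite_clique[OF H \<open>clique H K\<close>] by simp
qed

lemma degree_le_neighbours_power:
  assumes "r_graph r H" "edge_cliques_bounded k H" "v \<in> hverts H"
  shows "real (hdegree H v)
    \<le> ((k - 1) choose (r - 1)) * (card (neighbours H v) / real (k - 1)) ^ (r - 1)"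
  using motzkin_straus[OF r_graph_link edge_cliques_bounded_link, OF assms(1) assms, of "\<lambda>_. 1"]
  by (simp add: edge_sum_def card_link_edges) (simp add: link_def)

section \<open>Near-partitions from large minimum degree\<close>

definition nonneighbours :: "'a hgraph \<Rightarrow> 'a \<Rightarrow> 'a set" where
  "nonneighbours H v = hverts H - neighbours H v"

lemma nonneighbours_iff: "u \<in> nonneighbours H v \<longleftrightarrow> u \<in> hverts H \<and> \<not> adjacent H v u"
  by (auto simp: nonneighbours_def neighbours_def)

definition colour_class :: "'a set \<Rightarrow> ('a \<Rightarrow> 'c) \<Rightarrow> 'c \<Rightarrow> 'a set" where
  "colour_class V c i = {v\<in>V. c v = i}"

definition missing_neighbours :: "'a hgraph \<Rightarrow> ('a \<Rightarrow> 'c) \<Rightarrow> 'a \<Rightarrow> 'a set" where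
  "missing_neighbours H c v = {u \<in> nonneighbours H v. c u \<noteq> c v}"

definition near_partition :: "nat \<Rightarrow> real \<Rightarrow> real \<Rightarrow> 'a hgraph \<Rightarrow> ('a \<Rightarrow> nat) \<Rightarrow> bool" where
  "near_partition k a s H c \<longleftrightarrow>
     c ` hverts H \<subseteq> {..<k} \<and> (\<forall>u v. adjacent H u v \<longrightarrow> c u \<noteq> c v) \<and>
     (\<forall>v\<in>hverts H. real (card (missing_neighbours H c v)) \<le> s) \<and>
     (\<forall>i<k. a - s \<le> real (card (colour_class (hverts H) c i)))"

lemma
  fixes a s :: real
  assumes "near_partition k a s H c"
  shows near_partition_range: "c ` hverts H \<subseteq> {..<k}"
    and near_partition_proper: "adjacent H u v \<Longrightarrow> c u \<noteq> c v"
    and near_partition_missing: "v \<in> hverts H \<Longrightarrow> card (missing_neighbours H c v) \<le> s"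
    and near_partition_class: "i < k \<Longrightarrow> a - s \<le> card (colour_class (hverts H) c i)"
  using assms by (auto simp: near_partition_def)

lemma near_partition_mono:
  assumes "near_partition k a s H c" "s \<le> t"
  shows "near_partition k a t H c"
  using assms unfolding near_partition_def by (smt (verit))

lemma card_UN_le_mult:
  fixes b :: real
  assumes "finite S" "\<And>u. u \<in> S \<Longrightarrow> card (B u) \<le> b"
  shows "card (\<Union>u\<in>S. B u) \<le> card S * b"
proof -
  have "real (card (\<Union>u\<in>S. B u)) \<le> real (\<Sum>u\<in>S. card (B u))"
    using card_UN_le[OF assms(1), of B] by (rule of_nat_mono)
  also have "\<dots> = (\<Sum>u\<in>S. real (card (B u)))" by simp
  also have "\<dots> \<le> card S * b" using assms(2) by (rule sum_bounded_above)
  finally show ?thesis .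
qed

locale few_nonneighbours =
  fixes r k :: nat and H :: "'a hgraph" and a d :: real
  assumes r_graph: "r_graph r H" and r_le_k: "r \<le> k" and k_pos: "0 < k"
    and edge_cliques: "edge_cliques_bounded k H"
    and verts_nonempty: "hverts H \<noteq> {}"
    and edge_cover: "v \<in> hverts H \<Longrightarrow> \<exists>e\<in>hedges H. v \<in> e"
    and card_nonneighbours_le: "v \<in> hverts H \<Longrightarrow> card (nonneighbours H v) \<le> a + d"
    and card_verts_ge: "k * a - d \<le> card (hverts H)"
    and d_nonneg: "0 \<le> d" and d_small: "(real k + 1) ^ 3 * d < a"
begin

abbreviation "V \<equiv> hverts H"
abbreviation "N \<equiv> nonneighbours H"

definition D :: real where "D = (real k + 1) * d"

lemma D_nonneg: "0 \<le> D" and d_le_D: "d \<le> D" and D_small: "k * (k * D) + 2 * (k * D) + D < a"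
proof -
  show "0 \<le> D" "d \<le> D"
    using d_nonneg mult_right_mono[of 1 "real k + 1" d] by (simp_all add: D_def)
  show "k * (k * D) + 2 * (k * D) + D < a"
    using d_small by (simp add: D_def power3_eq_cube algebra_simps)
qed

lemma kD_nonneg: "0 \<le> k * D" "0 \<le> k * (k * D)"
  using D_nonneg by auto

lemma a_pos: "0 < a"
  using D_small D_nonneg kD_nonneg by linarith

lemma finite_verts: "finite V"
  using r_graph by (rule r_graph_finite_verts)

lemma nonneighbours_subset: "N v \<subseteq> V"
  by (auto simp: nonneighbours_def)

lemma finite_nonneighbours: "finite (N v)"
  using finite_verts by (simp add: nonneighbours_def)

lemma nonneighbours_sym: "u \<in> N v \<Longrightarrow> v \<in> V \<Longrightarrow> v \<in> N u"
  by (auto simp: nonneighbours_iff dest: adjacent_sym)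

lemma card_UN_nonneighbours_le: "K \<subseteq> V \<Longrightarrow> card (\<Union>v\<in>K. N v) \<le> card K * (a + d)"
  using card_nonneighbours_le finite_subset[OF _ finite_verts] by (intro card_UN_le_mult) auto

lemma clique_extensible:
  assumes K: "clique H K" "card K < k"
  obtains w where "w \<in> V" "w \<notin> K" "clique H (insert w K)"
proof -
  have "real (card (\<Union>v\<in>K. N v)) \<le> card K * (a + d)"
    using K by (intro card_UN_nonneighbours_le) (simp add: clique_def)
  also have "\<dots> \<le> (real k - 1) * (a + d)"
    using K a_pos d_nonneg by (intro mult_right_mono) auto
  also have "\<dots> = k * a + k * d - a - d" by (simp add: algebra_simps)
  also have "\<dots> < card V"
    using card_verts_ge mult_left_mono[OF d_le_D, of "real k"] D_small kD_nonneg D_nonneg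
    by linarith
  finally have "(\<Union>v\<in>K. N v) \<noteq> V" by auto
  then obtain w where w: "w \<in> V" "w \<notin> (\<Union>v\<in>K. N v)" using nonneighbours_subset by blast
  then have "adjacent H u w" if "u \<in> K" for u using that by (auto simp: nonneighbours_iff)
  then show ?thesis using that[of w] w(1) clique_insert[OF K(1)] by (auto simp: adjacent_def)
qed

lemma edge_in_k_clique:
  assumes "e \<in> hedges H"
  obtains Q where "clique H Q" "e \<subseteq> Q" "card Q = k"
proof -
  have "\<exists>Q. clique H Q \<and> e \<subseteq> Q \<and> card Q = k"
    using r_le_k
  proof (induction rule: dec_induct)
    case base
    show ?case using edge_clique[OF r_graph assms] r_graph_edge[OF r_graph assms] by blast
  next
    case (step j)
    then obtain K where K: "clique H K" "e \<subseteq> K" "card K = j" by auto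
    then obtain w where "w \<notin> K" "clique H (insert w K)"
      using clique_extensible step.hyps by metis
    then show ?case
      using K finite_clique[OF r_graph K(1)] by (intro exI[of _ "insert w K"]) auto
  qed
  then show ?thesis using that by blast
qed

lemma UN_nonneighbours_k_clique:
  assumes Q: "clique H Q" "card Q = k" and e: "e \<in> hedges H" "e \<subseteq> Q"
  shows "(\<Union>v\<in>Q. N v) = V"
proof (rule ccontr)
  assume "(\<Union>v\<in>Q. N v) \<noteq> V"
  then obtain w where w: "w \<in> V" "w \<notin> (\<Union>v\<in>Q. N v)" using nonneighbours_subset by blast
  then have adj: "adjacent H u w" if "u \<in> Q" for u using that by (auto simp: nonneighbours_iff)
  then have "clique H (insert w Q)" using Q(1) w(1) by (intro clique_insert)
  then have "card (insert w Q) \<le> k"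
    using edge_cliques e by (auto simp: edge_cliques_bounded_def)
  moreover have "w \<notin> Q" using adj by (auto simp: adjacent_def)
  ultimately show False using Q finite_clique[OF r_graph Q(1)] by simp
qed

lemma card_UN_nonneighbours_ge:
  assumes Q: "clique H Q" "card Q = k" and cover: "(\<Union>v\<in>Q. N v) = V" and S: "S \<subseteq> Q"
  shows "card S * (a + d) - D \<le> card (\<Union>v\<in>S. N v)"
proof -
  have fin: "finite Q" "finite S" using finite_clique[OF r_graph Q(1)] S finite_subset by auto
  have "V = (\<Union>v\<in>S. N v) \<union> (\<Union>v\<in>Q - S. N v)" using cover S by blast
  then have "card V \<le> card (\<Union>v\<in>S. N v) + card (\<Union>v\<in>Q - S. N v)" by (metis card_Un_le)
  moreover have "real (card (\<Union>v\<in>Q - S. N v)) \<le> card (Q - S) * (a + d)"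
    using Q by (intro card_UN_nonneighbours_le) (auto simp: clique_def)
  moreover have "real (card (Q - S)) = real k - card S"
    using fin S Q(2) card_mono[OF fin(1) S] by (simp add: card_Diff_subset of_nat_diff)
  ultimately show ?thesis
    using card_verts_ge by (simp add: D_def algebra_simps)
qed

lemma card_nonneighbours_ge:
  assumes "v \<in> V"
  shows "a + d - D \<le> card (N v)"
proof -
  obtain e where e: "e \<in> hedges H" "v \<in> e" using edge_cover[OF assms] by auto
  then obtain Q where Q: "clique H Q" "e \<subseteq> Q" "card Q = k" using edge_in_k_clique by metis
  then show ?thesis
    using card_UN_nonneighbours_ge[OF Q(1,3) UN_nonneighbours_k_clique, of e "{v}"] e by auto
qed

lemma card_common_nonneighbours_le:
  assumes "adjacent H u v"
  shows "card (N u \<inter> N v) \<le> D"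
proof -
  obtain e where e: "e \<in> hedges H" "u \<in> e" "v \<in> e" "u \<noteq> v" using assms by (auto simp: adjacent_def)
  then obtain Q where Q: "clique H Q" "e \<subseteq> Q" "card Q = k" using edge_in_k_clique by metis
  have uv: "u \<in> V" "v \<in> V" using adjacent_in_verts[OF r_graph assms] by auto
  have "2 * (a + d) - D \<le> card (N u \<union> N v)"
    using card_UN_nonneighbours_ge[OF Q(1,3) UN_nonneighbours_k_clique, of e "{u, v}"] e Q by auto
  moreover have "real (card (N u \<union> N v)) + card (N u \<inter> N v) = real (card (N u)) + card (N v)"
    using card_Un_Int[of "N u" "N v"] finite_nonneighbours by (simp flip: of_nat_add)
  ultimately show ?thesis
    using card_nonneighbours_le[OF uv(1)] card_nonneighbours_le[OF uv(2)]
    by (simp add: algebra_simps)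
qed

text \<open>Fix a \<open>k\<close>-clique \<open>Q\<close> without a common neighbour. The vertices whose only non-neighbour in
  \<open>Q\<close> is \<open>q\<close> make up almost all of the class of \<open>q\<close>; every vertex misses all of them for some
  \<open>q\<close>, which becomes its colour.\<close>

context
  fixes Q :: "'a set"
  assumes Q: "clique H Q" "card Q = k" and cover: "(\<Union>v\<in>Q. N v) = V"
begin

definition typical :: "'a \<Rightarrow> 'a set" where
  "typical q = {w\<in>V. N w \<inter> Q = {q}}"

lemma Q_subset: "Q \<subseteq> V" and finite_Q: "finite Q"
  using Q finite_clique[OF r_graph] by (auto simp: clique_def)

lemma Q_adjacent: "q \<in> Q \<Longrightarrow> q' \<in> Q \<Longrightarrow> q \<noteq> q' \<Longrightarrow> adjacent H q q'"
  using Q by (auto simp: clique_def pairwise_def)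

lemma card_Q_remove: "q \<in> Q \<Longrightarrow> real (card (Q - {q})) = real k - 1"
  using Q(2) k_pos finite_Q by (simp add: of_nat_diff)

lemma typical_self:
  assumes q: "q \<in> Q"
  shows "q \<in> typical q"
proof -
  have "q \<in> N q" using q Q_subset by (auto simp: nonneighbours_iff)
  moreover have "q' \<notin> N q" if "q' \<in> Q" "q' \<noteq> q" for q'
    using Q_adjacent q that by (auto simp: nonneighbours_iff)
  ultimately show ?thesis using q Q_subset unfolding typical_def by blast
qed

lemma typical_adjacent:
  assumes "w \<in> typical q" "q' \<in> Q" "q' \<noteq> q"
  shows "adjacent H w q'"
proof -
  have "q' \<notin> N w" "q' \<in> V" using assms Q_subset unfolding typical_def by blast+
  then show ?thesis by (simp add: nonneighbours_iff)
qed

lemma finite_typical: "finite (typical q)"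
  using finite_verts by (simp add: typical_def)

lemma card_typical_ge:
  assumes q: "q \<in> Q"
  shows "a - k * D \<le> card (typical q)"
proof -
  have "N q \<subseteq> typical q \<union> (\<Union>q'\<in>Q - {q}. N q \<inter> N q')"
  proof
    fix w assume w: "w \<in> N q"
    then have "w \<in> V" "q \<in> N w" using q Q_subset nonneighbours_subset nonneighbours_sym by auto
    moreover have "w \<in> N q'" if "q' \<in> N w" for q' using that \<open>w \<in> V\<close> by (rule nonneighbours_sym)
    ultimately show "w \<in> typical q \<union> (\<Union>q'\<in>Q - {q}. N q \<inter> N q')"
      using w q by (auto simp: typical_def)
  qed
  then have "card (N q) \<le> card (typical q \<union> (\<Union>q'\<in>Q - {q}. N q \<inter> N q'))"
    using finite_typical finite_Q finite_nonneighbours by (intro card_mono) auto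
  also have "\<dots> \<le> card (typical q) + card (\<Union>q'\<in>Q - {q}. N q \<inter> N q')" by (rule card_Un_le)
  finally have "real (card (N q)) \<le> card (typical q) + card (\<Union>q'\<in>Q - {q}. N q \<inter> N q')"
    by linarith
  moreover have "card (\<Union>q'\<in>Q - {q}. N q \<inter> N q') \<le> card (Q - {q}) * D"
    using finite_Q q Q_adjacent card_common_nonneighbours_le by (intro card_UN_le_mult) auto
  moreover have "a + d - D \<le> card (N q)" using card_nonneighbours_ge q Q_subset by blast
  ultimately show ?thesis
    using d_nonneg by (simp add: card_Q_remove[OF q] algebra_simps)
qed

lemma card_nonneighbours_diff_typical_le:
  assumes q: "q \<in> Q" and w: "w \<in> typical q"
  shows "card (N q - N w) \<le> k * D"
proof -
  have w_V: "w \<in> V" using w by (simp add: typical_def)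
  have "N w - N q \<subseteq> (\<Union>q'\<in>Q - {q}. N w \<inter> N q')" using cover nonneighbours_subset by blast
  then have "card (N w - N q) \<le> card (\<Union>q'\<in>Q - {q}. N w \<inter> N q')"
    using finite_Q finite_nonneighbours by (intro card_mono) auto
  moreover have "card (\<Union>q'\<in>Q - {q}. N w \<inter> N q') \<le> card (Q - {q}) * D"
    using finite_Q card_common_nonneighbours_le typical_adjacent[OF w]
    by (intro card_UN_le_mult) auto
  ultimately have diff: "card (N w - N q) \<le> (real k - 1) * D" using card_Q_remove[OF q] by simp
  have "card (N q - N w) + card (N q \<inter> N w) = card (N q)"
    "card (N w - N q) + card (N q \<inter> N w) = card (N w)"
    by (metis Diff_Int2 Int_commute Un_Diff_Int card_Un_disjoint finite_Diff finite_Int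
        finite_nonneighbours Diff_disjoint Int_assoc inf_bot_right)+
  then have "real (card (N q - N w)) = card (N q) - real (card (N w)) + card (N w - N q)"
    by linarith
  also have "\<dots> \<le> (a + d) - (a + d - D) + (real k - 1) * D"
    using diff card_nonneighbours_le[of q] card_nonneighbours_ge[OF w_V] q Q_subset by auto
  finally show ?thesis by (simp add: algebra_simps)
qed

lemma card_nonneighbours_Int_le:
  assumes q: "q \<in> Q" and w: "w \<in> typical q" and v: "adjacent H v w"
  shows "card (N v \<inter> N q) \<le> (real k + 1) * D"
proof -
  have "card (N v \<inter> N q) \<le> card ((N v \<inter> N w) \<union> (N q - N w))"
    using finite_nonneighbours by (intro card_mono) auto
  also have "\<dots> \<le> card (N v \<inter> N w) + card (N q - N w)" by (rule card_Un_le)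
  finally have "real (card (N v \<inter> N q)) \<le> card (N v \<inter> N w) + card (N q - N w)" by linarith
  then show ?thesis
    using card_common_nonneighbours_le[OF v] card_nonneighbours_diff_typical_le[OF q w]
    by (simp add: algebra_simps)
qed

lemma misses_typical_class:
  assumes v: "v \<in> V"
  shows "\<exists>q\<in>Q. typical q \<subseteq> N v"
proof (rule ccontr)
  assume "\<not> (\<exists>q\<in>Q. typical q \<subseteq> N v)"
  then have w: "\<exists>w\<in>typical q. adjacent H v w" if "q \<in> Q" for q
    using that by (auto simp: nonneighbours_iff typical_def)
  have "N v \<subseteq> (\<Union>q\<in>Q. N v \<inter> N q)" using cover nonneighbours_subset by blast
  then have "card (N v) \<le> card (\<Union>q\<in>Q. N v \<inter> N q)"
    using finite_Q finite_nonneighbours by (intro card_mono) auto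
  moreover have "card (\<Union>q\<in>Q. N v \<inter> N q) \<le> card Q * ((real k + 1) * D)"
    using finite_Q w card_nonneighbours_Int_le by (intro card_UN_le_mult) blast+
  ultimately have "card (N v) \<le> k * ((real k + 1) * D)" using Q by simp
  then show False
    using card_nonneighbours_ge[OF v] D_small kD_nonneg d_nonneg by (simp add: algebra_simps)
qed

lemma adjacent_not_both_miss_typical:
  assumes "adjacent H u v" "q \<in> Q" "typical q \<subseteq> N u"
  shows "\<not> typical q \<subseteq> N v"
proof
  assume "typical q \<subseteq> N v"
  then have "card (typical q) \<le> card (N u \<inter> N v)"
    using assms(3) finite_nonneighbours by (intro card_mono) auto
  then show False
    using card_common_nonneighbours_le[OF assms(1)] card_typical_ge[OF assms(2)] D_small kD_nonneg
    by linarith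
qed

lemma typical_misses_only_own_class:
  assumes "w \<in> typical q" "q' \<in> Q" "typical q' \<subseteq> N w"
  shows "q' = q"
proof (rule ccontr)
  assume "q' \<noteq> q"
  then have "adjacent H w q'" using typical_adjacent assms by blast
  moreover have "q' \<in> N w" using typical_self assms by blast
  ultimately show False by (simp add: nonneighbours_iff)
qed

lemma card_nonneighbours_minus_typical_le:
  assumes "v \<in> V" "q \<in> Q" "typical q \<subseteq> N v"
  shows "card (N v - typical q) \<le> (real k + 1) * D"
proof -
  have "real (card (N v - typical q)) = card (N v) - real (card (typical q))"
    using finite_typical finite_nonneighbours assms(3) card_mono[OF _ assms(3)]
    by (simp add: card_Diff_subset of_nat_diff)
  then show ?thesis
    using card_nonneighbours_le[OF assms(1)] card_typical_ge[OF assms(2)] d_le_D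
    by (simp add: algebra_simps)
qed

lemma near_partition_of_clique: "\<exists>c. near_partition k a ((real k + 1)\<^sup>2 * d) H c"
proof -
  obtain q where q: "\<And>v. v \<in> V \<Longrightarrow> q v \<in> Q \<and> typical (q v) \<subseteq> N v"
    using misses_typical_class by metis
  obtain h where h: "bij_betw h Q {..<k}"
    using finite_same_card_bij[of Q "{..<k}"] finite_Q Q(2) by auto
  then have h_eq: "h x = h y \<longleftrightarrow> x = y" if "x \<in> Q" "y \<in> Q" for x y
    using that by (auto simp: bij_betw_def inj_on_def)
  have slack: "(real k + 1)\<^sup>2 * d = (real k + 1) * D" by (simp add: D_def power2_eq_square)
  have typical_colour: "q w = x" if "w \<in> typical x" for w x
    using typical_misses_only_own_class that q by (auto simp: typical_def)
  have "near_partition k a ((real k + 1)\<^sup>2 * d) H (\<lambda>v. h (q v))"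
    unfolding near_partition_def slack
  proof (intro conjI allI impI ballI)
    show "(\<lambda>v. h (q v)) ` V \<subseteq> {..<k}" using h q by (auto simp: bij_betw_def)
    show "h (q u) \<noteq> h (q v)" if "adjacent H u v" for u v
      using adjacent_not_both_miss_typical[OF that] q adjacent_in_verts[OF r_graph that] h_eq
      by metis
    show "card (missing_neighbours H (\<lambda>v. h (q v)) v) \<le> (real k + 1) * D" if v: "v \<in> V" for v
    proof -
      have "missing_neighbours H (\<lambda>v. h (q v)) v \<subseteq> N v - typical (q v)"
        using typical_colour by (auto simp: missing_neighbours_def)
      then have "card (missing_neighbours H (\<lambda>v. h (q v)) v) \<le> card (N v - typical (q v))"
        using finite_nonneighbours by (intro card_mono) auto
      then show ?thesis using card_nonneighbours_minus_typical_le[OF v] q[OF v] by fastforce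
    qed
    show "a - (real k + 1) * D \<le> card (colour_class V (\<lambda>v. h (q v)) i)" if "i < k" for i
    proof -
      have "i \<in> h ` Q" using h that by (simp add: bij_betw_def)
      then obtain x where x: "x \<in> Q" "i = h x" by blast
      then have "typical x \<subseteq> colour_class V (\<lambda>v. h (q v)) i"
        using typical_colour by (auto simp: colour_class_def typical_def)
      then have "card (typical x) \<le> card (colour_class V (\<lambda>v. h (q v)) i)"
        using finite_verts by (intro card_mono) (auto simp: colour_class_def)
      then show ?thesis using card_typical_ge[OF x(1)] D_nonneg by (simp add: algebra_simps)
    qed
  qed
  then show ?thesis by blast
qed

end

theorem exists_near_partition: "\<exists>c. near_partition k a ((real k + 1)\<^sup>2 * d) H c"
proof -
  obtain e where e: "e \<in> hedges H" using verts_nonempty edge_cover by blast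
  then obtain Q where Q: "clique H Q" "e \<subseteq> Q" "card Q = k" using edge_in_k_clique by metis
  show ?thesis
    using near_partition_of_clique[OF Q(1,3) UN_nonneighbours_k_clique[OF Q(1,3) e Q(2)]] .
qed

end

definition turan_deg :: "nat \<Rightarrow> nat \<Rightarrow> real" where
  "turan_deg r k = ((k - 1) choose (r - 1)) / k ^ (r - 1)"

lemma turan_deg_pos: "1 \<le> r \<Longrightarrow> r \<le> k \<Longrightarrow> 0 < turan_deg r k"
  by (simp add: turan_deg_def)

definition degree_dense :: "nat \<Rightarrow> nat \<Rightarrow> real \<Rightarrow> real \<Rightarrow> 'a hgraph \<Rightarrow> bool" where
  "degree_dense r k \<epsilon> n H \<longleftrightarrow>
     (\<forall>v\<in>hverts H. (turan_deg r k - \<epsilon>) * n ^ (r - 1) \<le> hdegree H v)"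

text \<open>If a vertex has at most \<open>(1 - 1 / k - \<eta>) n\<close> neighbours, the Motzkin--Straus bound for its link
  is the left-hand side times \<open>n ^ (r - 1)\<close>; for \<open>\<eta> = 0\<close> it equals \<open>turan_deg r k * n ^ (r - 1)\<close>.\<close>

lemma exists_degree_slack:
  fixes \<eta> :: real
  assumes rk: "2 \<le> r" "r \<le> k" and \<eta>: "0 < \<eta>" "\<eta> < 1 / 2"
  obtains \<epsilon> where "0 < \<epsilon>" "\<epsilon> \<le> \<eta>" "\<epsilon> \<le> turan_deg r k / 2"
    "((k - 1) choose (r - 1)) * ((1 - 1 / k - \<eta>) / real (k - 1)) ^ (r - 1) < turan_deg r k - \<epsilon>"
proof -
  define B where "B = real ((k - 1) choose (r - 1))"
  define gap where "gap = turan_deg r k - B * ((1 - 1 / k - \<eta>) / real (k - 1)) ^ (r - 1)"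
  have "0 < B" using rk by (simp add: B_def)
  have "(1 - 1 / k) / real (k - 1) = 1 / k" using rk by (simp add: of_nat_diff field_simps)
  then have "turan_deg r k = B * ((1 - 1 / k) / real (k - 1)) ^ (r - 1)"
    by (simp only: turan_deg_def B_def power_one_over times_divide_eq_right mult_1_right)
  moreover have "((1 - 1 / k - \<eta>) / real (k - 1)) ^ (r - 1) < ((1 - 1 / k) / real (k - 1)) ^ (r - 1)"
  proof (intro power_strict_mono divide_strict_right_mono divide_nonneg_nonneg)
    have "1 / k \<le> 1 / 2" using rk by (simp add: field_simps)
    then show "0 \<le> 1 - 1 / k - \<eta>" using \<eta> by linarith
  qed (use rk \<eta> in auto)
  ultimately have "0 < gap" using \<open>0 < B\<close> by (simp add: gap_def)
  moreover have "0 < turan_deg r k" using rk by (intro turan_deg_pos) auto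
  ultimately show ?thesis
  proof (intro that[of "min (min \<eta> (turan_deg r k / 2)) (gap / 2)"])
    have "min (min \<eta> (turan_deg r k / 2)) (gap / 2) < gap" using \<open>0 < gap\<close> by linarith
    then show "((k - 1) choose (r - 1)) * ((1 - 1 / k - \<eta>) / real (k - 1)) ^ (r - 1)
        < turan_deg r k - min (min \<eta> (turan_deg r k / 2)) (gap / 2)"
      unfolding gap_def B_def by linarith
  qed (use \<eta> in auto)
qed

text \<open>The vertex number enters through \<open>n\<close> only, so that the bound can be used for an almost
  spanning subhypergraph of an \<open>n\<close>-vertex hypergraph.\<close>

lemma degree_dense_card_neighbours_gt:
  fixes n \<eta> :: real
  assumes H: "r_graph r H" "edge_cliques_bounded k H" and k: "2 \<le> k" and n: "0 < n"
    and dense: "degree_dense r k \<epsilon> n H" and v: "v \<in> hverts H"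
    and slack: "((k - 1) choose (r - 1)) * ((1 - 1 / k - \<eta>) / real (k - 1)) ^ (r - 1)
      < turan_deg r k - \<epsilon>"
  shows "(1 - 1 / k - \<eta>) * n < card (neighbours H v)"
proof (rule ccontr)
  assume "\<not> (1 - 1 / k - \<eta>) * n < card (neighbours H v)"
  then have few: "real (card (neighbours H v)) \<le> (1 - 1 / k - \<eta>) * n" by simp
  have "(turan_deg r k - \<epsilon>) * n ^ (r - 1) \<le> hdegree H v"
    using dense v by (simp add: degree_dense_def)
  also have "\<dots> \<le> ((k - 1) choose (r - 1)) * (card (neighbours H v) / real (k - 1)) ^ (r - 1)"
    by (rule degree_le_neighbours_power[OF H v])
  also have "\<dots> \<le> ((k - 1) choose (r - 1)) * ((1 - 1 / k - \<eta>) * n / real (k - 1)) ^ (r - 1)"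
    using few by (intro mult_left_mono power_mono divide_right_mono) auto
  also have "\<dots> = ((k - 1) choose (r - 1)) * ((1 - 1 / k - \<eta>) / real (k - 1)) ^ (r - 1) * n ^ (r - 1)"
    by (simp add: power_divide power_mult_distrib)
  finally show False using slack n by (simp add: mult_le_cancel_right)
qed

lemma few_nonneighbours_if_degree_dense:
  fixes n \<epsilon> \<theta> :: real
  assumes H: "r_graph r H" "edge_cliques_bounded k H" and rk: "2 \<le> r" "r \<le> k" and n: "0 < n"
    and card: "(1 - \<epsilon>) * n \<le> card (hverts H)" "card (hverts H) \<le> n"
    and dense: "degree_dense r k \<epsilon> n H"
    and \<epsilon>: "\<epsilon> \<le> \<theta>" "\<epsilon> < turan_deg r k" and \<theta>: "0 < \<theta>" "(real k + 1) ^ 3 * \<theta> < 1 / k" "\<theta> < 1 / 2"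
    and slack: "((k - 1) choose (r - 1)) * ((1 - 1 / k - \<theta>) / real (k - 1)) ^ (r - 1)
      < turan_deg r k - \<epsilon>"
  shows "few_nonneighbours r k H (n / k) (\<theta> * n)"
proof
  have "\<epsilon> * n \<le> \<theta> * n" "\<theta> * n < 1 * n"
    using \<epsilon> \<theta> n by (auto intro: mult_right_mono mult_strict_right_mono)
  then show "hverts H \<noteq> {}" "k * (n / k) - \<theta> * n \<le> card (hverts H)"
    using card rk by (auto simp: algebra_simps)
  show "\<exists>e\<in>hedges H. v \<in> e" if "v \<in> hverts H" for v
  proof -
    have "0 < (turan_deg r k - \<epsilon>) * n ^ (r - 1)" using \<epsilon> n by simp
    also have "\<dots> \<le> hdegree H v" using dense that by (simp add: degree_dense_def)
    finally show ?thesis by (auto simp: hdegree_def card_gt_0_iff)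
  qed
  show "card (nonneighbours H v) \<le> n / k + \<theta> * n" if "v \<in> hverts H" for v
  proof -
    note nbr = neighbours_subset[OF H(1), of v] r_graph_finite_verts[OF H(1)]
    have "real (card (nonneighbours H v)) = card (hverts H) - real (card (neighbours H v))"
      using card_mono[OF nbr(2,1)] finite_subset[OF nbr]
      by (simp add: nonneighbours_def card_Diff_subset[OF _ nbr(1)] of_nat_diff)
    moreover have "(1 - 1 / k - \<theta>) * n < card (neighbours H v)"
      by (rule degree_dense_card_neighbours_gt[OF H _ n dense that slack]) (use rk in simp)
    ultimately show ?thesis using card(2) by (simp add: algebra_simps)
  qed
  show "(real k + 1) ^ 3 * (\<theta> * n) < n / k"
    using mult_strict_right_mono[OF \<theta>(2) n] by (simp add: mult.assoc)
qed (use H rk \<theta> n in auto)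

definition forces_near_partition :: "nat \<Rightarrow> nat \<Rightarrow> real \<Rightarrow> real \<Rightarrow> 'a set \<Rightarrow> bool" where
  "forces_near_partition r k \<epsilon> \<eta> V \<longleftrightarrow>
     (\<forall>G. r_graph r G \<and> edge_cliques_bounded k G \<and> hverts G \<subseteq> V \<and>
        (1 - \<epsilon>) * real (card V) \<le> real (card (hverts G)) \<and>
        degree_dense r k \<epsilon> (real (card V)) G \<longrightarrow>
        (\<exists>c. near_partition k (real (card V) / real k) (\<eta> * real (card V)) G c))"

lemma exists_nonneighbour_slack:
  fixes k \<eta> :: real
  assumes k: "2 \<le> k" and \<eta>: "0 < \<eta>"
  obtains \<theta> where "0 < \<theta>" "(k + 1)\<^sup>2 * \<theta> \<le> \<eta>" "(k + 1) ^ 3 * \<theta> < 1 / k" "\<theta> < 1 / 2"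
proof
  define \<theta> where "\<theta> = min \<eta> (1 / (2 * k)) / (k + 1) ^ 3"
  have pow: "1 \<le> (k + 1) ^ 3" using k by (intro one_le_power) auto
  then have cube: "(k + 1) ^ 3 * \<theta> = min \<eta> (1 / (2 * k))" using k by (simp add: \<theta>_def)
  show pos: "0 < \<theta>" using \<eta> k by (simp add: \<theta>_def)
  have "(k + 1)\<^sup>2 \<le> (k + 1) ^ 3" using k by (intro power_increasing) auto
  then show "(k + 1)\<^sup>2 * \<theta> \<le> \<eta>" using mult_right_mono[of _ _ \<theta>] pos cube by fastforce
  show less: "(k + 1) ^ 3 * \<theta> < 1 / k"
    unfolding cube using k by (simp add: min_less_iff_disj field_simps)
  have "1 * \<theta> \<le> (k + 1) ^ 3 * \<theta>" using pow pos by (intro mult_right_mono) auto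
  also note less
  also have "1 / k \<le> 1 / 2" using k by (simp add: field_simps)
  finally show "\<theta> < 1 / 2" by simp
qed

theorem exists_forcing_degree_slack:
  fixes \<eta> :: real
  assumes rk: "2 \<le> r" "r \<le> k" and \<eta>: "0 < \<eta>"
  shows "\<exists>\<epsilon>>0. \<epsilon> \<le> turan_deg r k / 2 \<and>
    (\<forall>V :: 'a set. finite V \<longrightarrow> V \<noteq> {} \<longrightarrow> forces_near_partition r k \<epsilon> \<eta> V)"
proof -
  obtain \<theta> where \<theta>: "0 < \<theta>" "(real k + 1)\<^sup>2 * \<theta> \<le> \<eta>" "(real k + 1) ^ 3 * \<theta> < 1 / k" "\<theta> < 1 / 2"
    using exists_nonneighbour_slack[of "real k" \<eta>] rk \<eta> by auto
  obtain \<epsilon> where \<epsilon>: "0 < \<epsilon>" "\<epsilon> \<le> \<theta>" "\<epsilon> \<le> turan_deg r k / 2" and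
    slack: "((k - 1) choose (r - 1)) * ((1 - 1 / k - \<theta>) / real (k - 1)) ^ (r - 1) < turan_deg r k - \<epsilon>"
    using exists_degree_slack[OF rk \<theta>(1,4)] by metis
  have "forces_near_partition r k \<epsilon> \<eta> V" if V: "finite V" "V \<noteq> {}" for V :: "'a set"
    unfolding forces_near_partition_def
  proof (intro allI impI, elim conjE)
    fix G :: "'a hgraph"
    assume G: "r_graph r G" "edge_cliques_bounded k G" "hverts G \<subseteq> V"
      "(1 - \<epsilon>) * card V \<le> card (hverts G)" "degree_dense r k \<epsilon> (card V) G"
    have n: "0 < real (card V)" "real (card (hverts G)) \<le> card V"
      using V card_mono[OF V(1) G(3)] by (simp_all add: card_gt_0_iff)
    have "\<epsilon> < turan_deg r k" using \<epsilon> turan_deg_pos[of r k] rk by simp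
    then have "few_nonneighbours r k G (card V / k) (\<theta> * card V)"
      using few_nonneighbours_if_degree_dense[OF G(1,2) rk n(1) G(4) n(2) G(5) \<epsilon>(2) _ \<theta>(1,3,4) slack]
      by blast
    moreover have "(real k + 1)\<^sup>2 * (\<theta> * card V) \<le> \<eta> * card V"
      using mult_right_mono[OF \<theta>(2), of "real (card V)"] by (simp add: mult.assoc)
    ultimately show "\<exists>c. near_partition k (card V / k) (\<eta> * card V) G c"
      using few_nonneighbours.exists_near_partition near_partition_mono by blast
  qed
  then show ?thesis using \<epsilon> by blast
qed

section \<open>Embedding expanded cliques\<close>

lemma hgraph_iso_sym:
  assumes "hgraph_iso G H" and E: "\<And>e. e \<in> hedges G \<Longrightarrow> e \<subseteq> hverts G"
  shows "hgraph_iso H G"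
proof -
  obtain f where f: "bij_betw f (hverts G) (hverts H)" "(\<lambda>e. f ` e) ` hedges G = hedges H"
    using assms by (auto simp: hgraph_iso_def)
  define g where "g = inv_into (hverts G) f"
  have "bij_betw g (hverts H) (hverts G)" using f bij_betw_inv_into by (auto simp: g_def)
  moreover have "g ` f ` e = e" if "e \<in> hedges G" for e
    using E[OF that] f by (auto simp: g_def bij_betw_def inv_into_image_cancel)
  then have "(\<lambda>e. g ` e) ` hedges H = hedges G" unfolding f(2)[symmetric] image_image by simp
  ultimately show ?thesis by (auto simp: hgraph_iso_def)
qed

lemma not_hgraph_free_if_embedding:
  assumes "inj_on f (hverts F)" "f ` hverts F \<subseteq> hverts H"
    and "\<And>e. e \<in> hedges F \<Longrightarrow> f ` e \<in> hedges H" and F: "\<And>e. e \<in> hedges F \<Longrightarrow> e \<subseteq> hverts F"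
  shows "\<not> hgraph_free F H"
proof -
  define G where "G = (f ` hverts F, (\<lambda>e. f ` e) ` hedges F)"
  have "hgraph_iso F G"
    unfolding hgraph_iso_def using assms(1) by (intro exI[of _ f]) (auto simp: G_def bij_betw_def)
  then have "hgraph_iso G F" using F by (rule hgraph_iso_sym)
  moreover have "f ` e \<subseteq> f ` hverts F" if "e \<in> hedges F" for e
    using F[OF that] by (rule image_mono)
  then have "hsubgraph G H"
    using assms(2,3) unfolding hsubgraph_def G_def fst_conv snd_conv by blast
  ultimately show ?thesis unfolding hgraph_free_def by blast
qed

lemma inj_on_expanded_clique_verts:
  assumes inj: "inj_on g {1..m}"
    and inj_ext: "\<And>P. P \<in> pairs_upto m - pairs_upto r \<Longrightarrow> inj_on (b P) {..<r - 2}"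
    and apart: "\<And>P. P \<in> pairs_upto m - pairs_upto r \<Longrightarrow> b P ` {..<r - 2} \<inter> g ` {1..m} = {}"
    and disjoint: "disjoint_family_on (\<lambda>P. b P ` {..<r - 2}) (pairs_upto m - pairs_upto r)"
  shows "inj_on (case_sum g (case_prod b)) (hverts (expanded_clique r m))"
proof -
  let ?\<P> = "pairs_upto m - pairs_upto r" and ?h = "case_sum g (case_prod b)"
  have "inj_on ?h (\<Union>P\<in>?\<P>. pair_ext r P)"
  proof (rule inj_onI)
    fix y z assume yz: "y \<in> (\<Union>P\<in>?\<P>. pair_ext r P)" "z \<in> (\<Union>P\<in>?\<P>. pair_ext r P)"
      and eq: "?h y = ?h z"
    obtain P l where y: "P \<in> ?\<P>" "l \<in> {..<r - 2}" "y = Inr (P, l)"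
      using yz(1) unfolding pair_ext_def by blast
    obtain P' l' where z: "P' \<in> ?\<P>" "l' \<in> {..<r - 2}" "z = Inr (P', l')"
      using yz(2) unfolding pair_ext_def by blast
    have b_eq: "b P l = b P' l'" using eq y(3) z(3) by simp
    have "P = P'"
    proof (rule ccontr)
      assume "P \<noteq> P'"
      then have "b P ` {..<r - 2} \<inter> b P' ` {..<r - 2} = {}"
        by (rule disjoint_family_onD[OF disjoint y(1) z(1)])
      then show False using y(2) z(2) b_eq by blast
    qed
    then show "y = z" using y z inj_onD[OF inj_ext[OF y(1)], of l l'] b_eq by simp
  qed
  moreover have "inj_on ?h (Inl ` {1..m})"
    using inj by (intro inj_on_imageI) (simp add: case_sum_o_inj)
  moreover have "?h ` Inl ` {1..m} = g ` {1..m}"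
    "?h ` (\<Union>P\<in>?\<P>. pair_ext r P) = (\<Union>P\<in>?\<P>. b P ` {..<r - 2})"
    by (simp_all add: pair_ext_def image_UN image_image)
  then have "?h ` Inl ` {1..m} \<inter> ?h ` (\<Union>P\<in>?\<P>. pair_ext r P) = {}" using apart by blast
  ultimately show ?thesis
    unfolding expanded_clique_def fst_conv by (subst inj_on_Un) blast
qed

lemma exists_expanded_clique_map:
  assumes inj: "inj_on g {1..m}"
    and R: "\<And>P. P \<in> pairs_upto m - pairs_upto r \<Longrightarrow>
      finite (R P) \<and> card (R P) = r - 2 \<and> R P \<inter> g ` {1..m} = {}"
    and disjoint: "disjoint_family_on R (pairs_upto m - pairs_upto r)"
  obtains h where "inj_on h (hverts (expanded_clique r m))" "\<And>S. h ` Inl ` S = g ` S"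
    "\<And>P. P \<in> pairs_upto m - pairs_upto r \<Longrightarrow> h ` pair_ext r P = R P"
proof -
  have "\<exists>b. bij_betw b {..<r - 2} (R P)" if "P \<in> pairs_upto m - pairs_upto r" for P
    using R[OF that] by (intro finite_same_card_bij) auto
  then obtain b where b: "\<And>P. P \<in> pairs_upto m - pairs_upto r \<Longrightarrow> bij_betw (b P) {..<r - 2} (R P)"
    by metis
  then have image: "b P ` {..<r - 2} = R P" if "P \<in> pairs_upto m - pairs_upto r" for P
    using that by (simp add: bij_betw_def)
  define h where "h = case_sum g (case_prod b)"
  have "inj_on h (hverts (expanded_clique r m))"
    unfolding h_def
  proof (rule inj_on_expanded_clique_verts[OF inj])
    show "inj_on (b P) {..<r - 2}" if "P \<in> pairs_upto m - pairs_upto r" for P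
      using b[OF that] by (simp add: bij_betw_def)
    show "b P ` {..<r - 2} \<inter> g ` {1..m} = {}" if "P \<in> pairs_upto m - pairs_upto r" for P
      using R[OF that] image[OF that] by simp
    show "disjoint_family_on (\<lambda>P. b P ` {..<r - 2}) (pairs_upto m - pairs_upto r)"
      using disjoint image by (simp add: disjoint_family_on_def)
  qed
  moreover have "h ` Inl ` S = g ` S" for S by (simp add: h_def image_image)
  moreover have "h ` pair_ext r P = R P" if "P \<in> pairs_upto m - pairs_upto r" for P
    using image[OF that] by (simp add: h_def pair_ext_def image_image)
  ultimately show ?thesis by (rule that)
qed

lemma image_pair_not_initial:
  assumes inj: "inj_on g {1..m}" and "r \<le> m" and P: "P \<in> pairs_upto m - pairs_upto r"
  shows "g ` P \<subseteq> g ` {1..m}" "card (g ` P) = 2" "\<not> g ` P \<subseteq> g ` {1..r}"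
proof -
  have P': "P \<subseteq> {1..m}" "card P = 2" "\<not> P \<subseteq> {1..r}" using P by (auto simp: pairs_upto_def)
  show "g ` P \<subseteq> g ` {1..m}" using P'(1) by blast
  show "card (g ` P) = 2" using card_image[OF inj_on_subset[OF inj P'(1)]] P'(2) by simp
  show "\<not> g ` P \<subseteq> g ` {1..r}"
    using P' inj_on_image_subset_iff[OF inj P'(1), of "{1..r}"] assms(2) by simp
qed

lemma exists_bij_initial_segment:
  assumes "finite K" "A \<subseteq> K"
  obtains g where "bij_betw g {1..card K} K" "g ` {1..card A} = A"
proof -
  have fin: "finite A" and le: "card A \<le> card K" using assms finite_subset card_mono by auto
  obtain g\<^sub>1 where g\<^sub>1: "bij_betw g\<^sub>1 {1..card A} A"
    using finite_same_card_bij[of "{1..card A}" A] fin by auto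
  have "card (K - A) = card K - card A" using fin assms by (simp add: card_Diff_subset)
  then obtain g\<^sub>2 where g\<^sub>2: "bij_betw g\<^sub>2 {Suc (card A)..card K} (K - A)"
    using finite_same_card_bij[of "{Suc (card A)..card K}" "K - A"] assms by auto
  define g where "g i = (if i \<le> card A then g\<^sub>1 i else g\<^sub>2 i)" for i
  have "bij_betw g {1..card A} A"
    using g\<^sub>1 by (subst bij_betw_cong[of _ _ g\<^sub>1]) (auto simp: g_def)
  moreover have "bij_betw g {Suc (card A)..card K} (K - A)"
    using g\<^sub>2 by (subst bij_betw_cong[of _ _ g\<^sub>2]) (auto simp: g_def)
  ultimately have "bij_betw g ({1..card A} \<union> {Suc (card A)..card K}) (A \<union> (K - A))"
    by (rule bij_betw_combine) auto
  moreover have "{1..card A} \<union> {Suc (card A)..card K} = {1..card K}" "A \<union> (K - A) = K"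
    using le assms by auto
  ultimately show ?thesis
    using that \<open>bij_betw g {1..card A} A\<close> by (simp add: bij_betw_def)
qed

lemma not_expanded_clique_free_if_map:
  assumes rm: "2 \<le> r" "r \<le> m" and h: "inj_on h (hverts (expanded_clique r m))"
    and verts: "h ` hverts (expanded_clique r m) \<subseteq> hverts H" and core: "h ` Inl ` {1..r} \<in> hedges H"
    and pairs: "\<And>P. P \<in> pairs_upto m - pairs_upto r \<Longrightarrow> h ` (pair_ext r P \<union> Inl ` P) \<in> hedges H"
  shows "\<not> hgraph_free (expanded_clique r m) H"
proof (rule not_hgraph_free_if_embedding[OF h verts])
  fix e assume e: "e \<in> hedges (expanded_clique r m)"
  then show "e \<subseteq> hverts (expanded_clique r m)"
    using expanded_clique_r_graph[OF rm] by (simp add: r_graph_def)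
  show "h ` e \<in> hedges H" using e core pairs by (auto simp: expanded_clique_def)
qed

lemma expanded_clique_embedding:
  assumes H: "r_graph r H" and r: "2 \<le> r" and K: "K \<subseteq> hverts H" "r \<le> card K"
    and e\<^sub>0: "e\<^sub>0 \<in> hedges H" "e\<^sub>0 \<subseteq> K"
    and X: "\<And>P. P \<subseteq> K \<Longrightarrow> card P = 2 \<Longrightarrow> \<not> P \<subseteq> e\<^sub>0 \<Longrightarrow> X P \<in> hedges H \<and> X P \<inter> K = P"
    and disjoint: "disjoint_family_on (\<lambda>P. X P - K) {P. P \<subseteq> K \<and> card P = 2 \<and> \<not> P \<subseteq> e\<^sub>0}"
  shows "\<not> hgraph_free (expanded_clique r (card K)) H"
proof -
  define \<P> where "\<P> = pairs_upto (card K) - pairs_upto r"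
  obtain g where g: "bij_betw g {1..card K} K" "g ` {1..r} = e\<^sub>0"
    using exists_bij_initial_segment[of K e\<^sub>0] K e\<^sub>0 r_graph_edge[OF H e\<^sub>0(1)]
      r_graph_finite_verts[OF H] finite_subset by metis
  then have inj: "inj_on g {1..card K}" and image: "g ` {1..card K} = K"
    by (auto simp: bij_betw_def)
  have pair: "g ` P \<in> {P. P \<subseteq> K \<and> card P = 2 \<and> \<not> P \<subseteq> e\<^sub>0}" if "P \<in> \<P>" for P
    using image_pair_not_initial[OF inj K(2)] that unfolding \<P>_def image g(2) by blast
  then have X_pair: "X (g ` P) \<in> hedges H" "X (g ` P) \<inter> K = g ` P" if "P \<in> \<P>" for P
    using X that by blast+
  have "finite (X (g ` P) - K) \<and> card (X (g ` P) - K) = r - 2 \<and> (X (g ` P) - K) \<inter> K = {}"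
    if "P \<in> \<P>" for P
  proof -
    have "card (X (g ` P) - K) = card (X (g ` P)) - card (X (g ` P) \<inter> K)"
      using r_graph_edge(3)[OF H X_pair(1)[OF that]] by (intro card_Diff_subset_Int) auto
    then show ?thesis using r_graph_edge[OF H X_pair(1)[OF that]] X_pair(2)[OF that] pair[OF that] by auto
  qed
  moreover have "disjoint_family_on (\<lambda>P. X (g ` P) - K) \<P>"
    unfolding disjoint_family_on_def
  proof (intro ballI impI)
    fix P P' assume distinct: "P \<in> \<P>" "P' \<in> \<P>" "P \<noteq> P'"
    then have "g ` P \<noteq> g ` P'"
      using inj_on_image_eq_iff[OF inj, of P P'] by (auto simp: \<P>_def pairs_upto_def)
    then show "(X (g ` P) - K) \<inter> (X (g ` P') - K) = {}"
      using disjoint_family_onD[OF disjoint pair pair] distinct by blast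
  qed
  ultimately obtain h where h: "inj_on h (hverts (expanded_clique r (card K)))"
    "\<And>S. h ` Inl ` S = g ` S" "\<And>P. P \<in> \<P> \<Longrightarrow> h ` pair_ext r P = X (g ` P) - K"
    using exists_expanded_clique_map[OF inj, of r "\<lambda>P. X (g ` P) - K"]
    unfolding \<P>_def image by metis
  show ?thesis
  proof (rule not_expanded_clique_free_if_map[OF r K(2) h(1)])
    have "h ` hverts (expanded_clique r (card K)) = K \<union> (\<Union>P\<in>\<P>. X (g ` P) - K)"
      unfolding expanded_clique_def fst_conv image_Un image_UN h(2) image \<P>_def[symmetric]
      using h(3) by simp
    then show "h ` hverts (expanded_clique r (card K)) \<subseteq> hverts H"
      using K(1) r_graph_edge(1)[OF H X_pair(1)] by blast
    show "h ` Inl ` {1..r} \<in> hedges H" using e\<^sub>0(1) g(2) h(2) by simp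
    fix P assume "P \<in> pairs_upto (card K) - pairs_upto r"
    then have P: "P \<in> \<P>" by (simp add: \<P>_def)
    then have "h ` (pair_ext r P \<union> Inl ` P) = X (g ` P)"
      using X_pair(2)[OF P] by (auto simp: image_Un h)
    then show "h ` (pair_ext r P \<union> Inl ` P) \<in> hedges H" using X_pair(1)[OF P] by simp
  qed
qed

definition heavy :: "nat \<Rightarrow> 'a set set \<Rightarrow> 'a set \<Rightarrow> bool" where
  "heavy M E T \<longleftrightarrow>
     (\<forall>Z. finite Z \<and> card Z \<le> M \<and> Z \<inter> T = {} \<longrightarrow> (\<exists>e\<in>E. T \<subseteq> e \<and> e \<inter> Z = {}))"

lemma heavy_extension:
  assumes "heavy M E T" "T \<subseteq> U" "finite U" "card U \<le> M"
  obtains e where "e \<in> E" "e \<inter> U = T"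
proof -
  have "card (U - T) \<le> M" using card_mono[of U "U - T"] assms by auto
  then obtain e where "e \<in> E" "T \<subseteq> e" "e \<inter> (U - T) = {}"
    using assms unfolding heavy_def by (metis Diff_disjoint finite_Diff inf_commute)
  then show ?thesis using that[of e] assms(2) by blast
qed

lemma disjoint_heavy_extensions:
  assumes "finite \<T>" "\<And>T. T \<in> \<T> \<Longrightarrow> heavy M E T \<and> T \<subseteq> U"
    and U: "finite U" "card U + r * card \<T> \<le> M" and E: "\<And>e. e \<in> E \<Longrightarrow> finite e \<and> card e \<le> r"
  shows "\<exists>X. (\<forall>T\<in>\<T>. X T \<in> E \<and> X T \<inter> U = T) \<and> disjoint_family_on (\<lambda>T. X T - U) \<T>"
  using assms(1,2) U(2)
proof (induction \<T> rule: finite_induct)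
  case (insert T \<T>)
  then obtain X where X: "\<forall>T\<in>\<T>. X T \<in> E \<and> X T \<inter> U = T" "disjoint_family_on (\<lambda>T. X T - U) \<T>"
    by fastforce
  define U' where "U' = U \<union> (\<Union>T\<in>\<T>. X T)"
  have "card (\<Union>T\<in>\<T>. X T) \<le> (\<Sum>T\<in>\<T>. card (X T))" using insert.hyps by (intro card_UN_le)
  also have "\<dots> \<le> card \<T> * r" using X E by (intro sum_bounded_above[of \<T> _ r, simplified]) auto
  finally have "card U' \<le> M"
    using card_Un_le[of U "\<Union>T\<in>\<T>. X T"] insert by (simp add: U'_def algebra_simps)
  moreover have "finite U'" using U insert.hyps X E by (auto simp: U'_def)
  moreover have "T \<subseteq> U" "T \<subseteq> U'" "heavy M E T" using insert.prems by (auto simp: U'_def)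
  ultimately obtain e where e: "e \<in> E" "e \<inter> U' = T" using heavy_extension by metis
  define Y where "Y = X(T := e)"
  have Y: "Y T = e" "\<And>T'. T' \<in> \<T> \<Longrightarrow> Y T' = X T'" using insert.hyps by (auto simp: Y_def)
  have "disjoint_family_on (\<lambda>T. Y T - U) \<T>"
    using X(2) Y(2) by (simp add: disjoint_family_on_def)
  moreover have "(Y T - U) \<inter> (\<Union>T'\<in>\<T>. Y T' - U) = {}"
    using e \<open>T \<subseteq> U\<close> by (auto simp: Y U'_def)
  ultimately have "disjoint_family_on (\<lambda>T. Y T - U) (insert T \<T>)"
    using insert.hyps by (simp add: disjoint_family_on_insert)
  moreover have "\<forall>T'\<in>insert T \<T>. Y T' \<in> E \<and> Y T' \<inter> U = T'"
    using X(1) Y e \<open>T \<subseteq> U\<close> by (auto simp: U'_def)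
  ultimately show ?case by blast
qed (simp add: disjoint_family_on_def)

text \<open>An edge through a pair of core vertices, the core itself and one edge for every other pair have
  fewer vertices than this.\<close>

definition heavy_threshold :: "nat \<Rightarrow> nat \<Rightarrow> nat" where
  "heavy_threshold r k = (Suc k + r) + r * 2 ^ Suc k"

lemma expanded_clique_if_heavy_pairs_except_one:
  assumes H: "r_graph r H" and rk: "2 \<le> r" "r \<le> k" and K: "K \<subseteq> hverts H" "card K = Suc k"
    and e\<^sub>0: "e\<^sub>0 \<in> hedges H" "e\<^sub>0 \<subseteq> K" and f: "f \<in> hedges H"
    and heavy: "\<And>P. P \<subseteq> K \<Longrightarrow> card P = 2 \<Longrightarrow> \<not> P \<subseteq> e\<^sub>0 \<Longrightarrow> P \<noteq> f \<inter> K
      \<Longrightarrow> heavy (heavy_threshold r k) (hedges H) P"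
  shows "\<not> hgraph_free (expanded_clique r (k + 1)) H"
proof -
  define \<T> where "\<T> = {P. P \<subseteq> K \<and> card P = 2 \<and> \<not> P \<subseteq> e\<^sub>0} - {f \<inter> K}"
  have finK: "finite K" using K by (simp add: card_ge_0_finite)
  have "\<T> \<subseteq> Pow K" by (auto simp: \<T>_def)
  then have \<T>: "finite \<T>" "card \<T> \<le> 2 ^ Suc k"
    using finK K card_mono[of "Pow K" \<T>] finite_subset[of \<T> "Pow K"] by (simp_all add: card_Pow)
  have "card (K \<union> f) \<le> Suc k + r" using card_Un_le[of K f] K r_graph_edge[OF H f] by simp
  then have "card (K \<union> f) + r * card \<T> \<le> heavy_threshold r k"
    unfolding heavy_threshold_def using \<T>(2) by (intro add_mono mult_left_mono) auto
  then obtain X where X: "\<forall>P\<in>\<T>. X P \<in> hedges H \<and> X P \<inter> (K \<union> f) = P"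
    "disjoint_family_on (\<lambda>P. X P - (K \<union> f)) \<T>"
    using disjoint_heavy_extensions[OF \<T>(1), of "heavy_threshold r k" "hedges H" "K \<union> f" r]
      heavy r_graph_edge[OF H] f finK by (auto simp: \<T>_def)
  define Y where "Y = X(f \<inter> K := f)"
  have "\<not> hgraph_free (expanded_clique r (card K)) H"
  proof (rule expanded_clique_embedding[OF H rk(1) K(1) _ e\<^sub>0])
    show "Y P \<in> hedges H \<and> Y P \<inter> K = P" if "P \<subseteq> K" "card P = 2" "\<not> P \<subseteq> e\<^sub>0" for P
      using that X(1) f by (cases "P = f \<inter> K") (auto simp: Y_def \<T>_def)
    have old: "Y P - K = X P - (K \<union> f)" if "P \<in> \<T>" for P
      using that X(1) by (auto simp: Y_def \<T>_def)
    then have "disjoint_family_on (\<lambda>P. Y P - K) \<T>" using X(2) by (simp add: disjoint_family_on_def)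
    moreover have "(Y (f \<inter> K) - K) \<inter> (\<Union>P\<in>\<T>. Y P - K) = {}"
      using old by (auto simp: Y_def)
    ultimately have "disjoint_family_on (\<lambda>P. Y P - K) (insert (f \<inter> K) \<T>)"
      by (subst disjoint_family_on_insert) (auto simp: \<T>_def)
    then show "disjoint_family_on (\<lambda>P. Y P - K) {P. P \<subseteq> K \<and> card P = 2 \<and> \<not> P \<subseteq> e\<^sub>0}"
      by (rule disjoint_family_on_mono[rotated]) (auto simp: \<T>_def)
  qed (use K rk in simp)
  then show ?thesis using K by simp
qed

lemma expanded_clique_if_heavy_pairs:
  assumes H: "r_graph r H" and rk: "2 \<le> r" "r \<le> k" and K: "K \<subseteq> hverts H" "card K = Suc k"
    and e\<^sub>0: "e\<^sub>0 \<in> hedges H" "e\<^sub>0 \<subseteq> K"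
    and heavy: "\<And>P. P \<subseteq> K \<Longrightarrow> card P = 2 \<Longrightarrow> heavy (heavy_threshold r k) (hedges H) P"
  shows "\<not> hgraph_free (expanded_clique r (k + 1)) H"
  using assms by (intro expanded_clique_if_heavy_pairs_except_one[OF H rk K e\<^sub>0 e\<^sub>0(1)]) auto

definition heavy_subgraph :: "nat \<Rightarrow> 'a hgraph \<Rightarrow> 'a set \<Rightarrow> 'a hgraph" where
  "heavy_subgraph M H W =
     (W, {e\<in>hedges H. e \<subseteq> W \<and> (\<forall>P. P \<subseteq> e \<and> card P = 2 \<longrightarrow> heavy M (hedges H) P)})"

lemma hverts_heavy_subgraph [simp]: "hverts (heavy_subgraph M H W) = W"
  by (simp add: heavy_subgraph_def)

lemma hedges_heavy_subgraph_subset: "hedges (heavy_subgraph M H W) \<subseteq> hedges H"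
  by (auto simp: heavy_subgraph_def)

lemma r_graph_heavy_subgraph: "r_graph r H \<Longrightarrow> W \<subseteq> hverts H \<Longrightarrow> r_graph r (heavy_subgraph M H W)"
  by (auto simp: r_graph_def heavy_subgraph_def intro: finite_subset)

lemma heavy_if_adjacent:
  assumes "adjacent (heavy_subgraph M H W) u v"
  shows "heavy M (hedges H) {u, v}"
proof -
  obtain e where "e \<in> hedges (heavy_subgraph M H W)" "{u, v} \<subseteq> e" "u \<noteq> v"
    using assms by (auto simp: adjacent_def)
  then show ?thesis unfolding heavy_subgraph_def by auto
qed

lemma heavy_if_clique:
  assumes "clique (heavy_subgraph M H W) K" "P \<subseteq> K" "card P = 2"
  shows "heavy M (hedges H) P"
proof -
  obtain u v where "P = {u, v}" "u \<noteq> v" using assms(3) by (auto simp: card_2_iff)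
  then show ?thesis
    using assms heavy_if_adjacent[of M H W u v] by (auto simp: clique_def pairwise_def)
qed

lemma edge_cliques_bounded_heavy_subgraph:
  assumes H: "r_graph r H" and rk: "2 \<le> r" "r \<le> k" and W: "W \<subseteq> hverts H"
    and free: "hgraph_free (expanded_clique r (k + 1)) H"
  shows "edge_cliques_bounded k (heavy_subgraph (heavy_threshold r k) H W)"
  unfolding edge_cliques_bounded_def
proof (intro allI impI)
  fix K e assume K: "clique (heavy_subgraph (heavy_threshold r k) H W) K"
    and e: "e \<in> hedges (heavy_subgraph (heavy_threshold r k) H W)" "e \<subseteq> K"
  have "K \<subseteq> hverts H" using K W by (auto simp: clique_def)
  have eH: "e \<in> hedges H" using e hedges_heavy_subgraph_subset by blast
  show "card K \<le> k"
  proof (rule ccontr)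
    assume "\<not> card K \<le> k"
    then obtain K' where "e \<subseteq> K'" "K' \<subseteq> K" "card K' = Suc k"
      using exists_subset_between[of e "Suc k" K] e(2) r_graph_edge(2)[OF H eH] rk
        finite_subset[OF \<open>K \<subseteq> hverts H\<close> r_graph_finite_verts[OF H]] by auto
    then have "\<not> hgraph_free (expanded_clique r (k + 1)) H"
      using \<open>K \<subseteq> hverts H\<close> heavy_if_clique[OF K]
      by (intro expanded_clique_if_heavy_pairs[OF H rk _ _ eH, of K']) auto
    then show False using free by simp
  qed
qed

section \<open>Degree stability\<close>

text \<open>The bounds below read \<open>n ^ r / n ^ t\<close> for what is morally \<open>n ^ (r - t)\<close>, because \<open>t\<close> may exceed
  \<open>r\<close>.\<close>

lemma card_edges_containing_le:
  assumes H: "r_graph r H" "hverts H \<noteq> {}" and T: "finite T"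
  shows "card {e\<in>hedges H. T \<subseteq> e} \<le> real (card (hverts H)) ^ r / real (card (hverts H)) ^ card T"
proof (cases "card T \<le> r")
  case False
  then have "{e\<in>hedges H. T \<subseteq> e} = {}"
    using r_graph_edge[OF H(1)] card_mono by (metis (no_types, lifting) empty_Collect_eq)
  then show ?thesis
    by (metis card.empty divide_nonneg_nonneg of_nat_0 of_nat_0_le_iff zero_le_power)
next
  case True
  let ?n = "card (hverts H)"
  note fin = r_graph_finite_verts[OF H(1)]
  have "card {e\<in>hedges H. T \<subseteq> e} = card ((\<lambda>e. e - T) ` {e\<in>hedges H. T \<subseteq> e})"
    by (rule card_image[symmetric]) (auto simp: inj_on_def)
  also have "\<dots> \<le> card {S. S \<subseteq> hverts H \<and> card S = r - card T}"
    using r_graph_edge[OF H(1)] T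
    by (intro card_mono finite_subsets_card fin) (auto simp: card_Diff_subset)
  also have "\<dots> = ?n choose (r - card T)" using fin by (rule n_subsets)
  also have "\<dots> \<le> ?n ^ (r - card T)"
    by (cases "r - card T \<le> ?n") (auto simp: binomial_le_pow binomial_eq_0)
  finally have "real (card {e\<in>hedges H. T \<subseteq> e}) \<le> real (?n ^ (r - card T))" by (rule of_nat_mono)
  moreover have "real ?n ^ (r - card T) = real ?n ^ r / real ?n ^ card T"
    using True H(2) fin by (simp add: power_diff)
  ultimately show ?thesis by simp
qed

lemma card_edges_containing_hitting_le:
  assumes H: "r_graph r H" "hverts H \<noteq> {}" and T: "finite T" and Z: "finite Z" "Z \<inter> T = {}"
  shows "card {e\<in>hedges H. T \<subseteq> e \<and> e \<inter> Z \<noteq> {}}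
    \<le> card Z * (real (card (hverts H)) ^ r / real (card (hverts H)) ^ Suc (card T))"
proof -
  have hitting: "{e\<in>hedges H. T \<subseteq> e \<and> e \<inter> Z \<noteq> {}} = (\<Union>z\<in>Z. {e\<in>hedges H. insert z T \<subseteq> e})"
    by auto
  have "card {e\<in>hedges H. insert z T \<subseteq> e}
      \<le> real (card (hverts H)) ^ r / real (card (hverts H)) ^ Suc (card T)" if "z \<in> Z" for z
  proof -
    have "card (insert z T) = Suc (card T)" using Z(2) T that by (intro card_insert_disjoint) auto
    then show ?thesis using card_edges_containing_le[OF H, of "insert z T"] T by simp
  qed
  then show ?thesis unfolding hitting by (rule card_UN_le_mult[OF Z(1)])
qed

lemma codegree_le_if_not_heavy:
  assumes H: "r_graph r H" "hverts H \<noteq> {}" and T: "finite T" "\<not> heavy M (hedges H) T"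
  shows "card {e\<in>hedges H. T \<subseteq> e}
    \<le> M * (real (card (hverts H)) ^ r / real (card (hverts H)) ^ Suc (card T))"
proof -
  obtain Z where Z: "finite Z" "card Z \<le> M" "Z \<inter> T = {}"
    "\<And>e. e \<in> hedges H \<Longrightarrow> T \<subseteq> e \<Longrightarrow> e \<inter> Z \<noteq> {}"
    using T(2) unfolding heavy_def by meson
  then have "{e\<in>hedges H. T \<subseteq> e} = {e\<in>hedges H. T \<subseteq> e \<and> e \<inter> Z \<noteq> {}}" by blast
  then have "real (card {e\<in>hedges H. T \<subseteq> e}) = card {e\<in>hedges H. T \<subseteq> e \<and> e \<inter> Z \<noteq> {}}"
    by (rule arg_cong)
  also have "\<dots> \<le> card Z * (real (card (hverts H)) ^ r / real (card (hverts H)) ^ Suc (card T))"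
    using H T(1) Z(1,3) by (rule card_edges_containing_hitting_le)
  also have "\<dots> \<le> M * (real (card (hverts H)) ^ r / real (card (hverts H)) ^ Suc (card T))"
    using Z(2) by (intro mult_right_mono) auto
  finally show ?thesis .
qed

lemma sum_card_incident_edges:
  assumes "finite V" "finite L" "\<And>e. e \<in> L \<Longrightarrow> e \<subseteq> V \<and> card e = r"
  shows "(\<Sum>v\<in>V. card {e\<in>L. v \<in> e}) = r * card L"
proof (rule sum_multicount[OF assms(1,2)], rule ballI)
  fix e assume "e \<in> L"
  then have "{v\<in>V. v \<in> e} = e" "card e = r" using assms(3) by auto
  then show "card {v\<in>V. v \<in> e} = r" by simp
qed

lemma near_partition_exists_common_neighbour:
  fixes a s :: real
  assumes part: "near_partition k a s G c" and G: "r_graph r G" and T: "T \<subseteq> hverts G"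
    and F: "finite F" and q: "q < k" "q \<notin> c ` T" and room: "card F + card T * s < a - s"
  shows "\<exists>w\<in>hverts G. c w = q \<and> w \<notin> F \<and> (\<forall>t\<in>T. adjacent G t w)"
proof -
  define X where "X = F \<union> (\<Union>t\<in>T. missing_neighbours G c t)"
  have fin: "finite T" "finite (missing_neighbours G c t)" for t
    using T r_graph_finite_verts[OF G] finite_subset
    by (auto simp: missing_neighbours_def nonneighbours_def)
  have "card (\<Union>t\<in>T. missing_neighbours G c t) \<le> card T * s"
    using T fin(1) near_partition_missing[OF part] by (intro card_UN_le_mult) auto
  then have "card X < a - s"
    using card_Un_le[of F "\<Union>t\<in>T. missing_neighbours G c t"] room unfolding X_def by linarith
  also have "\<dots> \<le> card (colour_class (hverts G) c q)" by (rule near_partition_class[OF part q(1)])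
  finally have "card X < card (colour_class (hverts G) c q)" by simp
  moreover have "finite X" using F fin by (simp add: X_def)
  ultimately have "\<not> colour_class (hverts G) c q \<subseteq> X" by (meson card_mono not_le)
  then obtain w where w: "w \<in> hverts G" "c w = q" "w \<notin> X" by (auto simp: colour_class_def)
  have "adjacent G t w" if "t \<in> T" for t
  proof -
    have "c t \<noteq> q" using q(2) that by auto
    moreover have "w \<notin> missing_neighbours G c t" using that w(3) by (auto simp: X_def)
    ultimately show ?thesis using w(1,2) by (auto simp: missing_neighbours_def nonneighbours_iff)
  qed
  then show ?thesis using w by (auto simp: X_def)
qed

lemma near_partition_extend_clique:
  fixes a s :: real
  assumes part: "near_partition k a s G c" and G: "r_graph r G" and T: "T \<subseteq> hverts G"
    and F: "finite F" and D: "D \<subseteq> {..<k} - c ` T"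
    and room: "card F + (card T + card D) * s < a - s" and s: "0 \<le> s"
  shows "\<exists>S \<subseteq> hverts G. card S = card D \<and> c ` S = D \<and> S \<inter> F = {} \<and>
    (\<forall>x\<in>S. \<forall>y\<in>S \<union> T. x \<noteq> y \<longrightarrow> adjacent G x y)"
proof -
  have "finite D" using D finite_subset by blast
  then show ?thesis
    using D room
  proof (induction D rule: finite_induct)
    case empty
    show ?case by (intro exI[of _ "{}"]) auto
  next
    case (insert q D)
    have "(card T + card D) * s \<le> (card T + card (insert q D)) * s"
      using insert.hyps s by (intro mult_right_mono) auto
    then have room: "card F + (card T + card D) * s < a - s" using insert.prems by linarith
    moreover have "D \<subseteq> {..<k} - c ` T" using insert.prems by auto
    ultimately obtain S where S: "S \<subseteq> hverts G" "card S = card D" "c ` S = D" "S \<inter> F = {}"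
      "\<forall>x\<in>S. \<forall>y\<in>S \<union> T. x \<noteq> y \<longrightarrow> adjacent G x y"
      using insert.IH by metis
    have "card (S \<union> T) * s \<le> (card T + card D) * s"
      using card_Un_le[of S T] S(2) s by (intro mult_right_mono) auto
    then have "card F + card (S \<union> T) * s < a - s" using room by linarith
    moreover have "q < k" "q \<notin> c ` (S \<union> T)" using S(3) insert.hyps insert.prems by auto
    ultimately obtain w where w: "w \<in> hverts G" "c w = q" "w \<notin> F"
      and adj: "\<forall>t\<in>S \<union> T. adjacent G t w"
      using near_partition_exists_common_neighbour[OF part G _ F, of "S \<union> T" q] S(1) T by auto
    have "finite S" using S(1) r_graph_finite_verts[OF G] finite_subset by blast
    moreover have "w \<notin> S" using adj by (metis UnI1 adjacent_irrefl)
    ultimately have "card (insert w S) = card (insert q D)" using S(2) insert.hyps by simp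
    moreover have "adjacent G x y" if xy: "x \<in> insert w S" "y \<in> insert w S \<union> T" "x \<noteq> y" for x y
    proof (cases "x = w \<or> y = w")
      case True
      then consider "x = w" "y \<in> S \<union> T" | "y = w" "x \<in> S" using xy by blast
      then show ?thesis using adj adjacent_sym[of G] by cases auto
    qed (use xy S(5) in auto)
    ultimately show ?case using S(1,3,4) w by (intro exI[of _ "insert w S"]) auto
  qed
qed

definition k_partite :: "nat \<Rightarrow> 'a hgraph \<Rightarrow> bool" where
  "k_partite k H \<longleftrightarrow>
     (\<exists>c :: 'a \<Rightarrow> nat. c ` hverts H \<subseteq> {..<k} \<and> (\<forall>e\<in>hedges H. inj_on c e))"

lemma degree_dense_mono: "degree_dense r k \<epsilon> n H \<Longrightarrow> \<epsilon> \<le> \<epsilon>' \<Longrightarrow> 0 \<le> n \<Longrightarrow> degree_dense r k \<epsilon>' n H"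
  unfolding degree_dense_def by (meson diff_left_mono mult_right_mono order_trans zero_le_power)

locale expanded_clique_free =
  fixes r k :: nat and H :: "'a hgraph"
  assumes r_graph: "r_graph r H" and r_ge_2: "2 \<le> r" and r_le_k: "r \<le> k"
    and free: "hgraph_free (expanded_clique r (k + 1)) H" and verts_nonempty: "hverts H \<noteq> {}"
begin

abbreviation "V \<equiv> hverts H"
abbreviation "E \<equiv> hedges H"
abbreviation "n \<equiv> real (card V)"
abbreviation "M \<equiv> heavy_threshold r k"
abbreviation heavy_part :: "'a set \<Rightarrow> 'a hgraph" where
  "heavy_part W \<equiv> heavy_subgraph M H W"

lemma finite_verts: "finite V" and finite_edges: "finite E"
  using r_graph by (auto intro: r_graph_finite_verts r_graph_finite_edges)

lemma n_pos: "0 < n"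
  using verts_nonempty finite_verts by (simp add: card_gt_0_iff)

lemma n_power: "n ^ r = n * n ^ (r - 1)"
  using r_ge_2 by (cases r) auto

lemma edge: "e \<in> E \<Longrightarrow> e \<subseteq> V \<and> card e = r \<and> finite e"
  using r_graph_edge[OF r_graph] by blast

lemma degree_le_degree_plus:
  assumes "hedges G \<subseteq> E" and "\<And>e. e \<in> E \<Longrightarrow> v \<in> e \<Longrightarrow> e \<notin> hedges G \<Longrightarrow> e \<in> B" and "finite B"
  shows "hdegree H v \<le> hdegree G v + card B"
proof -
  have "hdegree H v \<le> card ({e\<in>hedges G. v \<in> e} \<union> B)"
    unfolding hdegree_def using assms finite_subset[OF assms(1) finite_edges]
    by (intro card_mono) auto
  also have "\<dots> \<le> hdegree G v + card B" unfolding hdegree_def by (rule card_Un_le)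
  finally show ?thesis .
qed

lemma card_edges_at_hitting_le:
  assumes "finite Z"
  shows "card {e\<in>E. x \<in> e \<and> e \<inter> (Z - {x}) \<noteq> {}} \<le> card Z / n * n ^ (r - 1)"
proof -
  have "card {e\<in>E. {x} \<subseteq> e \<and> e \<inter> (Z - {x}) \<noteq> {}} \<le> card (Z - {x}) * (n ^ r / n ^ Suc (card {x}))"
    using assms by (intro card_edges_containing_hitting_le[OF r_graph verts_nonempty]) auto
  also have "\<dots> \<le> card Z * (n ^ r / n ^ Suc (card {x}))"
    using card_mono[of Z "Z - {x}"] assms by (intro mult_right_mono) auto
  also have "\<dots> = card Z / n * n ^ (r - 1)" using n_pos by (simp add: n_power)
  finally show ?thesis by simp
qed

definition light_edges :: "'a set set" where
  "light_edges = {e\<in>E. \<exists>P\<subseteq>e. card P = 2 \<and> \<not> heavy M E P}"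

lemma edge_heavy_part_iff: "e \<in> hedges (heavy_part W) \<longleftrightarrow> e \<in> E \<and> e \<subseteq> W \<and> e \<notin> light_edges"
  by (auto simp: heavy_subgraph_def light_edges_def)

lemma card_light_edges_le: "card light_edges \<le> M * n ^ (r - 1)"
proof -
  define \<P> where "\<P> = {P. P \<subseteq> V \<and> card P = 2 \<and> \<not> heavy M E P}"
  have "\<P> \<subseteq> {P. P \<subseteq> V \<and> card P = 2}" by (auto simp: \<P>_def)
  then have \<P>: "finite \<P>" "card \<P> \<le> card V choose 2"
    using finite_subsets_card[OF finite_verts, of 2] card_mono[of "{P. P \<subseteq> V \<and> card P = 2}" \<P>]
      n_subsets[OF finite_verts, of 2] finite_subset by auto
  have "card V choose 2 \<le> card V ^ 2"
    by (cases "2 \<le> card V") (auto simp: binomial_le_pow binomial_eq_0)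
  then have card: "real (card \<P>) \<le> n ^ 2" using \<P>(2) of_nat_mono[of "card \<P>" "card V ^ 2"] by simp
  have "light_edges \<subseteq> (\<Union>P\<in>\<P>. {e\<in>E. P \<subseteq> e})"
  proof
    fix e assume "e \<in> light_edges"
    then obtain P where "e \<in> E" "P \<subseteq> e" "card P = 2" "\<not> heavy M E P"
      by (auto simp: light_edges_def)
    moreover from this have "P \<subseteq> V" using edge by blast
    ultimately show "e \<in> (\<Union>P\<in>\<P>. {e\<in>E. P \<subseteq> e})" by (auto simp: \<P>_def)
  qed
  then have "real (card light_edges) \<le> card (\<Union>P\<in>\<P>. {e\<in>E. P \<subseteq> e})"
    using \<P> finite_edges by (intro of_nat_mono card_mono) auto
  also have "\<dots> \<le> card \<P> * (M * (n ^ r / n ^ 3))"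
  proof (rule card_UN_le_mult[OF \<P>(1)])
    fix P assume "P \<in> \<P>"
    then have "finite P" "Suc (card P) = 3" "\<not> heavy M E P"
      by (auto simp: \<P>_def intro: card_ge_0_finite)
    then show "card {e\<in>E. P \<subseteq> e} \<le> M * (n ^ r / n ^ 3)"
      using codegree_le_if_not_heavy[OF r_graph verts_nonempty] by metis
  qed
  also have "\<dots> \<le> n ^ 2 * (M * (n ^ r / n ^ 3))" using card by (intro mult_right_mono) auto
  also have "\<dots> = M * n ^ (r - 1)"
    using n_pos by (simp add: n_power power2_eq_square power3_eq_cube)
  finally show ?thesis .
qed

definition exceptional :: "real \<Rightarrow> 'a set" where
  "exceptional \<tau> = {v\<in>V. \<tau> * n ^ (r - 1) < card {e\<in>light_edges. v \<in> e}}"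

lemma exceptional_subset: "exceptional \<tau> \<subseteq> V" and finite_exceptional: "finite (exceptional \<tau>)"
  using finite_verts by (auto simp: exceptional_def)

lemma card_exceptional_le:
  assumes "0 < \<tau>"
  shows "card (exceptional \<tau>) \<le> r * M / \<tau>"
proof -
  have fin: "finite light_edges" using finite_edges by (simp add: light_edges_def)
  have "card (exceptional \<tau>) * (\<tau> * n ^ (r - 1)) = (\<Sum>v\<in>exceptional \<tau>. \<tau> * n ^ (r - 1))" by simp
  also have "\<dots> \<le> (\<Sum>v\<in>exceptional \<tau>. real (card {e\<in>light_edges. v \<in> e}))"
    by (intro sum_mono) (auto simp: exceptional_def)
  also have "\<dots> \<le> (\<Sum>v\<in>V. real (card {e\<in>light_edges. v \<in> e}))"
    using exceptional_subset finite_verts by (intro sum_mono2) auto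
  also have "\<dots> = real (\<Sum>v\<in>V. card {e\<in>light_edges. v \<in> e})" by simp
  also have "\<dots> = r * card light_edges"
    using edge by (subst sum_card_incident_edges[OF finite_verts fin]) (auto simp: light_edges_def)
  also have "\<dots> \<le> r * (M * n ^ (r - 1))"
    using mult_left_mono[OF card_light_edges_le, of "real r"] by simp
  finally have "(card (exceptional \<tau>) * \<tau>) * n ^ (r - 1) \<le> (real r * M) * n ^ (r - 1)"
    by (simp add: mult.assoc)
  then have "card (exceptional \<tau>) * \<tau> \<le> real r * M" using n_pos by (simp add: mult_le_cancel_right)
  then show ?thesis using assms by (simp add: pos_le_divide_eq)
qed

lemma degree_dense_heavy_part_remove_exceptional:
  assumes "degree_dense r k \<epsilon> n H"
  shows "degree_dense r k (\<epsilon> + \<tau> + card (exceptional \<tau>) / n) n (heavy_part (V - exceptional \<tau>))"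
  unfolding degree_dense_def
proof
  fix v assume v: "v \<in> hverts (heavy_part (V - exceptional \<tau>))"
  let ?L = "{e\<in>light_edges. v \<in> e}"
  let ?Z = "{e\<in>E. v \<in> e \<and> e \<inter> (exceptional \<tau> - {v}) \<noteq> {}}"
  have "hdegree H v \<le> hdegree (heavy_part (V - exceptional \<tau>)) v + card (?L \<union> ?Z)"
  proof (rule degree_le_degree_plus[OF hedges_heavy_subgraph_subset])
    fix e assume "e \<in> E" "v \<in> e" "e \<notin> hedges (heavy_part (V - exceptional \<tau>))"
    then show "e \<in> ?L \<union> ?Z" using edge v by (auto simp: edge_heavy_part_iff)
  qed (use finite_edges in \<open>auto simp: light_edges_def\<close>)
  moreover have "card (?L \<union> ?Z) \<le> card ?L + card ?Z" by (rule card_Un_le)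
  moreover have "card ?L \<le> \<tau> * n ^ (r - 1)" using v by (auto simp: exceptional_def)
  moreover have "(turan_deg r k - \<epsilon>) * n ^ (r - 1) \<le> hdegree H v"
    using assms v by (auto simp: degree_dense_def)
  ultimately show "(turan_deg r k - (\<epsilon> + \<tau> + card (exceptional \<tau>) / n)) * n ^ (r - 1)
      \<le> hdegree (heavy_part (V - exceptional \<tau>)) v"
    using card_edges_at_hitting_le[OF finite_exceptional, of v \<tau>]
    unfolding left_diff_distrib distrib_right by linarith
qed

lemma r_graph_heavy_part: "W \<subseteq> V \<Longrightarrow> r_graph r (heavy_part W)"
  using r_graph by (rule r_graph_heavy_subgraph)

lemma edge_cliques_bounded_heavy_part: "W \<subseteq> V \<Longrightarrow> edge_cliques_bounded k (heavy_part W)"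
  using r_graph r_ge_2 r_le_k _ free by (rule edge_cliques_bounded_heavy_subgraph)

lemma exists_heavy_part_edge_avoiding:
  assumes "finite Z" "card Z / n * n ^ (r - 1) < hdegree (heavy_part W) v"
  obtains e where "e \<in> hedges (heavy_part W)" "v \<in> e" "e \<inter> (Z - {v}) = {}"
proof -
  have "\<not> {e\<in>hedges (heavy_part W). v \<in> e} \<subseteq> {e\<in>E. v \<in> e \<and> e \<inter> (Z - {v}) \<noteq> {}}"
  proof
    assume "{e\<in>hedges (heavy_part W). v \<in> e} \<subseteq> {e\<in>E. v \<in> e \<and> e \<inter> (Z - {v}) \<noteq> {}}"
    then have "hdegree (heavy_part W) v \<le> card {e\<in>E. v \<in> e \<and> e \<inter> (Z - {v}) \<noteq> {}}"
      unfolding hdegree_def using finite_edges by (intro card_mono) auto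
    then show False using card_edges_at_hitting_le[OF assms(1), of v] assms(2) by linarith
  qed
  then show ?thesis using that edge_heavy_part_iff by blast
qed

text \<open>Two vertices of the same class cannot lie in a common edge \<open>f\<close>: otherwise one completes them
  to a set of \<open>k + 1\<close> vertices, one further vertex from every other class, in which all pairs but
  this one are heavy, and \<open>f\<close> itself covers the remaining pair.\<close>

lemma exists_core_through_pair:
  assumes W: "W \<subseteq> V" and part: "near_partition k (n / k) (\<eta> * n) (heavy_part W) c" and "0 \<le> \<eta>"
    and room: "r + (real k + 1) * (\<eta> * n) < n / k - \<eta> * n"
    and e\<^sub>0: "e\<^sub>0 \<in> hedges (heavy_part W)" and f: "f \<in> E" "e\<^sub>0 \<inter> f = {u}"
    and v: "v \<in> f" "v \<in> W" "v \<noteq> u" "c v = c u"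
    and adj: "\<And>w. w \<in> e\<^sub>0 \<Longrightarrow> w \<noteq> u \<Longrightarrow> adjacent (heavy_part W) v w"
  obtains K where "K \<subseteq> W" "card K = Suc k" "e\<^sub>0 \<subseteq> K" "f \<inter> K = {u, v}"
    "\<And>x y. x \<in> K \<Longrightarrow> y \<in> K \<Longrightarrow> x \<noteq> y \<Longrightarrow> {x, y} \<noteq> {u, v} \<Longrightarrow> adjacent (heavy_part W) x y"
proof -
  let ?G = "heavy_part W"
  have G: "r_graph r ?G" using W by (rule r_graph_heavy_part)
  have u: "u \<in> e\<^sub>0" "v \<notin> e\<^sub>0" using f(2) v by auto
  note e\<^sub>0_props = r_graph_edge[OF G e\<^sub>0]
  have adj_e\<^sub>0: "adjacent ?G x y" if "x \<in> e\<^sub>0" "y \<in> e\<^sub>0" "x \<noteq> y" for x y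
    using that e\<^sub>0 by (auto simp: adjacent_def)
  then have "inj_on c e\<^sub>0" using near_partition_proper[OF part] by (meson inj_onI)
  define T where "T = insert v e\<^sub>0"
  have T: "T \<subseteq> W" "card T = Suc r" using e\<^sub>0_props v(2) u(2) by (auto simp: T_def)
  have "c ` T = c ` e\<^sub>0" using v(4) u(1) by (auto simp: T_def)
  then have colours: "card (c ` T) = r" "c ` T \<subseteq> {..<k}"
    using card_image[OF \<open>inj_on c e\<^sub>0\<close>] e\<^sub>0_props near_partition_range[OF part] by auto
  then have card_D: "card ({..<k} - c ` T) = k - r"
    using finite_subset[OF colours(2)] by (simp add: card_Diff_subset)
  have room': "card f + (card T + card ({..<k} - c ` T)) * (\<eta> * n) < n / k - \<eta> * n"
    using room r_le_k edge[OF f(1)] by (simp add: T(2) card_D of_nat_diff add.commute[of 1])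
  have "\<exists>S \<subseteq> W. card S = k - r \<and> c ` S = {..<k} - c ` T \<and> S \<inter> f = {} \<and>
      (\<forall>x\<in>S. \<forall>y\<in>S \<union> T. x \<noteq> y \<longrightarrow> adjacent ?G x y)"
    using near_partition_extend_clique[OF part G _ _ subset_refl room'] T(1) edge[OF f(1)] \<open>0 \<le> \<eta>\<close>
    unfolding hverts_heavy_subgraph card_D by simp
  then obtain S where S: "S \<subseteq> W" "card S = k - r" "c ` S = {..<k} - c ` T" "S \<inter> f = {}"
    and adj_S: "\<forall>x\<in>S. \<forall>y\<in>S \<union> T. x \<noteq> y \<longrightarrow> adjacent ?G x y"
    by metis
  have "finite S" "finite T" using S(1) T(1) W finite_verts finite_subset by metis+
  moreover have "S \<inter> T = {}" using S(3) by blast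
  ultimately have "card (S \<union> T) = Suc k" using S(2) T(2) r_le_k by (simp add: card_Un_disjoint)
  moreover have "f \<inter> (S \<union> T) = {u, v}" using S(4) f(2) v(1) by (auto simp: T_def)
  moreover have "adjacent ?G x y"
    if xy: "x \<in> S \<union> T" "y \<in> S \<union> T" "x \<noteq> y" "{x, y} \<noteq> {u, v}" for x y
  proof (cases "x \<in> S \<or> y \<in> S")
    case True
    then show ?thesis using xy adj_S adjacent_sym by metis
  next
    case False
    then consider "x \<in> e\<^sub>0" "y \<in> e\<^sub>0" | "x = v" "y \<in> e\<^sub>0" "y \<noteq> u" | "y = v" "x \<in> e\<^sub>0" "x \<noteq> u"
      using xy by (auto simp: T_def)
    then show ?thesis using adj_e\<^sub>0 adj adjacent_sym xy(3) by metis
  qed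
  ultimately show ?thesis using that[of "S \<union> T"] S(1) T(1) by (auto simp: T_def)
qed

lemma inj_on_near_partition:
  fixes \<epsilon> \<eta> :: real
  assumes W: "W \<subseteq> V" and part: "near_partition k (n / k) (\<eta> * n) (heavy_part W) c"
    and dense: "degree_dense r k \<epsilon> n (heavy_part W)"
    and many_edges: "r + \<eta> * n < (turan_deg r k - \<epsilon>) * n"
    and room: "r + (real k + 1) * (\<eta> * n) < n / k - \<eta> * n" "0 \<le> \<eta>"
    and f: "f \<in> E"
  shows "inj_on c (f \<inter> W)"
proof (rule inj_onI, rule ccontr)
  fix u v assume uv: "u \<in> f \<inter> W" "v \<in> f \<inter> W" "c u = c v" "u \<noteq> v"
  let ?G = "heavy_part W"
  define Z where "Z = (f - {u}) \<union> missing_neighbours ?G c v"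
  have "finite (missing_neighbours ?G c v)"
    using finite_subset[OF W finite_verts] by (simp add: missing_neighbours_def nonneighbours_def)
  then have finite_Z: "finite Z" using edge[OF f] by (simp add: Z_def)
  have "card (missing_neighbours ?G c v) \<le> \<eta> * n" using near_partition_missing[OF part] uv by simp
  moreover have "card Z \<le> card (f - {u}) + card (missing_neighbours ?G c v)"
    unfolding Z_def by (rule card_Un_le)
  moreover have "card (f - {u}) \<le> r" using edge[OF f] card_mono[of f "f - {u}"] by auto
  ultimately have "card Z < (turan_deg r k - \<epsilon>) * n" using many_edges by linarith
  then have "card Z / n * n ^ (r - 1) < (turan_deg r k - \<epsilon>) * n ^ (r - 1)"
    using n_pos by (intro mult_strict_right_mono) (auto simp: pos_divide_less_eq)
  also have "\<dots> \<le> hdegree ?G u" using dense uv by (auto simp: degree_dense_def)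
  finally obtain e\<^sub>0 where e\<^sub>0: "e\<^sub>0 \<in> hedges ?G" "u \<in> e\<^sub>0" "e\<^sub>0 \<inter> (Z - {u}) = {}"
    using exists_heavy_part_edge_avoiding[OF finite_Z] by blast
  have "adjacent ?G v w" if "w \<in> e\<^sub>0" "w \<noteq> u" for w
  proof -
    have "adjacent ?G u w" using e\<^sub>0(1,2) that by (auto simp: adjacent_def)
    then have "c w \<noteq> c v" using near_partition_proper[OF part] uv(3) by metis
    moreover have "w \<notin> missing_neighbours ?G c v" "w \<in> W"
      using e\<^sub>0 that r_graph_edge(1)[OF r_graph_heavy_part[OF W] e\<^sub>0(1)] by (auto simp: Z_def)
    ultimately show ?thesis by (simp add: missing_neighbours_def nonneighbours_iff)
  qed
  moreover have "e\<^sub>0 \<inter> f = {u}" using e\<^sub>0 uv by (auto simp: Z_def)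
  ultimately obtain K where K: "K \<subseteq> W" "card K = Suc k" "e\<^sub>0 \<subseteq> K" "f \<inter> K = {u, v}"
    "\<And>x y. x \<in> K \<Longrightarrow> y \<in> K \<Longrightarrow> x \<noteq> y \<Longrightarrow> {x, y} \<noteq> {u, v} \<Longrightarrow> adjacent ?G x y"
    using exists_core_through_pair[OF W part room(2,1) e\<^sub>0(1) f, of u v] uv by auto
  have "heavy M E P" if P: "P \<subseteq> K" "card P = 2" "P \<noteq> f \<inter> K" for P
  proof -
    obtain x y where "P = {x, y}" "x \<noteq> y" using P(2) by (auto simp: card_2_iff)
    then show ?thesis using K(4,5) P heavy_if_adjacent[of M H W x y] by auto
  qed
  moreover have "e\<^sub>0 \<in> E" using e\<^sub>0(1) by (simp add: edge_heavy_part_iff)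
  ultimately have "\<not> hgraph_free (expanded_clique r (k + 1)) H"
    using K(1-3) W f
    by (intro expanded_clique_if_heavy_pairs_except_one[OF r_graph r_ge_2 r_le_k, of K e\<^sub>0 f]) auto
  then show False using free by simp
qed

lemma card_edges_containing_two_le:
  assumes "finite U" "card U \<le> n" and "0 \<le> b"
    and "\<And>u. u \<in> U \<Longrightarrow> card (A u) \<le> b * (n ^ r / n ^ 3)"
  shows "card (\<Union>u\<in>U. A u) \<le> b / n * n ^ (r - 1)"
proof -
  have "card (\<Union>u\<in>U. A u) \<le> card U * (b * (n ^ r / n ^ 3))"
    using assms(1,4) by (rule card_UN_le_mult)
  also have "\<dots> \<le> n * (b * (n ^ r / n ^ 3))" using assms(2,3) by (intro mult_right_mono) auto
  also have "\<dots> = b / n * n ^ (r - 1)" using n_pos by (simp add: n_power power3_eq_cube)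
  finally show ?thesis .
qed

lemma card_light_edges_at_le:
  "card (\<Union>u\<in>{u\<in>V - {x}. \<not> heavy M E {x, u}}. {e\<in>E. {x, u} \<subseteq> e}) \<le> M / n * n ^ (r - 1)"
proof (rule card_edges_containing_two_le)
  show "card {u\<in>V - {x}. \<not> heavy M E {x, u}} \<le> n"
    using finite_verts by (intro of_nat_mono card_mono) auto
  fix u assume "u \<in> {u\<in>V - {x}. \<not> heavy M E {x, u}}"
  then have "Suc (card {x, u}) = 3" "\<not> heavy M E {x, u}" by auto
  then show "card {e\<in>E. {x, u} \<subseteq> e} \<le> M * (n ^ r / n ^ 3)"
    using codegree_le_if_not_heavy[OF r_graph verts_nonempty, of "{x, u}" M] by simp
qed (use finite_verts in auto)

lemma card_edges_with_missing_pair_le: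
  fixes \<eta> :: real
  assumes W: "W \<subseteq> V" and part: "near_partition k (n / k) (\<eta> * n) (heavy_part W) c" and "0 \<le> \<eta>"
  defines "N u \<equiv> missing_neighbours (heavy_part W) c u"
  shows "card (\<Union>u\<in>W - {x}. {e\<in>E. {x, u} \<subseteq> e \<and> e \<inter> (N u - {x, u}) \<noteq> {}}) \<le> \<eta> * n ^ (r - 1)"
proof -
  have "card (\<Union>u\<in>W - {x}. {e\<in>E. {x, u} \<subseteq> e \<and> e \<inter> (N u - {x, u}) \<noteq> {}}) \<le> \<eta> * n / n * n ^ (r - 1)"
  proof (rule card_edges_containing_two_le)
    show "finite (W - {x})" using finite_subset[OF W finite_verts] by simp
    show "card (W - {x}) \<le> n" using W finite_verts by (intro of_nat_mono card_mono) auto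
    fix u assume u: "u \<in> W - {x}"
    then have card_pair: "Suc (card {x, u}) = 3" by auto
    have finN: "finite (N u)"
      using finite_subset[OF W finite_verts]
      by (simp add: N_def missing_neighbours_def nonneighbours_def)
    have "card {e\<in>E. {x, u} \<subseteq> e \<and> e \<inter> (N u - {x, u}) \<noteq> {}}
        \<le> card (N u - {x, u}) * (n ^ r / n ^ Suc (card {x, u}))"
      using finN by (intro card_edges_containing_hitting_le[OF r_graph verts_nonempty]) auto
    also have "\<dots> \<le> (\<eta> * n) * (n ^ r / n ^ Suc (card {x, u}))"
    proof (rule mult_right_mono)
      have "card (N u - {x, u}) \<le> card (N u)" using finN by (intro card_mono) auto
      also have "real (card (N u)) \<le> \<eta> * n"
        using near_partition_missing[OF part] u by (simp add: N_def)
      finally show "card (N u - {x, u}) \<le> \<eta> * n" by simp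
    qed simp
    finally show "card {e\<in>E. {x, u} \<subseteq> e \<and> e \<inter> (N u - {x, u}) \<noteq> {}} \<le> \<eta> * n * (n ^ r / n ^ 3)"
      unfolding card_pair .
  qed (use assms(3) in simp)
  then show ?thesis using n_pos by simp
qed

lemma discarded_edge_cases:
  assumes rainbow: "inj_on c (e \<inter> (V - W))" and e: "e \<in> E" "x \<in> e" "e \<notin> hedges (heavy_part V)"
  obtains (light) u where "u \<in> e" "u \<in> V - {x}" "\<not> heavy M E {x, u}"
    | (hitting) "e \<inter> (W - {x}) \<noteq> {}"
    | (missing) u where "u \<in> e" "u \<in> V - W - {x}"
        "e \<inter> (missing_neighbours (heavy_part (V - W)) c u - {x, u}) \<noteq> {}"
proof -
  obtain P where "P \<subseteq> e" "card P = 2" "\<not> heavy M E P"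
    using e edge by (auto simp: edge_heavy_part_iff light_edges_def)
  then obtain u v where uv: "u \<in> e" "v \<in> e" "u \<noteq> v" "\<not> heavy M E {u, v}"
    by (auto simp: card_2_iff)
  have in_V: "u \<in> V" "v \<in> V" using uv e edge by blast+
  consider "x = u" | "x = v" | "x \<notin> {u, v}" "u \<in> W \<or> v \<in> W" | "x \<notin> {u, v}" "u \<in> V - W" "v \<in> V - W"
    using in_V by blast
  then show ?thesis
  proof cases
    case 1
    then show ?thesis using light[of v] uv in_V by auto
  next
    case 2
    then show ?thesis using light[of u] uv in_V by (auto simp: insert_commute)
  next
    case 3
    then show ?thesis using hitting uv by auto
  next
    case 4
    then have "c v \<noteq> c u" using rainbow uv by (auto simp: inj_on_def)
    moreover have "\<not> adjacent (heavy_part (V - W)) u v" using uv(4) heavy_if_adjacent by metis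
    ultimately have "v \<in> missing_neighbours (heavy_part (V - W)) c u"
      using 4 by (simp add: missing_neighbours_def nonneighbours_iff)
    then show ?thesis using missing[of u] 4 uv by auto
  qed
qed

lemma degree_dense_heavy_part_if_rainbow:
  fixes \<epsilon> \<eta> :: real
  assumes dense: "degree_dense r k \<epsilon> n H" and W: "W \<subseteq> V"
    and part: "near_partition k (n / k) (\<eta> * n) (heavy_part (V - W)) c" and "0 \<le> \<eta>"
    and rainbow: "\<And>f. f \<in> E \<Longrightarrow> inj_on c (f \<inter> (V - W))"
  shows "degree_dense r k (\<epsilon> + (M + card W) / n + \<eta>) n (heavy_part V)"
  unfolding degree_dense_def
proof
  fix x assume x: "x \<in> hverts (heavy_part V)"
  let ?N = "missing_neighbours (heavy_part (V - W)) c"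
  define A where "A = (\<Union>u\<in>{u\<in>V - {x}. \<not> heavy M E {x, u}}. {e\<in>E. {x, u} \<subseteq> e})"
  define B where "B = {e\<in>E. x \<in> e \<and> e \<inter> (W - {x}) \<noteq> {}}"
  define C where "C = (\<Union>u\<in>V - W - {x}. {e\<in>E. {x, u} \<subseteq> e \<and> e \<inter> (?N u - {x, u}) \<noteq> {}})"
  have "hdegree H x \<le> hdegree (heavy_part V) x + card (A \<union> B \<union> C)"
  proof (rule degree_le_degree_plus[OF hedges_heavy_subgraph_subset])
    fix e assume e: "e \<in> E" "x \<in> e" "e \<notin> hedges (heavy_part V)"
    show "e \<in> A \<union> B \<union> C"
      using rainbow[OF e(1)] e
      by (cases rule: discarded_edge_cases) (use e in \<open>auto simp: A_def B_def C_def\<close>)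
  qed (use finite_verts finite_edges in \<open>auto simp: A_def B_def C_def\<close>)
  moreover have "card (A \<union> B \<union> C) \<le> card A + card B + card C"
    using card_Un_le[of "A \<union> B" C] card_Un_le[of A B] by linarith
  moreover have "card A \<le> M / n * n ^ (r - 1)" unfolding A_def by (rule card_light_edges_at_le)
  moreover have "card B \<le> card W / n * n ^ (r - 1)"
    unfolding B_def using finite_subset[OF W finite_verts] by (rule card_edges_at_hitting_le)
  moreover have "card C \<le> \<eta> * n ^ (r - 1)"
    unfolding C_def using part \<open>0 \<le> \<eta>\<close> by (intro card_edges_with_missing_pair_le) auto
  moreover have "(turan_deg r k - \<epsilon>) * n ^ (r - 1) \<le> hdegree H x"
    using dense x by (auto simp: degree_dense_def)
  ultimately show "(turan_deg r k - (\<epsilon> + (M + card W) / n + \<eta>)) * n ^ (r - 1)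
      \<le> hdegree (heavy_part V) x"
    unfolding left_diff_distrib distrib_right add_divide_distrib of_nat_add by linarith
qed

lemma exists_rainbow_near_partition:
  assumes W: "W \<subseteq> V" "(1 - \<epsilon>) * n \<le> card W" and dense: "degree_dense r k \<epsilon> n (heavy_part W)"
    and force: "forces_near_partition r k \<epsilon> \<eta> V" and \<epsilon>: "\<epsilon> \<le> turan_deg r k / 2"
    and large: "r + \<eta> * n < turan_deg r k / 2 * n" "r + (real k + 1) * (\<eta> * n) < n / k - \<eta> * n"
    and "0 \<le> \<eta>"
  obtains c where "near_partition k (n / k) (\<eta> * n) (heavy_part W) c"
    "\<And>f. f \<in> E \<Longrightarrow> inj_on c (f \<inter> W)"
proof -
  have "\<exists>c. near_partition k (n / k) (\<eta> * n) (heavy_part W) c"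
    using force[unfolded forces_near_partition_def, rule_format, of "heavy_part W"] W dense
      r_graph_heavy_part[OF W(1)] edge_cliques_bounded_heavy_part[OF W(1)] by simp
  then obtain c where c: "near_partition k (n / k) (\<eta> * n) (heavy_part W) c" by blast
  have "turan_deg r k / 2 * n \<le> (turan_deg r k - \<epsilon>) * n" using \<epsilon> by (intro mult_right_mono) auto
  then have "r + \<eta> * n < (turan_deg r k - \<epsilon>) * n" using large(1) by linarith
  then show ?thesis
    using that[OF c] inj_on_near_partition[OF W(1) c dense _ large(2) \<open>0 \<le> \<eta>\<close>] by blast
qed

text \<open>Boundedly many vertices may lie in too many light edges. A first pass without them yields a
  partition that shows that they are not exceptional after all; the second pass includes them.\<close>

lemma k_partite_if_degree_dense:
  assumes dense: "degree_dense r k \<epsilon> n H"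
    and force\<^sub>1: "forces_near_partition r k \<epsilon>\<^sub>1 \<eta>\<^sub>1 V" and force\<^sub>2: "forces_near_partition r k \<epsilon>\<^sub>2 \<eta>\<^sub>2 V"
    and \<epsilon>\<^sub>1: "0 < \<epsilon>\<^sub>1" "\<epsilon>\<^sub>1 \<le> turan_deg r k / 2" and \<epsilon>\<^sub>2: "0 < \<epsilon>\<^sub>2" "\<epsilon>\<^sub>2 \<le> turan_deg r k / 2"
    and \<epsilon>: "\<epsilon> \<le> \<epsilon>\<^sub>1 / 2" "\<epsilon> \<le> \<epsilon>\<^sub>2 / 4" and \<eta>: "0 < \<eta>\<^sub>1" "\<eta>\<^sub>1 \<le> \<epsilon>\<^sub>2 / 4" "\<eta>\<^sub>1 \<le> \<eta>\<^sub>2"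
    and large: "r * M / (\<epsilon>\<^sub>1 / 4) \<le> \<epsilon>\<^sub>1 / 4 * n" "M + r * M / (\<epsilon>\<^sub>1 / 4) \<le> \<epsilon>\<^sub>2 / 2 * n"
      "r + \<eta>\<^sub>2 * n < turan_deg r k / 2 * n" "r + (real k + 1) * (\<eta>\<^sub>2 * n) < n / k - \<eta>\<^sub>2 * n"
  shows "k_partite k H"
proof -
  define W where "W = exceptional (\<epsilon>\<^sub>1 / 4)"
  have W: "W \<subseteq> V" "card W \<le> r * M / (\<epsilon>\<^sub>1 / 4)"
    unfolding W_def using exceptional_subset card_exceptional_le[of "\<epsilon>\<^sub>1 / 4"] \<epsilon>\<^sub>1 by auto
  have "card W / n \<le> \<epsilon>\<^sub>1 / 4" "(M + card W) / n \<le> \<epsilon>\<^sub>2 / 2"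
    using W(2) large(1,2) n_pos by (simp_all add: pos_divide_le_eq)
  then have "\<epsilon> + \<epsilon>\<^sub>1 / 4 + card W / n \<le> \<epsilon>\<^sub>1" "\<epsilon> + (M + card W) / n + \<eta>\<^sub>1 \<le> \<epsilon>\<^sub>2"
    using \<epsilon> \<eta>(2) by linarith+
  note slack = this
  have dense\<^sub>1: "degree_dense r k \<epsilon>\<^sub>1 n (heavy_part (V - W))"
    unfolding W_def
    by (rule degree_dense_mono[OF degree_dense_heavy_part_remove_exceptional[OF dense]])
      (use slack(1) in \<open>auto simp: W_def\<close>)
  have "card W \<le> \<epsilon>\<^sub>1 / 4 * n" "\<epsilon>\<^sub>1 / 4 * n \<le> \<epsilon>\<^sub>1 * n"
    using W(2) large(1) \<epsilon>\<^sub>1(1) by (auto intro!: mult_right_mono)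
  then have "(1 - \<epsilon>\<^sub>1) * n \<le> card (V - W)"
    using card_mono[OF finite_verts W(1)] finite_subset[OF W(1) finite_verts]
    by (simp add: card_Diff_subset[OF _ W(1)] of_nat_diff left_diff_distrib)
  moreover have "\<eta>\<^sub>1 * n \<le> \<eta>\<^sub>2 * n" "(real k + 1) * (\<eta>\<^sub>1 * n) \<le> (real k + 1) * (\<eta>\<^sub>2 * n)"
    using \<eta>(3) by (auto intro!: mult_left_mono mult_right_mono)
  then have "r + \<eta>\<^sub>1 * n < turan_deg r k / 2 * n" "r + (real k + 1) * (\<eta>\<^sub>1 * n) < n / k - \<eta>\<^sub>1 * n"
    using large(3,4) by linarith+
  ultimately obtain c\<^sub>1 where c\<^sub>1: "near_partition k (n / k) (\<eta>\<^sub>1 * n) (heavy_part (V - W)) c\<^sub>1"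
    "\<And>f. f \<in> E \<Longrightarrow> inj_on c\<^sub>1 (f \<inter> (V - W))"
    using exists_rainbow_near_partition[OF _ _ dense\<^sub>1 force\<^sub>1 \<epsilon>\<^sub>1(2)] \<eta>(1) by auto
  have dense\<^sub>2: "degree_dense r k \<epsilon>\<^sub>2 n (heavy_part V)"
    by (rule degree_dense_mono[OF degree_dense_heavy_part_if_rainbow[OF dense W(1) c\<^sub>1(1)]])
      (use slack(2) \<eta>(1) c\<^sub>1(2) in auto)
  moreover have "(1 - \<epsilon>\<^sub>2) * n \<le> card V" using \<epsilon>\<^sub>2(1) by (simp add: algebra_simps)
  ultimately obtain c\<^sub>2 where c\<^sub>2: "near_partition k (n / k) (\<eta>\<^sub>2 * n) (heavy_part V) c\<^sub>2"
    "\<And>f. f \<in> E \<Longrightarrow> inj_on c\<^sub>2 (f \<inter> V)"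
    using exists_rainbow_near_partition[OF _ _ dense\<^sub>2 force\<^sub>2 \<epsilon>\<^sub>2(2) large(3,4)] \<eta> by auto
  moreover have "f \<inter> V = f" if "f \<in> E" for f using edge[OF that] by blast
  ultimately show ?thesis
    unfolding k_partite_def using near_partition_range[OF c\<^sub>2(1)] by (intro exI[of _ c\<^sub>2]) auto
qed

end

lemma eventually_le_times_real:
  fixes C d :: real
  assumes "0 < d"
  shows "\<forall>\<^sub>F n in sequentially. C \<le> d * real n"
  using assms by real_asymp

lemma exists_class_slack:
  fixes k r :: nat and \<delta> :: real
  assumes "0 < \<delta>" "0 < k"
  shows "\<exists>\<eta> :: real. 0 < \<eta> \<and> (\<forall>\<^sub>F n in sequentially.
    r + \<eta> * n < \<delta> * n \<and> r + (real k + 1) * (\<eta> * n) < n / k - \<eta> * n)"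
proof -
  define \<eta> where "\<eta> = min (\<delta> / 2) (1 / (2 * k * (real k + 2)))"
  have \<eta>: "0 < \<eta>" "0 < \<delta> - \<eta>" using assms by (auto simp: \<eta>_def)
  have "(real k + 2) * \<eta> \<le> (real k + 2) * (1 / (2 * k * (real k + 2)))"
    unfolding \<eta>_def by (intro mult_left_mono) auto
  also have "\<dots> = 1 / (2 * k)" by simp
  also have "\<dots> < 1 / k" using assms by (simp add: field_simps)
  finally have "0 < 1 / k - (real k + 2) * \<eta>" by simp
  then have "\<forall>\<^sub>F n in sequentially. real (Suc r) \<le> (\<delta> - \<eta>) * real n"
    "\<forall>\<^sub>F n in sequentially. real (Suc r) \<le> (1 / k - (real k + 2) * \<eta>) * real n"
    using \<eta>(2) by (auto intro: eventually_le_times_real)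
  then have "\<forall>\<^sub>F n in sequentially. r + \<eta> * n < \<delta> * n \<and> r + (real k + 1) * (\<eta> * n) < n / k - \<eta> * n"
    by eventually_elim (auto simp: algebra_simps)
  then show ?thesis using \<eta>(1) by blast
qed

definition free_r_graphs :: "nat \<Rightarrow> 'b hgraph \<Rightarrow> nat \<Rightarrow> 'a hgraph set" where
  "free_r_graphs r F n = {H. r_graph r H \<and> card (hverts H) = n \<and> hgraph_free F H}"

lemma free_r_graphsD:
  assumes "H \<in> free_r_graphs r F n"
  shows "r_graph r H" "card (hverts H) = n" "hgraph_free F H"
  using assms by (auto simp: free_r_graphs_def)

theorem degree_stability:
  assumes rk: "2 \<le> r" "r \<le> k"
  shows "\<exists>\<epsilon>>0. \<forall>\<^sub>F n in sequentially.
    \<forall>H\<in>(free_r_graphs r (expanded_clique r (k + 1)) n :: 'a hgraph set).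
    degree_dense r k \<epsilon> n H \<longrightarrow> k_partite k H"
proof -
  have "0 < turan_deg r k / 2" using turan_deg_pos[of r k] rk by simp
  then obtain \<eta>\<^sub>2 :: real where \<eta>\<^sub>2: "0 < \<eta>\<^sub>2" "\<forall>\<^sub>F n in sequentially.
      r + \<eta>\<^sub>2 * n < turan_deg r k / 2 * n \<and> r + (real k + 1) * (\<eta>\<^sub>2 * n) < n / k - \<eta>\<^sub>2 * n"
    using exists_class_slack[of "turan_deg r k / 2" k r] rk by fastforce
  obtain \<epsilon>\<^sub>2 where \<epsilon>\<^sub>2: "0 < \<epsilon>\<^sub>2" "\<epsilon>\<^sub>2 \<le> turan_deg r k / 2"
    and force\<^sub>2: "\<forall>V :: 'a set. finite V \<longrightarrow> V \<noteq> {} \<longrightarrow> forces_near_partition r k \<epsilon>\<^sub>2 \<eta>\<^sub>2 V"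
    using exists_forcing_degree_slack[OF rk \<eta>\<^sub>2(1)] by blast
  define \<eta>\<^sub>1 where "\<eta>\<^sub>1 = min \<eta>\<^sub>2 (\<epsilon>\<^sub>2 / 4)"
  have \<eta>\<^sub>1: "0 < \<eta>\<^sub>1" "\<eta>\<^sub>1 \<le> \<epsilon>\<^sub>2 / 4" "\<eta>\<^sub>1 \<le> \<eta>\<^sub>2" using \<eta>\<^sub>2(1) \<epsilon>\<^sub>2(1) by (auto simp: \<eta>\<^sub>1_def)
  obtain \<epsilon>\<^sub>1 where \<epsilon>\<^sub>1: "0 < \<epsilon>\<^sub>1" "\<epsilon>\<^sub>1 \<le> turan_deg r k / 2"
    and force\<^sub>1: "\<forall>V :: 'a set. finite V \<longrightarrow> V \<noteq> {} \<longrightarrow> forces_near_partition r k \<epsilon>\<^sub>1 \<eta>\<^sub>1 V"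
    using exists_forcing_degree_slack[OF rk \<eta>\<^sub>1(1)] by blast
  define \<epsilon> where "\<epsilon> = min (\<epsilon>\<^sub>1 / 2) (\<epsilon>\<^sub>2 / 4)"
  have \<epsilon>: "0 < \<epsilon>" "\<epsilon> \<le> \<epsilon>\<^sub>1 / 2" "\<epsilon> \<le> \<epsilon>\<^sub>2 / 4" using \<epsilon>\<^sub>1(1) \<epsilon>\<^sub>2(1) by (auto simp: \<epsilon>_def)
  define w where "w = r * heavy_threshold r k / (\<epsilon>\<^sub>1 / 4)"
  have "\<forall>\<^sub>F n in sequentially. w \<le> \<epsilon>\<^sub>1 / 4 * real n"
    "\<forall>\<^sub>F n in sequentially. heavy_threshold r k + w \<le> \<epsilon>\<^sub>2 / 2 * real n"
    using \<epsilon>\<^sub>1(1) \<epsilon>\<^sub>2(1) by (simp_all add: eventually_le_times_real)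
  then have "\<forall>\<^sub>F n in sequentially. \<forall>H\<in>(free_r_graphs r (expanded_clique r (k + 1)) n :: 'a hgraph set).
      degree_dense r k \<epsilon> n H \<longrightarrow> k_partite k H"
    using \<eta>\<^sub>2(2) eventually_gt_at_top[of 0]
  proof eventually_elim
    case (elim n)
    show ?case
    proof (intro ballI impI)
      fix H :: "'a hgraph" assume "H \<in> free_r_graphs r (expanded_clique r (k + 1)) n"
      note H = free_r_graphsD[OF this]
      assume dense: "degree_dense r k \<epsilon> n H"
      have "hverts H \<noteq> {}" using H(2) elim(4) by auto
      then interpret expanded_clique_free r k H
        using H(1,3) rk by unfold_locales auto
      have force: "forces_near_partition r k \<epsilon>\<^sub>1 \<eta>\<^sub>1 V" "forces_near_partition r k \<epsilon>\<^sub>2 \<eta>\<^sub>2 V"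
        using force\<^sub>1 force\<^sub>2 finite_verts verts_nonempty by blast+
      show "k_partite k H"
        by (rule k_partite_if_degree_dense[OF _ force \<epsilon>\<^sub>1 \<epsilon>\<^sub>2 \<epsilon>(2,3) \<eta>\<^sub>1])
          (use dense elim(1-3) in \<open>simp_all add: w_def H(2)\<close>)
    qed
  qed
  then show ?thesis using \<epsilon>(1) by blast
qed

section \<open>Optimal part sizes\<close>

lemma weighted_geometric_mean_less:
  fixes \<alpha> \<beta> u w :: real
  assumes \<alpha>\<beta>: "0 < \<alpha>" "0 < \<beta>" "\<alpha> + \<beta> = 1" and uw: "0 < u" "0 < w" "u \<noteq> w"
  shows "u powr \<alpha> * w powr \<beta> < \<alpha> * u + \<beta> * w"
proof -
  define m where "m = \<alpha> * u + \<beta> * w"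
  have m: "0 < m" using \<alpha>\<beta> uw by (simp add: m_def add_pos_pos)
  have \<alpha>: "\<alpha> = 1 - \<beta>" using \<alpha>\<beta> by simp
  have "u \<noteq> m" using \<alpha>\<beta> uw by (auto simp: m_def \<alpha> algebra_simps)
  then have "u / m \<noteq> 1" "0 < u / m" using uw m by simp_all
  then have "ln (u / m) < u / m - 1"
    using ln_le_minus_one[of "u / m"] ln_eq_minus_one[of "u / m"] by force
  moreover have "ln (w / m) \<le> w / m - 1" using ln_le_minus_one[of "w / m"] uw m by simp
  ultimately have "\<alpha> * ln (u / m) + \<beta> * ln (w / m) < \<alpha> * (u / m - 1) + \<beta> * (w / m - 1)"
    using \<alpha>\<beta> by (intro add_less_le_mono mult_strict_left_mono mult_left_mono) auto
  also have "\<dots> = (\<alpha> * u + \<beta> * w) / m - (\<alpha> + \<beta>)" by (simp add: add_divide_distrib algebra_simps)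
  also have "\<dots> = 0" using \<alpha>\<beta> m by (simp flip: m_def)
  also have "\<alpha> * ln (u / m) + \<beta> * ln (w / m) = \<alpha> * ln u + \<beta> * ln w - ln m"
    using uw m by (simp add: ln_div \<alpha> algebra_simps)
  finally have "\<alpha> * ln u + \<beta> * ln w < ln m" using m by simp
  then have "exp (\<alpha> * ln u + \<beta> * ln w) < exp (ln m)" by (rule exp_less_mono)
  then show ?thesis using uw m by (simp add: exp_add powr_def m_def)
qed

lemma weighted_geometric_mean:
  fixes \<alpha> \<beta> u w :: real
  assumes \<alpha>\<beta>: "0 < \<alpha>" "0 < \<beta>" "\<alpha> + \<beta> = 1" and uw: "0 \<le> u" "0 \<le> w"
  shows "u powr \<alpha> * w powr \<beta> \<le> \<alpha> * u + \<beta> * w"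
    and "u \<noteq> w \<Longrightarrow> u powr \<alpha> * w powr \<beta> < \<alpha> * u + \<beta> * w"
proof -
  show "u powr \<alpha> * w powr \<beta> \<le> \<alpha> * u + \<beta> * w"
    using Youngs_inequality_0[of \<alpha> \<beta> u w] \<alpha>\<beta> uw by (cases "u = 0 \<or> w = 0") auto
  assume "u \<noteq> w"
  then show "u powr \<alpha> * w powr \<beta> < \<alpha> * u + \<beta> * w"
    using weighted_geometric_mean_less[OF \<alpha>\<beta>, of u w] \<alpha>\<beta> uw by (cases "u = 0 \<or> w = 0") auto
qed

text \<open>The largest possible sum of \<open>n\<close> nonnegative numbers whose \<open>p\<close>-th powers add up to \<open>Y\<close>.\<close>

definition part_sum :: "real \<Rightarrow> real \<Rightarrow> real \<Rightarrow> real" where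
  "part_sum p n Y = n powr (1 - 1 / p) * Y powr (1 / p)"

lemma part_sum_nonneg: "0 \<le> part_sum p n Y"
  by (simp add: part_sum_def)

lemma part_sum_scale:
  assumes "1 < p" "0 \<le> t" "0 \<le> n" "0 \<le> Y"
  shows "part_sum p (t * n) (t * Y) = t * part_sum p n Y"
proof -
  have "t powr (1 - 1 / p) * t powr (1 / p) = t"
    using assms by (cases "t = 0") (auto simp: powr_add[symmetric])
  then show ?thesis using assms by (simp add: part_sum_def powr_mult mult_ac)
qed

lemma part_sum_superadditive:
  assumes p: "1 < p" and nonneg: "0 \<le> n\<^sub>1" "0 \<le> n\<^sub>2" "0 \<le> Y\<^sub>1" "0 \<le> Y\<^sub>2"
  shows "part_sum p n\<^sub>1 Y\<^sub>1 + part_sum p n\<^sub>2 Y\<^sub>2 \<le> part_sum p (n\<^sub>1 + n\<^sub>2) (Y\<^sub>1 + Y\<^sub>2)" (is ?le)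
    and "n\<^sub>1 * Y\<^sub>2 \<noteq> n\<^sub>2 * Y\<^sub>1 \<Longrightarrow>
      part_sum p n\<^sub>1 Y\<^sub>1 + part_sum p n\<^sub>2 Y\<^sub>2 < part_sum p (n\<^sub>1 + n\<^sub>2) (Y\<^sub>1 + Y\<^sub>2)" (is "?ne \<Longrightarrow> ?less")
proof -
  define n where "n = n\<^sub>1 + n\<^sub>2"
  define Y where "Y = Y\<^sub>1 + Y\<^sub>2"
  have "?le \<and> (?ne \<longrightarrow> ?less)"
  proof (cases "n = 0 \<or> Y = 0")
    case True
    then show ?thesis using nonneg by (auto simp: part_sum_def n_def Y_def add_nonneg_eq_0_iff)
  next
    case False
    then have pos: "0 < n" "0 < Y" using nonneg by (auto simp: n_def Y_def)
    define mean where "mean m Z = (1 - 1 / p) * (m / n) + 1 / p * (Z / Y)" for m Z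
    have scale: "part_sum p m Z = part_sum p n Y * ((m / n) powr (1 - 1 / p) * (Z / Y) powr (1 / p))"
      if "0 \<le> m" "0 \<le> Z" for m Z
      using pos that by (simp add: part_sum_def powr_divide)
    have le: "part_sum p m Z \<le> part_sum p n Y * mean m Z" if "0 \<le> m" "0 \<le> Z" for m Z
      unfolding scale[OF that] mean_def using p pos that
      by (intro mult_left_mono weighted_geometric_mean part_sum_nonneg) auto
    have less: "part_sum p m Z < part_sum p n Y * mean m Z" if "0 \<le> m" "0 \<le> Z" "m / n \<noteq> Z / Y" for m Z
      unfolding scale[OF that(1,2)] mean_def using p pos that
      by (intro mult_strict_left_mono weighted_geometric_mean) (auto simp: part_sum_def)
    have "n\<^sub>1 / n + n\<^sub>2 / n = 1" "Y\<^sub>1 / Y + Y\<^sub>2 / Y = 1"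
      using pos unfolding add_divide_distrib[symmetric] by (auto simp: n_def Y_def)
    moreover have "mean n\<^sub>1 Y\<^sub>1 + mean n\<^sub>2 Y\<^sub>2
        = (1 - 1 / p) * (n\<^sub>1 / n + n\<^sub>2 / n) + 1 / p * (Y\<^sub>1 / Y + Y\<^sub>2 / Y)"
      by (simp add: mean_def algebra_simps)
    ultimately have "mean n\<^sub>1 Y\<^sub>1 + mean n\<^sub>2 Y\<^sub>2 = 1" by simp
    then have sum: "part_sum p n Y * mean n\<^sub>1 Y\<^sub>1 + part_sum p n Y * mean n\<^sub>2 Y\<^sub>2 = part_sum p n Y"
      by (simp flip: distrib_left)
    have "n\<^sub>1 / n \<noteq> Y\<^sub>1 / Y" if ?ne
      using that pos by (auto simp: frac_eq_eq n_def Y_def algebra_simps)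
    then show ?thesis
      using le[OF nonneg(1,3)] le[OF nonneg(2,4)] less[OF nonneg(1,3)] sum
      by (fastforce simp: n_def Y_def)
  qed
  then show ?le "?ne \<Longrightarrow> ?less" by blast+
qed

lemma part_sum_convex_combination:
  assumes p: "1 < p" and nonneg: "0 \<le> n\<^sub>1" "0 \<le> n\<^sub>2" "0 \<le> Y\<^sub>1" "0 \<le> Y\<^sub>2" and \<tau>: "0 < \<tau>" "\<tau> < 1"
  shows "(1 - \<tau>) * part_sum p n\<^sub>1 Y\<^sub>1 + \<tau> * part_sum p n\<^sub>2 Y\<^sub>2
      \<le> part_sum p ((1 - \<tau>) * n\<^sub>1 + \<tau> * n\<^sub>2) ((1 - \<tau>) * Y\<^sub>1 + \<tau> * Y\<^sub>2)"
    and "n\<^sub>1 * Y\<^sub>2 \<noteq> n\<^sub>2 * Y\<^sub>1 \<Longrightarrow> (1 - \<tau>) * part_sum p n\<^sub>1 Y\<^sub>1 + \<tau> * part_sum p n\<^sub>2 Y\<^sub>2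
      < part_sum p ((1 - \<tau>) * n\<^sub>1 + \<tau> * n\<^sub>2) ((1 - \<tau>) * Y\<^sub>1 + \<tau> * Y\<^sub>2)"
proof -
  have scale: "part_sum p ((1 - \<tau>) * n\<^sub>1) ((1 - \<tau>) * Y\<^sub>1) = (1 - \<tau>) * part_sum p n\<^sub>1 Y\<^sub>1"
    "part_sum p (\<tau> * n\<^sub>2) (\<tau> * Y\<^sub>2) = \<tau> * part_sum p n\<^sub>2 Y\<^sub>2"
    using assms by (simp_all add: part_sum_scale)
  have nonneg': "0 \<le> (1 - \<tau>) * n\<^sub>1" "0 \<le> \<tau> * n\<^sub>2" "0 \<le> (1 - \<tau>) * Y\<^sub>1" "0 \<le> \<tau> * Y\<^sub>2"
    using nonneg \<tau> by auto
  show "(1 - \<tau>) * part_sum p n\<^sub>1 Y\<^sub>1 + \<tau> * part_sum p n\<^sub>2 Y\<^sub>2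
      \<le> part_sum p ((1 - \<tau>) * n\<^sub>1 + \<tau> * n\<^sub>2) ((1 - \<tau>) * Y\<^sub>1 + \<tau> * Y\<^sub>2)"
    using part_sum_superadditive(1)[OF p nonneg'] unfolding scale .
  assume "n\<^sub>1 * Y\<^sub>2 \<noteq> n\<^sub>2 * Y\<^sub>1"
  moreover have "((1 - \<tau>) * n\<^sub>1) * (\<tau> * Y\<^sub>2) = (\<tau> * (1 - \<tau>)) * (n\<^sub>1 * Y\<^sub>2)"
    "(\<tau> * n\<^sub>2) * ((1 - \<tau>) * Y\<^sub>1) = (\<tau> * (1 - \<tau>)) * (n\<^sub>2 * Y\<^sub>1)"
    by (simp_all only: mult_ac)
  ultimately have "((1 - \<tau>) * n\<^sub>1) * (\<tau> * Y\<^sub>2) \<noteq> (\<tau> * n\<^sub>2) * ((1 - \<tau>) * Y\<^sub>1)"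
    using \<tau> by simp
  then show "(1 - \<tau>) * part_sum p n\<^sub>1 Y\<^sub>1 + \<tau> * part_sum p n\<^sub>2 Y\<^sub>2
      < part_sum p ((1 - \<tau>) * n\<^sub>1 + \<tau> * n\<^sub>2) ((1 - \<tau>) * Y\<^sub>1 + \<tau> * Y\<^sub>2)"
    using part_sum_superadditive(2)[OF p nonneg'] unfolding scale by blast
qed

lemma part_sum_proportional:
  assumes "1 < p" "0 < n\<^sub>1" "0 \<le> n\<^sub>2" "0 \<le> Y\<^sub>1" "n\<^sub>1 * Y\<^sub>2 = n\<^sub>2 * Y\<^sub>1"
  shows "part_sum p n\<^sub>2 Y\<^sub>2 = n\<^sub>2 / n\<^sub>1 * part_sum p n\<^sub>1 Y\<^sub>1"
proof -
  have "n\<^sub>2 = n\<^sub>2 / n\<^sub>1 * n\<^sub>1" "Y\<^sub>2 = n\<^sub>2 / n\<^sub>1 * Y\<^sub>1" using assms by (auto simp: field_simps)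
  then show ?thesis using part_sum_scale[of p "n\<^sub>2 / n\<^sub>1" n\<^sub>1 Y\<^sub>1] assms by simp
qed

lemma part_sum_eq_imp_not_proportional:
  assumes p: "1 < p" and n: "0 \<le> n\<^sub>2" "n\<^sub>2 < n\<^sub>1" and "0 \<le> Y\<^sub>1"
    and eq: "part_sum p n\<^sub>1 Y\<^sub>1 = part_sum p n\<^sub>2 Y\<^sub>2" and pos: "0 < part_sum p n\<^sub>1 Y\<^sub>1"
  shows "n\<^sub>1 * Y\<^sub>2 \<noteq> n\<^sub>2 * Y\<^sub>1"
proof
  assume "n\<^sub>1 * Y\<^sub>2 = n\<^sub>2 * Y\<^sub>1"
  then have "part_sum p n\<^sub>2 Y\<^sub>2 = n\<^sub>2 / n\<^sub>1 * part_sum p n\<^sub>1 Y\<^sub>1"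
    using assms by (intro part_sum_proportional) auto
  also have "\<dots> < 1 * part_sum p n\<^sub>1 Y\<^sub>1" using n pos by (intro mult_strict_right_mono) auto
  finally show False using eq by simp
qed

lemma sum_le_part_sum:
  fixes x :: "'a \<Rightarrow> real"
  assumes "finite V" "1 < p" "\<And>v. v \<in> V \<Longrightarrow> 0 \<le> x v"
  shows "sum x V \<le> part_sum p (card V) (\<Sum>v\<in>V. x v powr p)"
  using assms(1,3)
proof (induction V rule: finite_induct)
  case (insert v V)
  have "part_sum p 1 (x v powr p) = x v"
    using insert.prems assms(2) by (simp add: part_sum_def powr_powr)
  then have "sum x (insert v V) \<le> part_sum p 1 (x v powr p) + part_sum p (card V) (\<Sum>v\<in>V. x v powr p)"
    using insert by simp
  also have "\<dots> \<le> part_sum p (1 + real (card V)) (x v powr p + (\<Sum>v\<in>V. x v powr p))"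
    using assms(2) by (intro part_sum_superadditive(1)) (auto intro: sum_nonneg)
  finally show ?case using insert.hyps by simp
qed (simp add: part_sum_nonneg)

lemma product_le_product_of_averages:
  fixes s t s' t' \<tau> :: real
  assumes "0 \<le> s" "0 \<le> t" "0 < \<tau>" "\<tau> < 1" "(1 - \<tau>) * s + \<tau> * t \<le> s'" "\<tau> * s + (1 - \<tau>) * t \<le> t'"
  shows "s * t + \<tau> * (1 - \<tau>) * (s - t)\<^sup>2 \<le> s' * t'"
proof -
  have nonneg: "0 \<le> (1 - \<tau>) * s + \<tau> * t" "0 \<le> \<tau> * s + (1 - \<tau>) * t" using assms(1-4) by auto
  have "s * t + \<tau> * (1 - \<tau>) * (s - t)\<^sup>2 = ((1 - \<tau>) * s + \<tau> * t) * (\<tau> * s + (1 - \<tau>) * t)"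
    by (simp add: power2_eq_square algebra_simps)
  also have "\<dots> \<le> s' * t'" using assms(5,6) nonneg by (intro mult_mono) linarith+
  finally show ?thesis .
qed

text \<open>Replacing \<open>(n\<^sub>a, Y\<^sub>a)\<close> and \<open>(n\<^sub>b, Y\<^sub>b)\<close> by two convex combinations whose first
  coordinates are \<open>n\<^sub>a - 1\<close> and \<open>n\<^sub>b + 1\<close>; concavity of \<open>part_sum\<close> does the rest.\<close>

lemma exists_better_part_sums:
  fixes n\<^sub>a n\<^sub>b Y\<^sub>a Y\<^sub>b :: real
  assumes p: "1 < p" and n: "0 \<le> n\<^sub>b" "n\<^sub>b + 2 \<le> n\<^sub>a" and Y: "0 \<le> Y\<^sub>a" "0 \<le> Y\<^sub>b"
  defines "s \<equiv> part_sum p n\<^sub>a Y\<^sub>a" and "t \<equiv> part_sum p n\<^sub>b Y\<^sub>b"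
  shows "\<exists>Z\<^sub>a Z\<^sub>b. 0 \<le> Z\<^sub>a \<and> 0 \<le> Z\<^sub>b \<and> Z\<^sub>a + Z\<^sub>b = Y\<^sub>a + Y\<^sub>b \<and>
    s + t \<le> part_sum p (n\<^sub>a - 1) Z\<^sub>a + part_sum p (n\<^sub>b + 1) Z\<^sub>b \<and>
    s * t \<le> part_sum p (n\<^sub>a - 1) Z\<^sub>a * part_sum p (n\<^sub>b + 1) Z\<^sub>b \<and>
    (0 < s \<longrightarrow> s * t < part_sum p (n\<^sub>a - 1) Z\<^sub>a * part_sum p (n\<^sub>b + 1) Z\<^sub>b)"
proof -
  define \<tau> where "\<tau> = 1 / (n\<^sub>a - n\<^sub>b)"
  have \<tau>: "0 < \<tau>" "\<tau> < 1" "0 < 1 - \<tau>" "1 - \<tau> < 1" "\<tau> * (n\<^sub>a - n\<^sub>b) = 1"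
    using n by (auto simp: \<tau>_def field_simps)
  define Z\<^sub>a where "Z\<^sub>a = (1 - \<tau>) * Y\<^sub>a + \<tau> * Y\<^sub>b"
  define Z\<^sub>b where "Z\<^sub>b = \<tau> * Y\<^sub>a + (1 - \<tau>) * Y\<^sub>b"
  define s' where "s' = part_sum p (n\<^sub>a - 1) Z\<^sub>a"
  define t' where "t' = part_sum p (n\<^sub>b + 1) Z\<^sub>b"
  have combine: "n\<^sub>a - 1 = (1 - \<tau>) * n\<^sub>a + \<tau> * n\<^sub>b" "n\<^sub>b + 1 = \<tau> * n\<^sub>a + (1 - \<tau>) * n\<^sub>b"
    using \<tau>(5) by (simp_all add: algebra_simps)
  have "0 \<le> n\<^sub>a" using n by simp
  note concave = part_sum_convex_combination[OF p \<open>0 \<le> n\<^sub>a\<close> n(1) Y]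
  have s': "(1 - \<tau>) * s + \<tau> * t \<le> s'"
    using concave(1)[OF \<tau>(1,2)] unfolding s_def t_def s'_def Z\<^sub>a_def combine(1) .
  have t': "\<tau> * s + (1 - \<tau>) * t \<le> t'"
    using concave(1)[OF \<tau>(3,4)] unfolding s_def t_def t'_def Z\<^sub>b_def combine(2) by simp
  have nonneg: "0 \<le> s" "0 \<le> t" by (simp_all add: s_def t_def part_sum_nonneg)
  note product = product_le_product_of_averages[OF nonneg \<tau>(1,2) s' t']
  have strict: "s * t < s' * t'" if "0 < s"
  proof (cases "s = t")
    case False
    then have "0 < \<tau> * (1 - \<tau>) * (s - t)\<^sup>2" using \<tau> by simp
    then show ?thesis using product by linarith
  next
    case True
    then have "n\<^sub>a * Y\<^sub>b \<noteq> n\<^sub>b * Y\<^sub>a"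
      using part_sum_eq_imp_not_proportional[OF p n(1) _ Y(1), of n\<^sub>a Y\<^sub>b] n that
      by (simp add: s_def t_def)
    then have "(1 - \<tau>) * s + \<tau> * t < s'"
      using concave(2)[OF \<tau>(1,2)] unfolding s_def t_def s'_def Z\<^sub>a_def combine(1) by blast
    then have "s < s'" "s \<le> t'" using True t' by (simp_all add: algebra_simps)
    then show ?thesis using True that by (simp add: mult_less_le_imp_less)
  qed
  have "s * t \<le> s' * t'" using product \<tau> by (smt (verit) mult_nonneg_nonneg zero_le_power2)
  moreover have "((1 - \<tau>) * s + \<tau> * t) + (\<tau> * s + (1 - \<tau>) * t) = s + t" by (simp add: algebra_simps)
  then have "s + t \<le> s' + t'" using s' t' by linarith
  moreover have "0 \<le> Z\<^sub>a" "0 \<le> Z\<^sub>b" using \<tau> Y by (simp_all add: Z\<^sub>a_def Z\<^sub>b_def)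
  moreover have "Z\<^sub>a + Z\<^sub>b = Y\<^sub>a + Y\<^sub>b" by (simp add: Z\<^sub>a_def Z\<^sub>b_def algebra_simps)
  ultimately show ?thesis using strict unfolding s'_def t'_def by blast
qed

definition balanced :: "('i \<Rightarrow> nat) \<Rightarrow> 'i set \<Rightarrow> bool" where
  "balanced N I \<longleftrightarrow> (\<forall>i\<in>I. \<forall>j\<in>I. N i \<le> N j + 1)"

text \<open>Up to the factor \<open>r!\<close>, the largest value of the form of the complete partite \<open>r\<close>-graph with part
  sizes \<open>N\<close> when the \<open>p\<close>-th powers of the weights in part \<open>i\<close> add up to \<open>Y i\<close>.\<close>

definition part_form :: "nat \<Rightarrow> real \<Rightarrow> 'i set \<Rightarrow> ('i \<Rightarrow> nat) \<Rightarrow> ('i \<Rightarrow> real) \<Rightarrow> real" where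
  "part_form r p I N Y = esym r I (\<lambda>i. part_sum p (N i) (Y i))"

lemma exists_size_transfer:
  assumes p: "1 < p" and unbalanced: "\<not> balanced N I" and Y: "\<forall>i\<in>I. 0 \<le> Y i"
  obtains a b N' Y' where "a \<in> I" "b \<in> I" "N b + 2 \<le> N a" "N' a = N a - 1" "N' b = N b + 1"
    "0 \<le> Y' a" "0 \<le> Y' b" "Y' a + Y' b = Y a + Y b"
    "\<And>i. i \<in> I - {a, b} \<Longrightarrow> N' i = N i \<and> Y' i = Y i"
    "part_sum p (N a) (Y a) + part_sum p (N b) (Y b)
      \<le> part_sum p (N' a) (Y' a) + part_sum p (N' b) (Y' b)"
    "part_sum p (N a) (Y a) * part_sum p (N b) (Y b)
      \<le> part_sum p (N' a) (Y' a) * part_sum p (N' b) (Y' b)"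
    "0 < part_sum p (N a) (Y a) \<Longrightarrow>
      part_sum p (N a) (Y a) * part_sum p (N b) (Y b)
        < part_sum p (N' a) (Y' a) * part_sum p (N' b) (Y' b)"
proof -
  obtain a b where ab: "a \<in> I" "b \<in> I" "N b + 2 \<le> N a"
    using unbalanced by (auto simp: balanced_def not_le)
  then have neq: "a \<noteq> b" by auto
  define N' where "N' = N(a := N a - 1, b := N b + 1)"
  have N': "real (N' a) = real (N a) - 1" "real (N' b) = real (N b) + 1"
    using ab(3) neq by (auto simp: N'_def)
  obtain Z\<^sub>a Z\<^sub>b where Z: "0 \<le> Z\<^sub>a" "0 \<le> Z\<^sub>b" "Z\<^sub>a + Z\<^sub>b = Y a + Y b"
    "part_sum p (N a) (Y a) + part_sum p (N b) (Y b) \<le> part_sum p (N' a) Z\<^sub>a + part_sum p (N' b) Z\<^sub>b"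
    "part_sum p (N a) (Y a) * part_sum p (N b) (Y b) \<le> part_sum p (N' a) Z\<^sub>a * part_sum p (N' b) Z\<^sub>b"
    "0 < part_sum p (N a) (Y a) \<longrightarrow>
      part_sum p (N a) (Y a) * part_sum p (N b) (Y b) < part_sum p (N' a) Z\<^sub>a * part_sum p (N' b) Z\<^sub>b"
    using exists_better_part_sums[OF p, of "N b" "N a" "Y a" "Y b"] Y ab unfolding N' by auto
  show ?thesis
  proof (rule that[OF ab, of N' "Y(a := Z\<^sub>a, b := Z\<^sub>b)"])
    show "N' a = N a - 1" "N' b = N b + 1" using neq by (auto simp: N'_def)
    show "N' i = N i \<and> (Y(a := Z\<^sub>a, b := Z\<^sub>b)) i = Y i" if "i \<in> I - {a, b}" for i
      using that by (simp add: N'_def)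
  qed (use Z neq in auto)
qed

lemma balance_step:
  fixes N :: "'i \<Rightarrow> nat"
  assumes I: "finite I" and p: "1 < p" and r: "2 \<le> r"
    and unbalanced: "\<not> balanced N I" and Y: "\<forall>i\<in>I. 0 \<le> Y i"
  obtains N' Y' where "sum N' I = sum N I" "\<forall>i\<in>I. 0 \<le> Y' i" "sum Y' I = sum Y I"
    "(\<Sum>i\<in>I. (N' i)\<^sup>2) < (\<Sum>i\<in>I. (N i)\<^sup>2)" "part_form r p I N Y \<le> part_form r p I N' Y'"
    "r \<le> card {i\<in>I. 0 < N i} \<Longrightarrow> \<forall>i\<in>I. 0 < N i \<longrightarrow> 0 < Y i \<Longrightarrow> part_form r p I N Y < part_form r p I N' Y'"
proof (rule exists_size_transfer[OF p unbalanced Y])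
  fix a b :: 'i and N' :: "'i \<Rightarrow> nat" and Y' :: "'i \<Rightarrow> real"
  let ?f = "\<lambda>i. part_sum p (N i) (Y i)" and ?g = "\<lambda>i. part_sum p (N' i) (Y' i)"
  assume ab: "a \<in> I" "b \<in> I" "N b + 2 \<le> N a" and N': "N' a = N a - 1" "N' b = N b + 1"
    and Y': "0 \<le> Y' a" "0 \<le> Y' b" "Y' a + Y' b = Y a + Y b"
    and same: "\<And>i. i \<in> I - {a, b} \<Longrightarrow> N' i = N i \<and> Y' i = Y i"
    and sums: "?f a + ?f b \<le> ?g a + ?g b" and products: "?f a * ?f b \<le> ?g a * ?g b"
    and strict: "0 < ?f a \<Longrightarrow> ?f a * ?f b < ?g a * ?g b"
  have "a \<noteq> b" using ab(3) by auto
  note pair = I ab(1,2) this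
  have agree: "?g i = ?f i" if "i \<in> I - {a, b}" for i using same[OF that] by simp
  show ?thesis
  proof (rule that[of N' Y'])
    show "sum N' I = sum N I" using ab(3) N' same by (simp add: sum_eq_pair_plus_rest[OF pair])
    show "\<forall>i\<in>I. 0 \<le> Y' i" using Y Y'(1,2) same by (metis DiffI empty_iff insert_iff)
    show "sum Y' I = sum Y I"
      using Y'(3) same by (simp add: sum_eq_pair_plus_rest[OF pair] flip: add.assoc)
    obtain d where d: "N a = N b + 2 + d" using ab(3) le_Suc_ex by blast
    have "(N' a)\<^sup>2 + (N' b)\<^sup>2 < (N a)\<^sup>2 + (N b)\<^sup>2"
      unfolding N' d by (simp add: power2_eq_square algebra_simps)
    then show "(\<Sum>i\<in>I. (N' i)\<^sup>2) < (\<Sum>i\<in>I. (N i)\<^sup>2)"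
      using same by (simp add: sum_eq_pair_plus_rest[OF pair])
    show "part_form r p I N Y \<le> part_form r p I N' Y'"
      unfolding part_form_def using esym_mono_pair[OF pair agree part_sum_nonneg sums products] .
    assume many: "r \<le> card {i\<in>I. 0 < N i}" and pos: "\<forall>i\<in>I. 0 < N i \<longrightarrow> 0 < Y i"
    obtain s where s: "r = Suc (Suc s)" using r by (metis add_2_eq_Suc le_Suc_ex)
    have f_pos: "0 < ?f i" if "i \<in> I" "0 < N i" for i using pos that by (auto simp: part_sum_def)
    then have "card {i\<in>I. 0 < N i} \<le> card {i\<in>I. 0 < ?f i}" using I by (intro card_mono) auto
    then have "Suc (Suc s) \<le> card {i\<in>I. 0 < ?f i}" using many s by linarith
    then have "0 < esym s (I - {a, b}) ?f"
      using esym_pos_diff_pair[where f = ?f, OF I part_sum_nonneg] by blast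
    then show "part_form r p I N Y < part_form r p I N' Y'"
      unfolding part_form_def s using f_pos ab
      by (intro esym_strict_mono_pair[OF pair agree part_sum_nonneg sums strict]) auto
  qed
qed

lemma exists_balanced:
  assumes I: "finite I" and p: "1 < p" and r: "2 \<le> r" and "\<forall>i\<in>I. 0 \<le> Y i"
  shows "\<exists>N' Y'. sum N' I = sum N I \<and> (\<forall>i\<in>I. 0 \<le> Y' i) \<and> sum Y' I = sum Y I \<and> balanced N' I \<and>
    part_form r p I N Y \<le> part_form r p I N' Y'"
  using assms(4)
proof (induction "\<Sum>i\<in>I. (N i)\<^sup>2" arbitrary: N Y rule: less_induct)
  case less
  show ?case
  proof (cases "balanced N I")
    case True
    then show ?thesis using less.prems by blast
  next
    case False
    obtain N\<^sub>1 Y\<^sub>1 where step: "sum N\<^sub>1 I = sum N I" "\<forall>i\<in>I. 0 \<le> Y\<^sub>1 i" "sum Y\<^sub>1 I = sum Y I"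
      "(\<Sum>i\<in>I. (N\<^sub>1 i)\<^sup>2) < (\<Sum>i\<in>I. (N i)\<^sup>2)" "part_form r p I N Y \<le> part_form r p I N\<^sub>1 Y\<^sub>1"
      by (rule balance_step[OF I p r False less.prems])
    show ?thesis
      using less.hyps[OF step(4,2)] step(1,3,5) by (metis order_trans)
  qed
qed

lemma ex_bij_betw_fibres:
  assumes fin: "finite A" "finite B" and card: "\<And>y. card {a\<in>A. f a = y} = card {b\<in>B. g b = y}"
  obtains h where "bij_betw h A B" "\<And>a. a \<in> A \<Longrightarrow> g (h a) = f a"
proof -
  have "\<exists>b. bij_betw b {a\<in>A. f a = y} {b\<in>B. g b = y}" for y
    using fin card by (intro finite_same_card_bij) auto
  then obtain b where b: "\<And>y. bij_betw (b y) {a\<in>A. f a = y} {b\<in>B. g b = y}" by metis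
  define h where "h a = b (f a) a" for a
  have h: "h a \<in> B" "g (h a) = f a" if "a \<in> A" for a
    using bij_betwE[OF b[of "f a"]] that by (auto simp: h_def)
  have "inj_on h A"
  proof (rule inj_onI)
    fix u v assume uv: "u \<in> A" "v \<in> A" "h u = h v"
    then have "f u = f v" using h(2) by metis
    then show "u = v" using bij_betw_imp_inj_on[OF b[of "f u"]] uv by (auto simp: h_def inj_on_def)
  qed
  moreover have "b' \<in> h ` A" if "b' \<in> B" for b'
  proof -
    have "b' \<in> b (g b') ` {a\<in>A. f a = g b'}" using b[of "g b'"] that by (simp add: bij_betw_def)
    then show ?thesis by (auto simp: h_def intro!: image_eqI)
  qed
  ultimately have "bij_betw h A B" using h(1) by (auto simp: bij_betw_def)
  then show ?thesis using that h(2) by blast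
qed

lemma balanced_values:
  assumes I: "finite I" "I \<noteq> {}" and bal: "balanced N I"
  defines "m \<equiv> sum N I div card I"
  shows "\<And>i. i \<in> I \<Longrightarrow> N i = m \<or> N i = Suc m" and "card {i\<in>I. N i = Suc m} = sum N I mod card I"
proof -
  obtain j where j: "j \<in> I" "\<And>i. i \<in> I \<Longrightarrow> N j \<le> N i"
    using arg_min_if_finite[OF I, of N] by (metis not_le)
  have value_cases: "N i = N j \<or> N i = Suc (N j)" if "i \<in> I" for i
    using bal j that unfolding balanced_def by (metis Suc_eq_plus1 le_SucE le_antisym)
  define t where "t = card {i\<in>I. N i = Suc (N j)}"
  have "sum N I = (\<Sum>i\<in>I. N j + (if N i = Suc (N j) then 1 else 0))"
    by (rule sum.cong) (use value_cases in force)+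
  also have "\<dots> = card I * N j + t"
    using I(1) by (simp add: sum.distrib t_def sum.If_cases Int_def)
  finally have sum: "sum N I = card I * N j + t" .
  have "j \<notin> {i\<in>I. N i = Suc (N j)}" by simp
  then have "{i\<in>I. N i = Suc (N j)} \<subset> I" using j(1) by blast
  then have t: "t < card I" unfolding t_def using I(1) by (intro psubset_card_mono) auto
  then have m: "m = N j" unfolding m_def sum by simp
  show "\<And>i. i \<in> I \<Longrightarrow> N i = m \<or> N i = Suc m" using value_cases m by simp
  show "card {i\<in>I. N i = Suc m} = sum N I mod card I" unfolding sum using t by (simp add: m t_def)
qed

lemma card_balanced_fibre:
  assumes I: "finite I" "I \<noteq> {}" and bal: "balanced N I"
  defines "m \<equiv> sum N I div card I" and "t \<equiv> sum N I mod card I"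
  shows "card {i\<in>I. N i = y} = (if y = Suc m then t else if y = m then card I - t else 0)"
proof -
  note value_cases = balanced_values[OF I bal, folded m_def t_def]
  have "{i\<in>I. N i = m} = I - {i\<in>I. N i = Suc m}" using value_cases(1) by auto
  then have "card {i\<in>I. N i = m} = card I - t"
    using I(1) value_cases(2) by (simp add: card_Diff_subset)
  moreover have "{i\<in>I. N i = y} = {}" if "y \<noteq> m" "y \<noteq> Suc m" using value_cases(1) that by blast
  then have "card {i\<in>I. N i = y} = 0" if "y \<noteq> m" "y \<noteq> Suc m" using that by (metis card.empty)
  ultimately show ?thesis using value_cases(2) by presburger
qed

lemma balanced_matching:
  assumes "finite I" "balanced N I" "finite J" "balanced M J" "card I = card J" "sum N I = sum M J"
  obtains \<pi> where "bij_betw \<pi> I J" "\<And>i. i \<in> I \<Longrightarrow> M (\<pi> i) = N i"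
proof (cases "I = {}")
  case True
  then have "J = {}" using assms by simp
  then show ?thesis using that[of "\<lambda>_. undefined"] True by (simp add: bij_betw_def)
next
  case False
  then have "J \<noteq> {}" using assms by auto
  have "card {i\<in>I. N i = y} = card {j\<in>J. M j = y}" for y
    using card_balanced_fibre[OF assms(1) False assms(2)]
      card_balanced_fibre[OF assms(3) \<open>J \<noteq> {}\<close> assms(4)]
      assms(5,6) by simp
  then show ?thesis using ex_bij_betw_fibres[OF assms(1,3), of N M] that by metis
qed

section \<open>Complete partite hypergraphs\<close>

definition class_size :: "'a set \<Rightarrow> ('a \<Rightarrow> 'c) \<Rightarrow> 'c \<Rightarrow> nat" where
  "class_size V c i = card (colour_class V c i)"

lemma finite_colour_class: "finite V \<Longrightarrow> finite (colour_class V c i)"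
  by (simp add: colour_class_def)

lemma sum_colour_classes:
  assumes "finite V" "finite I" "c ` V \<subseteq> I"
  shows "(\<Sum>i\<in>I. sum f (colour_class V c i)) = sum f V"
  unfolding colour_class_def using assms by (rule sum.group)

lemma sum_class_size:
  assumes "finite V" "finite I" "c ` V \<subseteq> I"
  shows "sum (class_size V c) I = card V"
  using sum_colour_classes[OF assms, of "\<lambda>_. 1::nat"] by (simp add: class_size_def)

lemma bij_betw_transversals:
  "bij_betw (\<lambda>g. g ` S) (Pi\<^sub>E S (colour_class V c)) {e. e \<subseteq> V \<and> inj_on c e \<and> c ` e = S}"
proof (rule bij_betw_byWitness[where f' = "\<lambda>e. restrict (inv_into e c) S"])
  have colour: "c (g i) = i" "g i \<in> V" if "g \<in> Pi\<^sub>E S (colour_class V c)" "i \<in> S" for g i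
    using PiE_mem[OF that] by (auto simp: colour_class_def)
  have inj: "inj_on c (g ` S)" if "g \<in> Pi\<^sub>E S (colour_class V c)" for g
    by (rule inj_onI) (use colour[OF that] in auto)
  show "\<forall>g\<in>Pi\<^sub>E S (colour_class V c). restrict (inv_into (g ` S) c) S = g"
  proof
    fix g assume g: "g \<in> Pi\<^sub>E S (colour_class V c)"
    have "inv_into (g ` S) c i = g i" if "i \<in> S" for i
      using colour[OF g that] that by (intro inv_into_f_eq[OF inj[OF g]]) auto
    then show "restrict (inv_into (g ` S) c) S = g" using PiE_arb[OF g] by (auto simp: fun_eq_iff)
  qed
  show "\<forall>e\<in>{e. e \<subseteq> V \<and> inj_on c e \<and> c ` e = S}. restrict (inv_into e c) S ` S = e"
    by (auto simp: inv_into_image_cancel)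
  show "(\<lambda>g. g ` S) ` Pi\<^sub>E S (colour_class V c) \<subseteq> {e. e \<subseteq> V \<and> inj_on c e \<and> c ` e = S}"
    using colour inj by (auto simp: image_image)
  show "(\<lambda>e. restrict (inv_into e c) S) ` {e. e \<subseteq> V \<and> inj_on c e \<and> c ` e = S}
    \<subseteq> Pi\<^sub>E S (colour_class V c)"
    by (auto simp: colour_class_def)
qed

lemma prod_sum_colour_classes:
  fixes x :: "'a \<Rightarrow> 'b::comm_semiring_1"
  assumes "finite V" "finite S"
  shows "(\<Prod>i\<in>S. sum x (colour_class V c i)) = edge_sum {e. e \<subseteq> V \<and> inj_on c e \<and> c ` e = S} x"
proof -
  have inj: "inj_on g S" if "g \<in> Pi\<^sub>E S (colour_class V c)" for g
  proof (rule inj_on_inverseI)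
    show "c (g i) = i" if "i \<in> S" for i
      using PiE_mem[OF \<open>g \<in> _\<close> that] by (simp add: colour_class_def)
  qed
  have "(\<Prod>i\<in>S. sum x (colour_class V c i)) = (\<Sum>g\<in>Pi\<^sub>E S (colour_class V c). \<Prod>i\<in>S. x (g i))"
    using assms by (intro prod_sum_PiE) (auto simp: finite_colour_class)
  also have "\<dots> = (\<Sum>g\<in>Pi\<^sub>E S (colour_class V c). \<Prod>v\<in>g ` S. x v)"
    by (intro sum.cong refl) (simp add: prod.reindex[OF inj])
  also have "\<dots> = edge_sum {e. e \<subseteq> V \<and> inj_on c e \<and> c ` e = S} x"
    unfolding edge_sum_def by (rule sum.reindex_bij_betw[OF bij_betw_transversals])
  finally show ?thesis .
qed

lemma hverts_complete_partite [simp]: "hverts (complete_partite r V c) = V"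
  by (simp add: complete_partite_def)

lemma r_graph_complete_partite: "finite V \<Longrightarrow> r_graph r (complete_partite r V c)"
  by (auto simp: r_graph_def complete_partite_def)

lemma edge_sum_complete_partite:
  fixes x :: "'a \<Rightarrow> 'b::comm_semiring_1"
  assumes V: "finite V" and I: "finite I" "c ` V \<subseteq> I"
  shows "edge_sum (hedges (complete_partite r V c)) x = esym r I (\<lambda>i. sum x (colour_class V c i))"
proof -
  define E where "E = hedges (complete_partite r V c)"
  have E: "E = {e. e \<subseteq> V \<and> card e = r \<and> inj_on c e}" by (simp add: E_def complete_partite_def)
  have "finite E"
    unfolding E_def using r_graph_complete_partite[OF V] by (rule r_graph_finite_edges)
  moreover have "(`) c ` E \<subseteq> {S. S \<subseteq> I \<and> card S = r}" using I(2) by (auto simp: E card_image)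
  ultimately have "edge_sum E x = (\<Sum>S | S \<subseteq> I \<and> card S = r. edge_sum {e\<in>E. c ` e = S} x)"
    unfolding edge_sum_def using finite_subsets_card[OF I(1)] by (intro sum.group[symmetric])
  also have "\<dots> = (\<Sum>S | S \<subseteq> I \<and> card S = r. \<Prod>i\<in>S. sum x (colour_class V c i))"
  proof (rule sum.cong[OF refl])
    fix S assume S: "S \<in> {S. S \<subseteq> I \<and> card S = r}"
    then have "finite S" using finite_subset[OF _ I(1)] by simp
    moreover have "{e\<in>E. c ` e = S} = {e. e \<subseteq> V \<and> inj_on c e \<and> c ` e = S}"
      using S by (auto simp: E card_image)
    ultimately show "edge_sum {e\<in>E. c ` e = S} x = (\<Prod>i\<in>S. sum x (colour_class V c i))"
      by (simp add: prod_sum_colour_classes[OF V])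
  qed
  finally show ?thesis by (simp add: E_def esym_def)
qed

lemma hgraph_iso_complete_partite:
  assumes h: "bij_betw h V W" and \<pi>: "inj_on \<pi> (c ` V)" and colour: "\<And>v. v \<in> V \<Longrightarrow> d (h v) = \<pi> (c v)"
  shows "hgraph_iso (complete_partite r V c) (complete_partite r W d)"
proof -
  have inj: "inj_on h V" and W: "W = h ` V" using h by (auto simp: bij_betw_def)
  have rainbow: "inj_on d (h ` e) \<longleftrightarrow> inj_on c e" if e: "e \<subseteq> V" for e
  proof -
    have "inj_on d (h ` e) \<longleftrightarrow> inj_on (d \<circ> h) e"
      using inj_on_subset[OF inj e] by (rule comp_inj_on_iff)
    also have "\<dots> \<longleftrightarrow> inj_on (\<pi> \<circ> c) e" using colour e by (intro inj_on_cong) auto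
    also have "\<dots> \<longleftrightarrow> inj_on c e"
      using comp_inj_on[of c e \<pi>] inj_on_subset[OF \<pi> image_mono[OF e]] inj_on_imageI2[of \<pi> c e]
      by blast
    finally show ?thesis .
  qed
  have card: "card (h ` e) = card e" if "e \<subseteq> V" for e
    using inj_on_subset[OF inj that] by (rule card_image)
  have "(`) h ` {e. e \<subseteq> V \<and> card e = r \<and> inj_on c e} = {e. e \<subseteq> W \<and> card e = r \<and> inj_on d e}"
  proof (intro equalityI subsetI)
    fix e assume e: "e \<in> {e. e \<subseteq> W \<and> card e = r \<and> inj_on d e}"
    then obtain e' where "e' \<subseteq> V" "e = h ` e'" unfolding W by (auto simp: subset_image_iff)
    then show "e \<in> (`) h ` {e. e \<subseteq> V \<and> card e = r \<and> inj_on c e}" using e rainbow card by auto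
  qed (use rainbow card W in auto)
  then show ?thesis
    unfolding hgraph_iso_def complete_partite_def using h by (intro exI[of _ h]) simp
qed

lemma hverts_turan [simp]: "hverts (turan r n k) = {..<n}"
  by (simp add: turan_def)

lemma r_graph_turan: "r_graph r (turan r n k)"
  by (simp add: turan_def r_graph_complete_partite)

definition turan_sizes :: "nat \<Rightarrow> nat \<Rightarrow> nat \<Rightarrow> nat" where
  "turan_sizes n k = class_size {..<n} (\<lambda>v. v mod k)"

lemma sum_turan_sizes: "0 < k \<Longrightarrow> sum (turan_sizes n k) {..<k} = n"
  unfolding turan_sizes_def by (subst sum_class_size) auto

lemma turan_sizes_cases: "i < k \<Longrightarrow> turan_sizes n k i = n div k \<or> turan_sizes n k i = n div k + 1"
  using turan_part_sizes[of i k n] by (simp add: turan_sizes_def class_size_def colour_class_def)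

lemma balanced_turan_sizes: "balanced (turan_sizes n k) {..<k}"
  unfolding balanced_def
proof (intro ballI)
  fix i j assume "i \<in> {..<k}" "j \<in> {..<k}"
  then show "turan_sizes n k i \<le> turan_sizes n k j + 1"
    using turan_sizes_cases[of i k n] turan_sizes_cases[of j k n] by auto
qed

lemma balanced_complete_partite_iso_turan:
  assumes V: "finite V" and I: "finite I" "I \<noteq> {}" "c ` V \<subseteq> I" and bal: "balanced (class_size V c) I"
  shows "hgraph_iso (complete_partite r V c) (turan r (card V) (card I))"
proof -
  define k where "k = card I"
  define n where "n = card V"
  have k: "0 < k" using I by (simp add: k_def card_gt_0_iff)
  have "sum (class_size V c) I = sum (turan_sizes n k) {..<k}"
    using sum_class_size[OF V I(1,3)] sum_turan_sizes[OF k] by (simp add: n_def)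
  then obtain \<pi> where \<pi>: "bij_betw \<pi> I {..<k}" "\<And>i. i \<in> I \<Longrightarrow> turan_sizes n k (\<pi> i) = class_size V c i"
    using balanced_matching[OF I(1) bal _ balanced_turan_sizes]
    by (metis k_def card_lessThan finite_lessThan)
  have "card {v\<in>V. \<pi> (c v) = j} = card {w\<in>{..<n}. w mod k = j}" for j
  proof (cases "j < k")
    case True
    then obtain i where i: "i \<in> I" "j = \<pi> i" using \<pi>(1) by (auto simp: bij_betw_def)
    then have "{v\<in>V. \<pi> (c v) = j} = colour_class V c i"
      using \<pi>(1) I(3) by (auto simp: colour_class_def bij_betw_def inj_on_def)
    then show ?thesis
      using \<pi>(2)[OF i(1)] i(2) by (simp add: turan_sizes_def class_size_def colour_class_def)
  next
    case False
    then have "{v\<in>V. \<pi> (c v) = j} = {}" "{w\<in>{..<n}. w mod k = j} = {}"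
      using \<pi>(1) I(3) k by (auto simp: bij_betw_def)
    then show ?thesis by (simp only: card.empty)
  qed
  then obtain h where "bij_betw h V {..<n}" "\<And>v. v \<in> V \<Longrightarrow> h v mod k = \<pi> (c v)"
    using ex_bij_betw_fibres[OF V finite_lessThan, of "\<lambda>v. \<pi> (c v)" n "\<lambda>w. w mod k"] by blast
  then show ?thesis
    unfolding turan_def n_def[symmetric] k_def[symmetric]
    using \<pi>(1) I(3)
    by (intro hgraph_iso_complete_partite[where \<pi> = \<pi>]) (auto simp: bij_betw_def intro: inj_on_subset)
qed

section \<open>The p-spectral radius\<close>

lemma p_norm_eq_1_iff:
  assumes "0 < p"
  shows "p_norm p V x = 1 \<longleftrightarrow> (\<Sum>v\<in>V. \<bar>x v\<bar> powr p) = 1"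
proof
  assume "p_norm p V x = 1"
  moreover have "0 \<le> (\<Sum>v\<in>V. \<bar>x v\<bar> powr p)" by (intro sum_nonneg) simp
  then have "(\<Sum>v\<in>V. \<bar>x v\<bar> powr p) = p_norm p V x powr p"
    using assms by (simp add: p_norm_def powr_powr)
  ultimately show "(\<Sum>v\<in>V. \<bar>x v\<bar> powr p) = 1" by simp
qed (simp add: p_norm_def)

lemma graph_form_eq_edge_sum: "graph_form r H x = fact r * edge_sum (hedges H) x"
  by (simp add: graph_form_def edge_sum_def)

lemma edge_sum_scale:
  fixes x :: "'a \<Rightarrow> 'b::comm_semiring_1"
  assumes "r_graph r H"
  shows "edge_sum (hedges H) (\<lambda>v. a * x v) = a ^ r * edge_sum (hedges H) x"
  unfolding edge_sum_def sum_distrib_left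
  using r_graph_edge[OF assms] by (intro sum.cong refl) (simp add: prod.distrib)

lemma edge_sum_eq_0:
  fixes x :: "'a \<Rightarrow> 'b::comm_semiring_1"
  assumes H: "r_graph r H" and "0 < r" and x: "\<And>v. v \<in> hverts H \<Longrightarrow> x v = 0"
  shows "edge_sum (hedges H) x = 0"
  unfolding edge_sum_def
proof (intro sum.neutral ballI)
  fix e assume "e \<in> hedges H"
  then have e: "e \<subseteq> hverts H" "card e = r" "finite e" using r_graph_edge[OF H] by auto
  then obtain v where "v \<in> e" using \<open>0 < r\<close> by fastforce
  then show "prod x e = 0" using e x by (intro prod_zero) auto
qed

lemma graph_form_le_radius:
  assumes H: "r_graph r H" and verts: "hverts H \<noteq> {}" and p: "1 \<le> p" and r: "0 < r"
  shows "graph_form r H z \<le> p_spectral_radius r p H * (\<Sum>v\<in>hverts H. \<bar>z v\<bar> powr p) powr (r / p)"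
proof -
  define S where "S = (\<Sum>v\<in>hverts H. \<bar>z v\<bar> powr p)"
  show ?thesis
  proof (cases "S = 0")
    case True
    then have "z v = 0" if "v \<in> hverts H" for v
      using that r_graph_finite_verts[OF H] by (simp add: S_def sum_nonneg_eq_0_iff)
    then have "edge_sum (hedges H) z = 0" by (rule edge_sum_eq_0[OF H r])
    then show ?thesis using True by (simp add: graph_form_eq_edge_sum S_def)
  next
    case False
    moreover have "0 \<le> S" by (simp add: S_def sum_nonneg)
    ultimately have S: "0 < S" by simp
    define a where "a = S powr (- 1 / p)"
    have a: "0 < a" using S by (simp add: a_def)
    have "a powr p = S powr (- 1)" unfolding a_def powr_powr using p by simp
    then have a_p: "a powr p = 1 / S" using S by (simp add: powr_minus_divide)
    have "a ^ r = a powr r" using powr_realpow[OF a] by simp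
    also have "\<dots> = S powr (- (r / p))" unfolding a_def powr_powr by simp
    finally have a_r: "a ^ r = 1 / S powr (r / p)" by (simp add: powr_minus_divide)
    have "(\<Sum>v\<in>hverts H. \<bar>a * z v\<bar> powr p) = a powr p * S"
      unfolding S_def sum_distrib_left using a
      by (intro sum.cong refl) (simp add: abs_mult powr_mult)
    then have "p_norm p (hverts H) (\<lambda>v. a * z v) = 1" using a_p S p by (simp add: p_norm_eq_1_iff)
    then have "graph_form r H (\<lambda>v. a * z v) \<le> p_spectral_radius r p H"
      using p_spectral_radius_attained[OF H verts p] by metis
    then show ?thesis
      using S a_r
      by (simp add: graph_form_eq_edge_sum edge_sum_scale[OF H] S_def[symmetric] field_simps)
  qed
qed

lemma p_spectral_radius_nonneg:
  assumes H: "r_graph r H" and verts: "hverts H \<noteq> {}" and p: "1 \<le> p" and r: "0 < r"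
  shows "0 \<le> p_spectral_radius r p H"
proof -
  have "0 \<le> graph_form r H (\<lambda>_. 1)" by (simp add: graph_form_def)
  also have "\<dots> \<le> p_spectral_radius r p H * (\<Sum>v\<in>hverts H. \<bar>1::real\<bar> powr p) powr (r / p)"
    by (rule graph_form_le_radius[OF assms])
  finally show ?thesis
    using r_graph_finite_verts[OF H] verts by (simp add: zero_le_mult_iff card_gt_0_iff)
qed

definition principal_eigenvector :: "nat \<Rightarrow> real \<Rightarrow> 'a hgraph \<Rightarrow> ('a \<Rightarrow> real) \<Rightarrow> bool" where
  "principal_eigenvector r p H x \<longleftrightarrow>
    (\<forall>v. 0 \<le> x v) \<and> (\<Sum>v\<in>hverts H. x v powr p) = 1 \<and> graph_form r H x = p_spectral_radius r p H"

lemma principal_eigenvectorD: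
  assumes "principal_eigenvector r p H x"
  shows "0 \<le> x v" "(\<Sum>v\<in>hverts H. x v powr p) = 1" "graph_form r H x = p_spectral_radius r p H"
  using assms by (auto simp: principal_eigenvector_def)

lemma exists_principal_eigenvector:
  assumes H: "r_graph r H" and verts: "hverts H \<noteq> {}" and p: "1 \<le> p"
  shows "\<exists>x. principal_eigenvector r p H x"
proof -
  obtain x where x: "p_norm p (hverts H) x = 1" "graph_form r H x = p_spectral_radius r p H"
    "\<And>y. p_norm p (hverts H) y = 1 \<Longrightarrow> graph_form r H y \<le> graph_form r H x"
    using p_spectral_radius_attained[OF H verts p] by metis
  define y where "y v = \<bar>x v\<bar>" for v
  have norm: "p_norm p (hverts H) y = 1" using x(1) by (simp add: p_norm_def y_def)
  have "graph_form r H x \<le> graph_form r H y"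
    unfolding graph_form_def y_def
    by (intro mult_left_mono sum_mono) (auto simp: abs_prod[symmetric])
  then have "graph_form r H y = p_spectral_radius r p H" using x(2) x(3)[OF norm] by simp
  moreover have "(\<Sum>v\<in>hverts H. y v powr p) = 1" using norm p by (simp add: p_norm_eq_1_iff y_def)
  moreover have "0 \<le> y v" for v by (simp add: y_def)
  ultimately show ?thesis unfolding principal_eigenvector_def by blast
qed

lemma p_spectral_radius_iso_le:
  assumes iso: "hgraph_iso G H" and G: "r_graph r G" and H: "r_graph r H" and verts: "hverts H \<noteq> {}"
    and p: "1 \<le> p"
  shows "p_spectral_radius r p H \<le> p_spectral_radius r p G"
proof -
  obtain f where f: "bij_betw f (hverts G) (hverts H)" and edges: "(`) f ` hedges G = hedges H"
    using iso by (auto simp: hgraph_iso_def)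
  have inj: "inj_on f (hverts G)" and "hverts G \<noteq> {}" using f verts by (auto simp: bij_betw_def)
  note G_edge = r_graph_edge(1)[OF G]
  obtain x where x: "p_norm p (hverts H) x = 1" "graph_form r H x = p_spectral_radius r p H"
    using p_spectral_radius_attained[OF H verts p] by metis
  have "p_norm p (hverts G) (x \<circ> f) = 1"
    using x(1) sum.reindex_bij_betw[OF f, of "\<lambda>v. \<bar>x v\<bar> powr p"] by (simp add: p_norm_def)
  then have le: "graph_form r G (x \<circ> f) \<le> p_spectral_radius r p G"
    using p_spectral_radius_attained[OF G \<open>hverts G \<noteq> {}\<close> p] by metis
  have "inj_on ((`) f) (hedges G)"
    by (rule inj_onI) (use inj_on_image_eq_iff[OF inj G_edge G_edge] in blast)
  then have "(\<Sum>e\<in>hedges H. prod x e) = (\<Sum>e\<in>hedges G. prod x (f ` e))"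
    unfolding edges[symmetric] by (subst sum.reindex) auto
  also have "\<dots> = (\<Sum>e\<in>hedges G. prod (x \<circ> f) e)"
    by (intro sum.cong refl prod.reindex inj_on_subset[OF inj] G_edge)
  finally have "graph_form r G (x \<circ> f) = graph_form r H x" by (simp add: graph_form_def)
  then show ?thesis using le x(2) by simp
qed

lemma p_spectral_radius_iso:
  assumes iso: "hgraph_iso G H" and G: "r_graph r G" and H: "r_graph r H" and verts: "hverts H \<noteq> {}"
    and p: "1 \<le> p"
  shows "p_spectral_radius r p G = p_spectral_radius r p H"
proof (rule order_antisym)
  have "hgraph_iso H G" by (rule hgraph_iso_sym[OF iso r_graph_edge(1)[OF G]])
  moreover have "hverts G \<noteq> {}" using iso verts by (auto simp: hgraph_iso_def bij_betw_def)
  ultimately show "p_spectral_radius r p G \<le> p_spectral_radius r p H"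
    using G H p by (intro p_spectral_radius_iso_le)
qed (rule p_spectral_radius_iso_le[OF assms])

lemma tangent_slope_of_power_bound:
  fixes t S p s a b l :: real
  assumes p: "0 < p" and t: "0 < t" "t powr p + S = 1" and touch: "a + b * t = l"
    and below: "\<And>z. 0 < z \<Longrightarrow> a + b * z \<le> l * (z powr p + S) powr (s / p)"
  shows "b = s * l * t powr (p - 1)"
proof -
  define f where "f z = l * (z powr p + S) powr (s / p) - (a + b * z)" for z
  have "((\<lambda>z. z powr p + S) has_real_derivative (p * t powr (p - 1))) (at t)"
    using t(1) by (auto intro!: derivative_eq_intros has_real_derivative_powr)
  then have "((\<lambda>z. (z powr p + S) powr (s / p)) has_real_derivative
      ((s / p) * (t powr p + S) powr (s / p - of_nat 1) * (p * t powr (p - 1)))) (at t)"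
    by (rule DERIV_fun_powr) (simp add: t(2))
  then have power: "((\<lambda>z. (z powr p + S) powr (s / p)) has_real_derivative (s * t powr (p - 1))) (at t)"
    using p by (simp add: t(2))
  have "(f has_real_derivative (l * (s * t powr (p - 1)) - b)) (at t)"
    unfolding f_def by (rule derivative_eq_intros power refl | simp)+
  moreover have "f t \<le> f z" if "\<bar>t - z\<bar> < t" for z
    using below[of z] that touch t by (simp add: f_def)
  ultimately have "l * (s * t powr (p - 1)) - b = 0" using DERIV_local_min[of f _ t t] t(1) by blast
  then show ?thesis by (simp add: mult_ac)
qed

lemma eigenvector_equation:
  assumes H: "r_graph r H" and p: "1 \<le> p" and r: "0 < r" and x: "principal_eigenvector r p H x"
    and v: "v \<in> hverts H" "0 < x v"
  shows "fact r * edge_sum (hedges (link H v)) x = r * p_spectral_radius r p H * x v powr (p - 1)"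
proof (rule tangent_slope_of_power_bound)
  define a where "a = fact r * edge_sum (hedges (delete_vertex v H)) x"
  define b where "b = fact r * edge_sum (hedges (link H v)) x"
  define S where "S = (\<Sum>w\<in>hverts H - {v}. x w powr p)"
  note fin = r_graph_finite_verts[OF H]
  have form: "graph_form r H (x(v := z)) = a + b * z" for z
  proof -
    have "edge_sum (hedges (delete_vertex v H)) (x(v := z)) = edge_sum (hedges (delete_vertex v H)) x"
      by (rule edge_sum_cong) (auto simp: delete_vertex_def)
    moreover have "edge_sum (hedges (link H v)) (x(v := z)) = edge_sum (hedges (link H v)) x"
      by (rule edge_sum_link_cong) auto
    ultimately show ?thesis
      unfolding graph_form_eq_edge_sum edge_sum_split_vertex[OF H, of _ v]
      by (simp add: a_def b_def algebra_simps)
  qed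
  show "a + b * x v = p_spectral_radius r p H"
    using form[of "x v"] principal_eigenvectorD(3)[OF x] by simp
  show "x v powr p + S = 1"
    using principal_eigenvectorD(2)[OF x] fin v by (simp add: S_def sum.remove)
  show "a + b * z \<le> p_spectral_radius r p H * (z powr p + S) powr (r / p)" if "0 < z" for z
  proof -
    have "(\<Sum>w\<in>hverts H. \<bar>(x(v := z)) w\<bar> powr p) = z powr p + S"
      using fin v that principal_eigenvectorD(1)[OF x] by (simp add: sum.remove[of _ v] S_def)
    then show ?thesis
      using graph_form_le_radius[OF H _ p r, of "x(v := z)"] v(1) unfolding form by auto
  qed
qed (use p v in auto)

lemma r_graph_delete_vertex: "r_graph r H \<Longrightarrow> r_graph r (delete_vertex v H)"
  by (auto simp: r_graph_def delete_vertex_def)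

lemma hgraph_free_delete_vertex:
  assumes "hgraph_free F H"
  shows "hgraph_free F (delete_vertex v H)"
proof -
  have "hsubgraph G H" if "hsubgraph G (delete_vertex v H)" for G
    using that unfolding hsubgraph_def delete_vertex_def by auto
  then show ?thesis using assms unfolding hgraph_free_def by blast
qed

lemma card_hverts_delete_vertex:
  "v \<in> hverts H \<Longrightarrow> finite (hverts H) \<Longrightarrow> card (hverts (delete_vertex v H)) = card (hverts H) - 1"
  by (simp add: delete_vertex_def)

lemma radius_delete_vertex_ge:
  assumes H: "r_graph r H" and p: "1 < p" and r: "0 < r" and verts: "2 \<le> card (hverts H)"
    and x: "principal_eigenvector r p H x" and v: "v \<in> hverts H"
  shows "p_spectral_radius r p H * (1 - r * x v powr p)
    \<le> p_spectral_radius r p (delete_vertex v H) * (1 - x v powr p) powr (r / p)"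
proof -
  define l where "l = p_spectral_radius r p H"
  define b where "b = fact r * edge_sum (hedges (link H v)) x"
  note fin = r_graph_finite_verts[OF H]
  have "b * x v = r * l * x v powr p"
  proof (cases "x v = 0")
    case False
    then have pos: "0 < x v" using principal_eigenvectorD(1)[OF x, of v] by simp
    then have "x v powr p = x v powr (p - 1) * x v" by (simp add: powr_diff)
    then show ?thesis using eigenvector_equation[OF H _ r x v pos] p by (simp add: b_def l_def)
  qed simp
  then have "l * (1 - r * x v powr p) = l - b * x v" by (simp add: algebra_simps)
  also have "\<dots> = graph_form r (delete_vertex v H) x"
    using edge_sum_split_vertex[OF H, of x v] principal_eigenvectorD(3)[OF x]
    by (simp add: graph_form_eq_edge_sum b_def l_def algebra_simps)
  also have "\<dots> \<le> p_spectral_radius r p (delete_vertex v H) *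
      (\<Sum>w\<in>hverts (delete_vertex v H). \<bar>x w\<bar> powr p) powr (r / p)"
  proof (rule graph_form_le_radius[OF r_graph_delete_vertex[OF H]])
    have "card (hverts (delete_vertex v H)) \<noteq> 0"
      using card_hverts_delete_vertex[OF v fin] verts by linarith
    then show "hverts (delete_vertex v H) \<noteq> {}" by auto
  qed (use p r in auto)
  also have "(\<Sum>w\<in>hverts (delete_vertex v H). \<bar>x w\<bar> powr p) = 1 - x v powr p"
    using principal_eigenvectorD[OF x] fin v by (simp add: delete_vertex_def sum.remove[of _ v])
  finally show ?thesis by (simp add: l_def)
qed

lemma principal_eigenvector_le_1:
  assumes "finite (hverts H)" "0 < p" "principal_eigenvector r p H x" "v \<in> hverts H"
  shows "x v \<le> 1"
proof (rule ccontr)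
  assume "\<not> x v \<le> 1"
  then have "1 < x v powr p" using assms(2) by (intro gr_one_powr) auto
  moreover have "x v powr p \<le> (\<Sum>v\<in>hverts H. x v powr p)"
    using assms(1,4) by (intro member_le_sum) auto
  ultimately show False using principal_eigenvectorD(2)[OF assms(3)] by simp
qed

lemma p_spectral_radius_le_card:
  assumes H: "r_graph r H" and verts: "hverts H \<noteq> {}" and p: "1 \<le> p"
  shows "p_spectral_radius r p H \<le> fact r * 2 ^ card (hverts H)"
proof -
  note fin = r_graph_finite_verts[OF H]
  obtain x where x: "principal_eigenvector r p H x"
    using exists_principal_eigenvector[OF assms] by blast
  have "prod x e \<le> 1" if "e \<in> hedges H" for e
    using principal_eigenvector_le_1[OF fin _ x] principal_eigenvectorD(1)[OF x] p
      r_graph_edge(1)[OF H that]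
    by (intro prod_le_1) auto
  then have "edge_sum (hedges H) x \<le> card (hedges H)"
    using sum_mono[of "hedges H" "prod x" "\<lambda>_. 1"] by (simp add: edge_sum_def)
  moreover have "hedges H \<subseteq> Pow (hverts H)" using r_graph_edge(1)[OF H] by auto
  then have "card (hedges H) \<le> 2 ^ card (hverts H)"
    using card_mono[of "Pow (hverts H)" "hedges H"] fin by (simp add: card_Pow)
  then have "real (card (hedges H)) \<le> 2 ^ card (hverts H)" using of_nat_mono by fastforce
  ultimately have "edge_sum (hedges H) x \<le> 2 ^ card (hverts H)" by linarith
  then show ?thesis
    by (simp add: principal_eigenvectorD(3)[OF x, symmetric] graph_form_eq_edge_sum)
qed

section \<open>Partite hypergraphs and the Turan hypergraph\<close>

lemma graph_form_mono:
  assumes G: "r_graph r G" and sub: "hedges H \<subseteq> hedges G" and x: "\<And>v. v \<in> hverts G \<Longrightarrow> 0 \<le> x v"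
  shows "graph_form r H x \<le> graph_form r G x"
proof -
  have "edge_sum (hedges H) x \<le> edge_sum (hedges G) x"
    unfolding edge_sum_def using sub r_graph_finite_edges[OF G] r_graph_edge(1)[OF G] x
    by (intro sum_mono2 prod_nonneg) auto
  then show ?thesis by (simp add: graph_form_eq_edge_sum)
qed

lemma graph_form_strict_mono:
  assumes G: "r_graph r G" and sub: "hedges H \<subset> hedges G" and x: "\<And>v. v \<in> hverts G \<Longrightarrow> 0 < x v"
  shows "graph_form r H x < graph_form r G x"
proof -
  have pos: "0 < prod x e" if "e \<in> hedges G" for e
    using r_graph_edge(1)[OF G that] x by (intro prod_pos) auto
  obtain e where "e \<in> hedges G - hedges H" using sub by blast
  then have "edge_sum (hedges H) x < edge_sum (hedges G) x"
    unfolding edge_sum_def using sub r_graph_finite_edges[OF G] pos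
    by (intro sum_strict_mono2[of _ _ e]) (auto intro: less_imp_le)
  then show ?thesis by (simp add: graph_form_eq_edge_sum)
qed

lemma hedges_subset_complete_partite:
  assumes "r_graph r H" "\<forall>e\<in>hedges H. inj_on c e"
  shows "hedges H \<subseteq> hedges (complete_partite r (hverts H) c)"
  using assms r_graph_edge[OF assms(1)] by (auto simp: complete_partite_def)

lemma graph_form_complete_partite:
  assumes "finite V" "finite I" "c ` V \<subseteq> I"
  shows "graph_form r (complete_partite r V c) x = fact r * esym r I (\<lambda>i. sum x (colour_class V c i))"
  by (simp add: graph_form_eq_edge_sum edge_sum_complete_partite[OF assms])

definition class_weight :: "real \<Rightarrow> 'a set \<Rightarrow> ('a \<Rightarrow> 'c) \<Rightarrow> ('a \<Rightarrow> real) \<Rightarrow> 'c \<Rightarrow> real" where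
  "class_weight p V c x i = (\<Sum>v\<in>colour_class V c i. x v powr p)"

lemma graph_form_complete_partite_le_part_form:
  assumes V: "finite V" and I: "finite I" "c ` V \<subseteq> I" and p: "1 < p" and x: "\<And>v. v \<in> V \<Longrightarrow> 0 \<le> x v"
  shows "graph_form r (complete_partite r V c) x
    \<le> fact r * part_form r p I (class_size V c) (class_weight p V c x)"
  unfolding graph_form_complete_partite[OF V I] part_form_def class_size_def class_weight_def
  using V p x finite_colour_class[OF V]
  by (intro mult_left_mono esym_mono sum_le_part_sum sum_nonneg) (auto simp: colour_class_def)

lemma radius_le_graph_form_complete_partite:
  assumes H: "r_graph r H" and rainbow: "\<forall>e\<in>hedges H. inj_on c e" and x: "principal_eigenvector r p H x"
  shows "p_spectral_radius r p H \<le> graph_form r (complete_partite r (hverts H) c) x"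
  unfolding principal_eigenvectorD(3)[OF x, symmetric]
  using r_graph_complete_partite[OF r_graph_finite_verts[OF H]]
    hedges_subset_complete_partite[OF H rainbow]
    principal_eigenvectorD(1)[OF x]
  by (rule graph_form_mono)

lemma sum_class_weight:
  assumes "r_graph r H" "finite I" "c ` hverts H \<subseteq> I" "principal_eigenvector r p H x"
  shows "sum (class_weight p (hverts H) c x) I = 1"
  unfolding class_weight_def
  using sum_colour_classes[OF r_graph_finite_verts[OF assms(1)] assms(2,3), of "\<lambda>v. x v powr p"]
    principal_eigenvectorD(2)[OF assms(4)] by simp

lemma class_weight_nonneg: "0 \<le> class_weight p V c x i"
  by (simp add: class_weight_def sum_nonneg)

lemma class_weight_pos:
  assumes "finite V" "\<And>v. v \<in> V \<Longrightarrow> 0 < x v" "0 < class_size V c i"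
  shows "0 < class_weight p V c x i"
  unfolding class_weight_def
proof (rule sum_pos)
  show "finite (colour_class V c i)" using assms(1) by (rule finite_colour_class)
  show "colour_class V c i \<noteq> {}" using assms(3) by (auto simp: class_size_def)
  show "0 < x v powr p" if "v \<in> colour_class V c i" for v
    using assms(2)[of v] that by (auto simp: colour_class_def)
qed

lemma part_form_le_complete_partite_radius:
  assumes V: "finite V" "V \<noteq> {}" and I: "finite I" "c ` V \<subseteq> I" and p: "1 < p" and r: "0 < r"
    and Y: "\<forall>i\<in>I. 0 \<le> Y i" "sum Y I = 1"
  shows "fact r * part_form r p I (class_size V c) Y \<le> p_spectral_radius r p (complete_partite r V c)"
proof -
  define N where "N = class_size V c"
  define x where "x v = (Y (c v) / N (c v)) powr (1 / p)" for v
  have size: "card (colour_class V c i) = N i" for i by (simp add: N_def class_size_def)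
  have on_class: "x v = (Y i / N i) powr (1 / p)" if "v \<in> colour_class V c i" for v i
    using that by (simp add: x_def colour_class_def)
  have "sum x (colour_class V c i) = part_sum p (N i) (Y i)" if "i \<in> I" for i
  proof -
    have "sum x (colour_class V c i) = N i * (Y i / N i) powr (1 / p)"
      using on_class by (simp add: size)
    then show ?thesis
      using Y(1) that by (cases "N i = 0") (auto simp: part_sum_def powr_divide powr_diff)
  qed
  then have "fact r * part_form r p I N Y = graph_form r (complete_partite r V c) x"
    unfolding graph_form_complete_partite[OF V(1) I] part_form_def by (simp cong: esym_cong)
  also have "\<dots> \<le> p_spectral_radius r p (complete_partite r V c) * (\<Sum>v\<in>V. \<bar>x v\<bar> powr p) powr (r / p)"
    using graph_form_le_radius[OF r_graph_complete_partite[OF V(1)] _ _ r, of _ p x] V(2) p by simp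
  also have "\<dots> \<le> p_spectral_radius r p (complete_partite r V c) * 1"
  proof (rule mult_left_mono)
    have "(\<Sum>v\<in>colour_class V c i. \<bar>x v\<bar> powr p) \<le> Y i" if "i \<in> I" for i
      using on_class Y(1) that p by (simp add: powr_powr size)
    then have "(\<Sum>i\<in>I. \<Sum>v\<in>colour_class V c i. \<bar>x v\<bar> powr p) \<le> 1"
      using sum_mono[of I _ Y] Y(2) by metis
    then have "(\<Sum>v\<in>V. \<bar>x v\<bar> powr p) \<le> 1" by (simp only: sum_colour_classes[OF V(1) I])
    then show "(\<Sum>v\<in>V. \<bar>x v\<bar> powr p) powr (r / p) \<le> 1"
      using p by (intro powr_le1) (auto simp: abs_of_nonneg sum_nonneg)
    show "0 \<le> p_spectral_radius r p (complete_partite r V c)"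
      using p_spectral_radius_nonneg[OF r_graph_complete_partite[OF V(1)] _ less_imp_le[OF p] r]
        V(2) by simp
  qed
  finally show ?thesis by (simp add: N_def)
qed

lemma balanced_part_form_le_turan_radius:
  assumes I: "finite I" and bal: "balanced N I" and n: "0 < sum N I" and p: "1 < p" and r: "0 < r"
    and Y: "\<forall>i\<in>I. 0 \<le> Y i" "sum Y I = 1"
  shows "fact r * part_form r p I N Y \<le> p_spectral_radius r p (turan r (sum N I) (card I))"
proof -
  define n where "n = sum N I"
  define k where "k = card I"
  have k: "0 < k" using I n by (auto simp: k_def card_gt_0_iff)
  obtain \<pi> where \<pi>: "bij_betw \<pi> {..<k} I" "\<And>j. j < k \<Longrightarrow> N (\<pi> j) = turan_sizes n k j"
    using balanced_matching[OF finite_lessThan balanced_turan_sizes I bal, of k n]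
      sum_turan_sizes[OF k, of n]
    by (auto simp: n_def k_def)
  then have inj: "inj_on \<pi> {..<k}" and image: "\<pi> ` {..<k} = I" by (auto simp: bij_betw_def)
  define Z where "Z j = Y (\<pi> j)" for j
  have "part_form r p I N Y = esym r {..<k} (\<lambda>j. part_sum p (N (\<pi> j)) (Z j))"
    unfolding part_form_def image[symmetric] Z_def by (rule esym_reindex[OF finite_lessThan inj])
  also have "\<dots> = part_form r p {..<k} (turan_sizes n k) Z"
    unfolding part_form_def using \<pi>(2) by (intro esym_cong) simp
  also have "fact r * \<dots> \<le> p_spectral_radius r p (turan r n k)"
    unfolding turan_sizes_def turan_def
  proof (rule part_form_le_complete_partite_radius)
    show "\<forall>j\<in>{..<k}. 0 \<le> Z j" using Y(1) image by (auto simp: Z_def)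
    show "sum Z {..<k} = 1" using sum.reindex_bij_betw[OF \<pi>(1), of Y] Y(2) by (simp add: Z_def)
  qed (use k n p r in \<open>auto simp: n_def lessThan_empty_iff\<close>)
  finally show ?thesis by (simp add: n_def k_def)
qed

lemma part_form_le_turan_radius:
  assumes I: "finite I" and n: "0 < sum N I" and p: "1 < p" and r: "2 \<le> r"
    and Y: "\<forall>i\<in>I. 0 \<le> Y i" "sum Y I = 1"
  shows "fact r * part_form r p I N Y \<le> p_spectral_radius r p (turan r (sum N I) (card I))"
proof -
  obtain N' Y' where "sum N' I = sum N I" "\<forall>i\<in>I. 0 \<le> Y' i" "sum Y' I = sum Y I" "balanced N' I"
    and le: "part_form r p I N Y \<le> part_form r p I N' Y'"
    using exists_balanced[OF I p r Y(1)] by metis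
  then have "fact r * part_form r p I N' Y' \<le> p_spectral_radius r p (turan r (sum N I) (card I))"
    using balanced_part_form_le_turan_radius[OF I, of N' p r Y'] n p r Y(2) by simp
  moreover have "fact r * part_form r p I N Y \<le> fact r * part_form r p I N' Y'"
    using le by simp
  ultimately show ?thesis by linarith
qed

lemma unbalanced_part_form_less_turan_radius:
  assumes I: "finite I" and n: "0 < sum N I" and p: "1 < p" and r: "2 \<le> r"
    and Y: "\<forall>i\<in>I. 0 \<le> Y i" "sum Y I = 1" and unbalanced: "\<not> balanced N I"
    and many: "r \<le> card {i\<in>I. 0 < N i}" and pos: "\<forall>i\<in>I. 0 < N i \<longrightarrow> 0 < Y i"
  shows "fact r * part_form r p I N Y < p_spectral_radius r p (turan r (sum N I) (card I))"
proof -
  obtain N' Y' where "sum N' I = sum N I" "\<forall>i\<in>I. 0 \<le> Y' i" "sum Y' I = sum Y I"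
    and less: "part_form r p I N Y < part_form r p I N' Y'"
    using balance_step[OF I p r unbalanced Y(1)] many pos by metis
  then have "fact r * part_form r p I N' Y' \<le> p_spectral_radius r p (turan r (sum N I) (card I))"
    using part_form_le_turan_radius[OF I, of N' p r Y'] n p r Y(2) by simp
  moreover have "fact r * part_form r p I N Y < fact r * part_form r p I N' Y'"
    using less by simp
  ultimately show ?thesis by linarith
qed

lemma k_partite_radius_le_turan_radius:
  assumes H: "r_graph r H" and verts: "hverts H \<noteq> {}" and p: "1 < p" and r: "2 \<le> r"
    and partite: "k_partite k H"
  shows "p_spectral_radius r p H \<le> p_spectral_radius r p (turan r (card (hverts H)) k)"
proof -
  note fin = r_graph_finite_verts[OF H]
  obtain c :: "'a \<Rightarrow> nat" where c: "c ` hverts H \<subseteq> {..<k}" "\<forall>e\<in>hedges H. inj_on c e"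
    using partite by (auto simp: k_partite_def)
  have size: "sum (class_size (hverts H) c) {..<k} = card (hverts H)"
    using sum_class_size[OF fin _ c(1)] by simp
  obtain x where x: "principal_eigenvector r p H x"
    using exists_principal_eigenvector[OF H verts] p by fastforce
  have "p_spectral_radius r p H \<le> graph_form r (complete_partite r (hverts H) c) x"
    by (rule radius_le_graph_form_complete_partite[OF H c(2) x])
  also have "\<dots>
    \<le> fact r * part_form r p {..<k} (class_size (hverts H) c) (class_weight p (hverts H) c x)"
    using fin c(1) p principal_eigenvectorD(1)[OF x]
    by (intro graph_form_complete_partite_le_part_form) auto
  also have "\<dots> \<le> p_spectral_radius r p (turan r (sum (class_size (hverts H) c) {..<k}) (card {..<k}))"
    using p r fin verts sum_class_weight[OF H _ c(1) x]
    by (intro part_form_le_turan_radius) (auto simp: size card_gt_0_iff class_weight_nonneg)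
  finally show ?thesis by (simp add: size)
qed

lemma card_nonempty_classes_ge:
  assumes "finite V" "finite I" "c ` V \<subseteq> I" "e \<subseteq> V" "inj_on c e"
  shows "card e \<le> card {i\<in>I. 0 < class_size V c i}"
proof -
  have "c ` e \<subseteq> {i\<in>I. 0 < class_size V c i}"
    using assms(1,3,4) by (auto simp: class_size_def colour_class_def card_gt_0_iff)
  then have "card (c ` e) \<le> card {i\<in>I. 0 < class_size V c i}"
    using assms(2) by (intro card_mono) auto
  then show ?thesis using card_image[OF assms(5)] by simp
qed

lemma k_partite_radius_eq_turan_radius_imp_iso:
  assumes H: "r_graph r H" and edges: "hedges H \<noteq> {}" and p: "1 < p" and r: "2 \<le> r"
    and partite: "k_partite k H" and x: "principal_eigenvector r p H x" "\<And>v. v \<in> hverts H \<Longrightarrow> 0 < x v"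
    and eq: "p_spectral_radius r p H = p_spectral_radius r p (turan r (card (hverts H)) k)"
  shows "hgraph_iso H (turan r (card (hverts H)) k)"
proof -
  define V where "V = hverts H"
  have fin: "finite V" using r_graph_finite_verts[OF H] by (simp add: V_def)
  obtain c :: "'a \<Rightarrow> nat" where c: "c ` V \<subseteq> {..<k}" "\<forall>e\<in>hedges H. inj_on c e"
    using partite by (auto simp: k_partite_def V_def)
  define N where "N = class_size V c"
  define Y where "Y = class_weight p V c x"
  have N: "sum N {..<k} = card V" using sum_class_size[OF fin _ c(1)] by (simp add: N_def)
  have Y: "\<forall>i\<in>{..<k}. 0 \<le> Y i" "sum Y {..<k} = 1" "\<forall>i\<in>{..<k}. 0 < N i \<longrightarrow> 0 < Y i"
    using sum_class_weight[OF H _ c(1)[unfolded V_def] x(1)] class_weight_pos[OF fin, of x c] x(2)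
    by (auto simp: Y_def N_def V_def class_weight_nonneg)
  obtain e where "e \<in> hedges H" using edges by auto
  then have e: "e \<subseteq> V" "card e = r" "inj_on c e" using r_graph_edge[OF H] c(2) by (auto simp: V_def)
  then have many: "r \<le> card {i\<in>{..<k}. 0 < N i}"
    using card_nonempty_classes_ge[OF fin _ c(1), of e] by (simp add: N_def)
  have "V \<noteq> {}" using e r by auto
  then have pos: "0 < sum N {..<k}" using fin N by (simp add: card_gt_0_iff)
  note form_le = radius_le_graph_form_complete_partite[OF H c(2) x(1), folded V_def]
    graph_form_complete_partite_le_part_form[OF fin finite_lessThan c(1) p, of x r, folded N_def Y_def]
  have "H = complete_partite r V c"
  proof (rule ccontr)
    assume "H \<noteq> complete_partite r V c"
    then have "hedges H \<subset> hedges (complete_partite r V c)"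
      using hedges_subset_complete_partite[OF H c(2)]
      by (auto simp: V_def complete_partite_def prod_eq_iff)
    then have "graph_form r H x < graph_form r (complete_partite r V c) x"
      using x(2) by (intro graph_form_strict_mono r_graph_complete_partite fin) (auto simp: V_def)
    moreover have "fact r * part_form r p {..<k} N Y \<le> p_spectral_radius r p (turan r (card V) k)"
      using part_form_le_turan_radius[OF _ pos p r Y(1,2)] N by simp
    ultimately show False
      using form_le(2) principal_eigenvectorD(1,3)[OF x(1)] eq by (simp add: V_def)
  qed
  moreover have "balanced N {..<k}"
  proof (rule ccontr)
    assume "\<not> balanced N {..<k}"
    then have "fact r * part_form r p {..<k} N Y < p_spectral_radius r p (turan r (card V) k)"
      using unbalanced_part_form_less_turan_radius[OF _ pos p r Y(1,2) _ many Y(3)] N by simp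
    then show False using form_le principal_eigenvectorD(1)[OF x(1)] eq by (simp add: V_def)
  qed
  then have "hgraph_iso (complete_partite r V c) (turan r (card V) (card {..<k}))"
    using balanced_complete_partite_iso_turan[OF fin finite_lessThan _ c(1)] \<open>V \<noteq> {}\<close> c(1)
    by (auto simp: N_def)
  ultimately show ?thesis by (simp add: V_def)
qed

definition turan_const :: "nat \<Rightarrow> nat \<Rightarrow> real" where
  "turan_const r k = fact r * (k choose r) / k ^ r"

lemma turan_const_pos: "r \<le> k \<Longrightarrow> 0 < k \<Longrightarrow> 0 < turan_const r k"
  by (simp add: turan_const_def)

lemma turan_const_eq_turan_deg:
  assumes "1 \<le> r" "r \<le> k"
  shows "r * turan_const r k / fact r = turan_deg r k"
proof -
  have "real r * real (k choose r) = real k * real ((k - 1) choose (r - 1))"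
    using times_binomial_minus1_eq[of r k] assms by (simp flip: of_nat_mult)
  then have "r * turan_const r k / fact r = real k * real ((k - 1) choose (r - 1)) / k ^ r"
    by (simp add: turan_const_def)
  also have "\<dots> = turan_deg r k" using assms by (cases r) (auto simp: turan_deg_def)
  finally show ?thesis .
qed

lemma k_partite_radius_le:
  assumes H: "r_graph r H" and verts: "hverts H \<noteq> {}" and p: "1 < p" and partite: "k_partite k H"
  shows "p_spectral_radius r p H \<le> turan_const r k * real (card (hverts H)) powr (r - r / p)"
proof -
  define n where "n = real (card (hverts H))"
  note fin = r_graph_finite_verts[OF H]
  have n: "0 < n" using fin verts by (simp add: n_def card_gt_0_iff)
  obtain c :: "'a \<Rightarrow> nat" where c: "c ` hverts H \<subseteq> {..<k}" "\<forall>e\<in>hedges H. inj_on c e"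
    using partite by (auto simp: k_partite_def)
  obtain x where x: "principal_eigenvector r p H x"
    using exists_principal_eigenvector[OF H verts] p by fastforce
  note nonneg = principal_eigenvectorD(1)[OF x]
  let ?s = "\<lambda>i. sum x (colour_class (hverts H) c i)"
  have "p_spectral_radius r p H \<le> fact r * esym r {..<k} ?s"
    using radius_le_graph_form_complete_partite[OF H c(2) x]
    unfolding graph_form_complete_partite[OF fin finite_lessThan c(1)] .
  also have "\<dots> \<le> fact r * ((k choose r) * (sum ?s {..<k} / k) ^ r)"
    using nonneg by (intro mult_left_mono esym_le_choose) (auto intro: sum_nonneg)
  also have "\<dots> = turan_const r k * sum x (hverts H) ^ r"
    by (simp add: sum_colour_classes[OF fin finite_lessThan c(1)] turan_const_def power_divide)
  also have "\<dots> \<le> turan_const r k * (n powr (1 - 1 / p)) ^ r"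
    using sum_le_part_sum[OF fin p, of x] nonneg principal_eigenvectorD(2)[OF x]
    by (intro mult_left_mono power_mono)
      (auto simp: part_sum_def n_def turan_const_def intro: sum_nonneg)
  also have "(n powr (1 - 1 / p)) ^ r = n powr (r * (1 - 1 / p))"
    using n by (simp add: powr_realpow[symmetric] powr_powr mult.commute)
  finally show ?thesis by (simp add: n_def algebra_simps)
qed

lemma abs_prod_one_plus_diff_le:
  fixes \<tau> :: "'a \<Rightarrow> real"
  assumes "finite S" "\<And>i. i \<in> S \<Longrightarrow> \<bar>\<tau> i\<bar> \<le> h" and h: "0 \<le> h" "h \<le> 1"
  shows "\<bar>(\<Prod>i\<in>S. 1 + \<tau> i) - 1 - sum \<tau> S\<bar> \<le> 3 ^ card S * h\<^sup>2"
  using assms(1,2)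
proof (induction rule: finite_induct)
  case (insert j S)
  define P where "P = (\<Prod>i\<in>S. 1 + \<tau> i) - 1 - sum \<tau> S"
  have P: "\<bar>P\<bar> \<le> 3 ^ card S * h\<^sup>2" and j: "\<bar>\<tau> j\<bar> \<le> h" using insert by (auto simp: P_def)
  have "\<bar>sum \<tau> S\<bar> \<le> (\<Sum>i\<in>S. h)" using insert.prems by (intro order_trans[OF sum_abs] sum_mono) auto
  then have "\<bar>\<tau> j * sum \<tau> S\<bar> \<le> h * (card S * h)"
    unfolding abs_mult using j h by (intro mult_mono) auto
  also have "\<dots> = card S * h\<^sup>2" by (simp add: power2_eq_square)
  also have "\<dots> \<le> 3 ^ card S * h\<^sup>2"
  proof (rule mult_right_mono)
    have "card S < 3 ^ card S" using power_gt_expt[of 3 "card S"] by simp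
    then show "real (card S) \<le> 3 ^ card S"
      by (metis less_imp_le of_nat_le_iff of_nat_numeral of_nat_power)
  qed simp
  finally have "\<bar>\<tau> j * sum \<tau> S\<bar> \<le> 3 ^ card S * h\<^sup>2" .
  moreover have "\<bar>P * (1 + \<tau> j)\<bar> \<le> (3 ^ card S * h\<^sup>2) * 2"
    unfolding abs_mult using P j h by (intro mult_mono) auto
  moreover have "(\<Prod>i\<in>insert j S. 1 + \<tau> i) - 1 - sum \<tau> (insert j S) = P * (1 + \<tau> j) + \<tau> j * sum \<tau> S"
    using insert.hyps by (simp add: P_def algebra_simps)
  ultimately show ?case using insert.hyps by simp
qed simp

lemma sum_sum_subsets:
  fixes \<tau> :: "'i \<Rightarrow> 'b::comm_semiring_1"
  assumes I: "finite I"
  shows "(\<Sum>S | S \<subseteq> I \<and> card S = Suc s. sum \<tau> S) = of_nat ((card I - 1) choose s) * sum \<tau> I"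
proof -
  have "(\<Sum>S | S \<subseteq> I \<and> card S = Suc s. sum \<tau> S)
      = (\<Sum>S | S \<subseteq> I \<and> card S = Suc s. \<Sum>i\<in>{i\<in>I. i \<in> S}. \<tau> i)"
    by (intro sum.cong refl) auto
  also have "\<dots> = (\<Sum>i\<in>I. \<Sum>S\<in>{S \<in> {S. S \<subseteq> I \<and> card S = Suc s}. i \<in> S}. \<tau> i)"
    using I by (intro sum.swap_restrict finite_subsets_card)
  also have "\<dots> = (\<Sum>i\<in>I. of_nat ((card I - 1) choose s) * \<tau> i)"
  proof (rule sum.cong[OF refl])
    fix i assume i: "i \<in> I"
    have I': "finite (I - {i})" "i \<notin> I - {i}" "insert i (I - {i}) = I" using I i by auto
    have "{S \<in> {S. S \<subseteq> I \<and> card S = Suc s}. i \<in> S} = insert i ` {S. S \<subseteq> I - {i} \<and> card S = s}"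
      using subsets_card_Suc_insert[OF I'(1,2), of s] unfolding I'(3) by auto
    moreover have "inj_on (insert i) {S. S \<subseteq> I - {i} \<and> card S = s}" by (auto simp: inj_on_def)
    ultimately have "card {S \<in> {S. S \<subseteq> I \<and> card S = Suc s}. i \<in> S} = (card I - 1) choose s"
      using n_subsets[OF I'(1), of s] i I by (simp add: card_image)
    then show "(\<Sum>S\<in>{S \<in> {S. S \<subseteq> I \<and> card S = Suc s}. i \<in> S}. \<tau> i)
      = of_nat ((card I - 1) choose s) * \<tau> i"
      by simp
  qed
  finally show ?thesis by (simp add: sum_distrib_left)
qed

lemma esym_one_plus_ge:
  fixes \<tau> :: "'i \<Rightarrow> real" and h :: real
  assumes I: "finite I" and s: "0 < s" and \<tau>: "sum \<tau> I = 0" "\<And>i. i \<in> I \<Longrightarrow> \<bar>\<tau> i\<bar> \<le> h"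
    and h: "0 \<le> h" "h \<le> 1"
  shows "(card I choose s) * (1 - 3 ^ s * h\<^sup>2) \<le> esym s I (\<lambda>i. 1 + \<tau> i)"
proof -
  obtain t where t: "s = Suc t" using s gr0_implies_Suc by blast
  have "(\<Sum>S | S \<subseteq> I \<and> card S = s. 1 + sum \<tau> S - 3 ^ s * h\<^sup>2)
      = (\<Sum>S | S \<subseteq> I \<and> card S = s. 1 - 3 ^ s * h\<^sup>2) + (\<Sum>S | S \<subseteq> I \<and> card S = s. sum \<tau> S)"
    unfolding sum.distrib[symmetric] by (intro sum.cong) auto
  also have "\<dots> = (card I choose s) * (1 - 3 ^ s * h\<^sup>2)"
    using sum_sum_subsets[OF I, of \<tau> t] \<tau>(1) n_subsets[OF I, of s] by (simp add: t)
  finally have "(card I choose s) * (1 - 3 ^ s * h\<^sup>2)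
      = (\<Sum>S | S \<subseteq> I \<and> card S = s. 1 + sum \<tau> S - 3 ^ s * h\<^sup>2)" ..
  also have "\<dots> \<le> esym s I (\<lambda>i. 1 + \<tau> i)"
    unfolding esym_def
  proof (rule sum_mono)
    fix S assume S: "S \<in> {S. S \<subseteq> I \<and> card S = s}"
    then have "\<bar>(\<Prod>i\<in>S. 1 + \<tau> i) - 1 - sum \<tau> S\<bar> \<le> 3 ^ card S * h\<^sup>2"
      using \<tau>(2) h finite_subset[OF _ I] by (intro abs_prod_one_plus_diff_le) auto
    then show "1 + sum \<tau> S - 3 ^ s * h\<^sup>2 \<le> (\<Prod>i\<in>S. 1 + \<tau> i)" using S by (simp add: abs_le_iff)
  qed
  finally show ?thesis .
qed

lemma turan_sizes_near_mean:
  assumes "i < k" "0 < n"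
  shows "\<bar>turan_sizes n k i * k / n - 1\<bar> \<le> k / n"
proof -
  have "real (n div k) = \<lfloor>n / k\<rfloor>" by (simp add: floor_divide_of_nat_eq)
  then have "real (n div k) \<le> n / k" "n / k < real (n div k) + 1" by linarith+
  then have "\<bar>real (turan_sizes n k i) - n / k\<bar> \<le> 1"
    using turan_sizes_cases[OF assms(1), of n] by auto
  then have "\<bar>real (turan_sizes n k i) - n / k\<bar> * (k / n) \<le> 1 * (k / n)"
    by (rule mult_right_mono) simp
  also have "\<bar>real (turan_sizes n k i) - n / k\<bar> * (k / n) = \<bar>(turan_sizes n k i - n / k) * (k / n)\<bar>"
    by (simp add: abs_mult)
  also have "(turan_sizes n k i - n / k) * (k / n) = turan_sizes n k i * k / n - 1"
    using assms by (simp add: left_diff_distrib diff_divide_distrib)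
  finally show ?thesis by simp
qed

lemma esym_turan_sizes_ge:
  assumes "0 < r" "0 < k" "k \<le> n"
  shows "(real n / real k) ^ r * ((k choose r) * (1 - 3 ^ r * (real k / real n)\<^sup>2))
    \<le> esym r {..<k} (\<lambda>i. real (turan_sizes n k i))"
proof -
  define \<tau> where "\<tau> i = turan_sizes n k i * k / n - 1" for i
  have n: "0 < n" using assms by simp
  have "(\<Sum>i<k. real (turan_sizes n k i)) = n"
    using sum_turan_sizes[OF assms(2), of n] by (simp flip: of_nat_sum)
  then have "sum \<tau> {..<k} = 0"
    using assms n by (simp add: \<tau>_def sum_subtractf flip: sum_divide_distrib sum_distrib_right)
  then have "(k choose r) * (1 - 3 ^ r * (real k / real n)\<^sup>2) \<le> esym r {..<k} (\<lambda>i. 1 + \<tau> i)"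
    using esym_one_plus_ge[of "{..<k}" r \<tau> "real k / real n"] turan_sizes_near_mean[OF _ n] assms
    by (simp add: \<tau>_def)
  then have "(real n / real k) ^ r * ((k choose r) * (1 - 3 ^ r * (real k / real n)\<^sup>2))
    \<le> esym r {..<k} (\<lambda>i. real n / real k * (1 + \<tau> i))"
    unfolding esym_scale by (intro mult_left_mono) auto
  moreover have "real n / real k * (1 + \<tau> i) = real (turan_sizes n k i)" for i
    using assms n by (simp add: \<tau>_def)
  ultimately show ?thesis by (simp only:)
qed

lemma turan_radius_ge:
  assumes p: "1 \<le> p" and r: "0 < r" and k: "0 < k" "k \<le> n"
  shows "turan_const r k * real n powr (r - r / p) * (1 - 3 ^ r * (real k / real n)\<^sup>2)
    \<le> p_spectral_radius r p (turan r n k)"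
proof -
  have n: "0 < n" using k by simp
  have "turan_const r k * real n powr r * (1 - 3 ^ r * (real k / real n)\<^sup>2)
      = fact r * ((real n / real k) ^ r * ((k choose r) * (1 - 3 ^ r * (real k / real n)\<^sup>2)))"
    using n by (simp add: turan_const_def power_divide powr_realpow)
  also have "\<dots> \<le> fact r * esym r {..<k} (\<lambda>i. real (turan_sizes n k i))"
    using esym_turan_sizes_ge[OF r k] by (intro mult_left_mono) auto
  also have "\<dots> = graph_form r (turan r n k) (\<lambda>_. 1)"
    unfolding turan_def turan_sizes_def class_size_def
    using k by (subst graph_form_complete_partite[where I = "{..<k}"]) auto
  also have "\<dots> \<le> p_spectral_radius r p (turan r n k) * real n powr (r / p)"
    using graph_form_le_radius[OF r_graph_turan _ p r, of n k "\<lambda>_. 1"] n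
    by (simp add: lessThan_empty_iff)
  finally have "turan_const r k * real n powr r * (1 - 3 ^ r * (real k / real n)\<^sup>2) / real n powr (r / p)
      \<le> p_spectral_radius r p (turan r n k)" using n by (simp add: pos_divide_le_eq)
  then show ?thesis by (simp add: powr_diff mult_ac)
qed

section \<open>Large weights force large degrees\<close>

lemma edge_sum_le_card_plus:
  fixes \<xi> :: "'a \<Rightarrow> real" and a :: real
  assumes V: "finite V" "V \<noteq> {}" and E: "E \<subseteq> {S. S \<subseteq> V \<and> card S = s}" and a: "0 \<le> a" "a \<le> 1"
    and \<xi>: "\<And>u. u \<in> V \<Longrightarrow> a \<le> \<xi> u" "sum \<xi> V \<le> card V"
  shows "edge_sum E \<xi> \<le> card E + (1 - a ^ s) * card V ^ s"
proof -
  define C where "C = real (card V choose s)"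
  have card: "real (card {S. S \<subseteq> V \<and> card S = s}) = C" using n_subsets[OF V(1)] by (simp add: C_def)
  have pow: "0 \<le> a ^ s" "a ^ s \<le> 1" using a by (auto simp: power_le_one)
  have nonneg: "0 \<le> \<xi> u" if "u \<in> V" for u using \<xi>(1)[OF that] a(1) by linarith
  have "edge_sum E \<xi> - card E * a ^ s = (\<Sum>S\<in>E. prod \<xi> S - a ^ s)"
    by (simp add: edge_sum_def sum_subtractf)
  also have "\<dots> \<le> (\<Sum>S | S \<subseteq> V \<and> card S = s. prod \<xi> S - a ^ s)"
  proof (rule sum_mono2[OF finite_subsets_card[OF V(1)] E])
    fix S assume "S \<in> {S. S \<subseteq> V \<and> card S = s} - E"
    then have S: "S \<subseteq> V" "card S = s" by auto
    have "(\<Prod>u\<in>S. a) \<le> prod \<xi> S" using \<xi>(1) S(1) a(1) by (intro prod_mono) auto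
    then show "0 \<le> prod \<xi> S - a ^ s" using S(2) by simp
  qed
  also have "\<dots> = esym s V \<xi> - C * a ^ s" by (simp add: esym_def sum_subtractf card)
  also have "\<dots> \<le> C * 1 - C * a ^ s"
  proof (intro diff_right_mono)
    have "0 \<le> sum \<xi> V / card V" by (intro divide_nonneg_nonneg sum_nonneg nonneg) auto
    moreover have "sum \<xi> V / card V \<le> 1" using \<xi>(2) V by (simp add: divide_le_eq_1 card_gt_0_iff)
    ultimately have "C * (sum \<xi> V / card V) ^ s \<le> C * 1"
      by (intro mult_left_mono power_le_one) (auto simp: C_def)
    then show "esym s V \<xi> \<le> C * 1"
      using maclaurin_esym[where x = \<xi> and s = s, OF V nonneg] by (simp add: C_def)
  qed
  also have "\<dots> = (1 - a ^ s) * C" by (simp add: algebra_simps)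
  also have "\<dots> \<le> (1 - a ^ s) * card V ^ s"
  proof (rule mult_left_mono)
    have "card V choose s \<le> card V ^ s"
      by (cases "s \<le> card V") (auto simp: binomial_le_pow binomial_eq_0)
    then show "C \<le> card V ^ s" unfolding C_def by (metis of_nat_le_iff of_nat_power)
  qed (use pow in simp)
  finally show ?thesis using mult_left_le[of "a ^ s" "real (card E)"] pow by simp
qed

definition rescaled :: "real \<Rightarrow> 'a hgraph \<Rightarrow> ('a \<Rightarrow> real) \<Rightarrow> 'a \<Rightarrow> real" where
  "rescaled p H x v = real (card (hverts H)) powr (1 / p) * x v"

definition large_weights :: "real \<Rightarrow> real \<Rightarrow> 'a hgraph \<Rightarrow> ('a \<Rightarrow> real) \<Rightarrow> bool" where
  "large_weights p \<delta> H x \<longleftrightarrow> (\<forall>v\<in>hverts H. (1 - \<delta>) / card (hverts H) \<le> x v powr p)"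

lemma sum_rescaled_le:
  assumes H: "r_graph r H" "hverts H \<noteq> {}" and p: "1 < p" and x: "principal_eigenvector r p H x"
  shows "sum (rescaled p H x) (hverts H) \<le> card (hverts H)"
proof -
  define n where "n = real (card (hverts H))"
  have n: "0 < n" using r_graph_finite_verts[OF H(1)] H(2) by (simp add: n_def card_gt_0_iff)
  have "sum x (hverts H) \<le> n powr (1 - 1 / p)"
    using sum_le_part_sum[OF r_graph_finite_verts[OF H(1)] p, of x] principal_eigenvectorD(1,2)[OF x]
    by (simp add: part_sum_def n_def)
  then have "n powr (1 / p) * sum x (hverts H) \<le> n powr (1 / p) * n powr (1 - 1 / p)"
    by (intro mult_left_mono) auto
  also have "\<dots> = n" using n by (simp flip: powr_add)
  finally show ?thesis by (simp add: rescaled_def n_def sum_distrib_left)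
qed

lemma rescaled_powr_ge:
  assumes large: "large_weights p \<delta> H x" and v: "v \<in> hverts H" "finite (hverts H)" and x: "0 \<le> x v"
    and \<delta>: "0 < \<delta>" "\<delta> < 1" and s: "0 \<le> s" "s \<le> p" "0 < p"
  shows "1 - \<delta> \<le> rescaled p H x v powr s"
proof -
  define n where "n = real (card (hverts H))"
  have n: "0 < n" using v by (auto simp: n_def card_gt_0_iff)
  have "(1 - \<delta>) / n \<le> x v powr p" using large v(1) by (simp add: large_weights_def n_def)
  then have "1 - \<delta> \<le> n * x v powr p" using n by (simp add: pos_divide_le_eq mult.commute)
  also have "\<dots> = rescaled p H x v powr p"
    using s n by (simp add: rescaled_def n_def powr_mult powr_powr)
  finally have "(1 - \<delta>) powr (s / p) \<le> (rescaled p H x v powr p) powr (s / p)"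
    using \<delta> s by (intro powr_mono2) auto
  moreover have "1 - \<delta> \<le> (1 - \<delta>) powr (s / p)"
    using \<delta> s powr_mono'[of "s / p" 1 "1 - \<delta>"] by simp
  ultimately show ?thesis using s by (simp add: powr_powr)
qed

lemma rescaled_eigenvector_equation:
  assumes H: "r_graph r H" and p: "1 \<le> p" and r: "0 < r" and x: "principal_eigenvector r p H x"
    and v: "v \<in> hverts H" "0 < x v"
  shows "edge_sum (hedges (link H v)) (rescaled p H x)
    = r / fact r * (p_spectral_radius r p H * real (card (hverts H)) powr (r / p - 1))
      * rescaled p H x v powr (p - 1)"
proof -
  define n where "n = real (card (hverts H))"
  define l where "l = p_spectral_radius r p H"
  have n: "0 < n" using r_graph_finite_verts[OF H] v by (auto simp: n_def card_gt_0_iff)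
  have rescaled: "rescaled p H x = (\<lambda>u. n powr (1 / p) * x u)"
    by (simp add: fun_eq_iff rescaled_def n_def)
  have "edge_sum (hedges (link H v)) (rescaled p H x)
    = (n powr (1 / p)) ^ (r - 1) * edge_sum (hedges (link H v)) x"
    unfolding rescaled by (rule edge_sum_scale[OF r_graph_link[OF H]])
  also have "edge_sum (hedges (link H v)) x = r / fact r * l * x v powr (p - 1)"
    using eigenvector_equation[OF H p r x v] by (simp add: l_def field_simps)
  also have "(n powr (1 / p)) ^ (r - 1) = n powr (r / p - 1) * (n powr (1 / p)) powr (p - 1)"
  proof -
    have "(n powr (1 / p)) ^ (r - 1) = n powr (real (r - 1) / p)"
      using n by (simp add: powr_powr flip: powr_realpow)
    also have "real (r - 1) / p = (r / p - 1) + 1 / p * (p - 1)"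
      using p r by (simp add: of_nat_diff field_simps)
    also have "n powr \<dots> = n powr (r / p - 1) * (n powr (1 / p)) powr (p - 1)"
      by (simp only: powr_add powr_powr)
    finally show ?thesis .
  qed
  finally show ?thesis
    by (simp add: rescaled_def[of p H x v] n_def[symmetric] l_def powr_mult mult_ac)
qed

lemma edge_sum_link_rescaled_ge:
  assumes H: "r_graph r H" and p: "1 < p" and rk: "1 \<le> r" "r \<le> k" and x: "principal_eigenvector r p H x"
    and \<delta>: "0 < \<delta>" "\<delta> < 1" and large: "large_weights p \<delta> H x" and v: "v \<in> hverts H"
    and radius: "(1 - \<delta>) * turan_const r k * real (card (hverts H)) powr (r - r / p)
      \<le> p_spectral_radius r p H"
  shows "(1 - \<delta>)\<^sup>2 * turan_deg r k * real (card (hverts H)) ^ (r - 1)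
    \<le> edge_sum (hedges (link H v)) (rescaled p H x)"
proof -
  define n where "n = real (card (hverts H))"
  note fin = r_graph_finite_verts[OF H]
  have n: "0 < n" using fin v by (auto simp: n_def card_gt_0_iff)
  have weight: "1 - \<delta> \<le> rescaled p H x v powr (p - 1)"
    using p by (intro rescaled_powr_ge[OF large v fin principal_eigenvectorD(1)[OF x] \<delta>]) auto
  have "x v \<noteq> 0" using weight \<delta> by (auto simp: rescaled_def)
  then have pos: "0 < x v" using principal_eigenvectorD(1)[OF x, of v] by simp
  have "(1 - \<delta>) * turan_const r k * n powr (r - r / p) * n powr (r / p - 1)
      \<le> p_spectral_radius r p H * n powr (r / p - 1)"
    using radius by (intro mult_right_mono) (auto simp: n_def)
  moreover have "n powr (r - r / p) * n powr (r / p - 1) = n ^ (r - 1)"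
    using n rk by (simp add: of_nat_diff powr_add[symmetric] flip: powr_realpow)
  ultimately have "(1 - \<delta>) * turan_const r k * n ^ (r - 1)
    \<le> p_spectral_radius r p H * n powr (r / p - 1)"
    by (simp add: mult.assoc)
  moreover have "0 \<le> (1 - \<delta>) * turan_const r k * n ^ (r - 1)"
    using \<delta> n by (simp add: turan_const_def)
  ultimately have "((1 - \<delta>) * turan_const r k * n ^ (r - 1)) * (1 - \<delta>)
      \<le> (p_spectral_radius r p H * n powr (r / p - 1)) * rescaled p H x v powr (p - 1)"
    using weight \<delta> by - (rule mult_mono; linarith)
  then have "r / fact r * (((1 - \<delta>) * turan_const r k * n ^ (r - 1)) * (1 - \<delta>))
      \<le> r / fact r * ((p_spectral_radius r p H * n powr (r / p - 1)) * rescaled p H x v powr (p - 1))"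
    by (intro mult_left_mono) auto
  also have "\<dots> = edge_sum (hedges (link H v)) (rescaled p H x)"
    using rescaled_eigenvector_equation[OF H _ _ x v pos] p rk by (simp add: n_def mult.assoc)
  finally show ?thesis
    unfolding turan_const_eq_turan_deg[OF rk, symmetric] n_def
    by (simp add: power2_eq_square mult_ac)
qed

lemma degree_dense_if_large_weights:
  assumes H: "r_graph r H" and p: "1 < p" and rk: "1 \<le> r" "r \<le> k" and x: "principal_eigenvector r p H x"
    and \<delta>: "0 < \<delta>" "\<delta> < 1" "\<delta> * (2 * turan_deg r k + r) \<le> \<epsilon>" and large: "large_weights p \<delta> H x"
    and radius: "(1 - \<delta>) * turan_const r k * real (card (hverts H)) powr (r - r / p)
      \<le> p_spectral_radius r p H"
  shows "degree_dense r k \<epsilon> (real (card (hverts H))) H"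
  unfolding degree_dense_def
proof
  fix v assume v: "v \<in> hverts H"
  define n where "n = real (card (hverts H))"
  define t where "t = turan_deg r k"
  note fin = r_graph_finite_verts[OF H]
  have "S \<subseteq> hverts H" "card S = r - 1" if "S \<in> hedges (link H v)" for S
    using r_graph_edge(1,2)[OF r_graph_link[OF H] that] neighbours_subset[OF H, of v]
    by (simp_all add: link_def)
  then have "hedges (link H v) \<subseteq> {S. S \<subseteq> hverts H \<and> card S = r - 1}" by blast
  moreover have "1 - \<delta> \<le> rescaled p H x u" if "u \<in> hverts H" for u
    using rescaled_powr_ge[OF large that fin principal_eigenvectorD(1)[OF x] \<delta>(1,2), of 1] p
      principal_eigenvectorD(1)[OF x] by (simp add: rescaled_def)
  ultimately have "edge_sum (hedges (link H v)) (rescaled p H x)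
      \<le> hdegree H v + (1 - (1 - \<delta>) ^ (r - 1)) * n ^ (r - 1)"
    using edge_sum_le_card_plus[OF fin, of "hedges (link H v)" "r - 1" "1 - \<delta>" "rescaled p H x"]
      sum_rescaled_le[OF H _ p x] v \<delta>
    by (auto simp: card_link_edges n_def)
  then have degree: "(1 - \<delta>)\<^sup>2 * t * n ^ (r - 1) \<le> hdegree H v + (1 - (1 - \<delta>) ^ (r - 1)) * n ^ (r - 1)"
    using edge_sum_link_rescaled_ge[OF H p rk x \<delta>(1,2) large v radius] by (simp add: n_def t_def)
  have "1 + real (r - 1) * (- \<delta>) \<le> (1 + (- \<delta>)) ^ (r - 1)"
    using \<delta> by (intro Bernoulli_inequality) auto
  moreover have "real (r - 1) * \<delta> \<le> r * \<delta>" using \<delta> by (intro mult_right_mono) auto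
  ultimately have "1 - (1 - \<delta>) ^ (r - 1) \<le> r * \<delta>" by simp
  moreover have "0 < t" using turan_deg_pos[OF rk] by (simp add: t_def)
  then have "(1 - 2 * \<delta>) * t \<le> (1 - \<delta>)\<^sup>2 * t"
    by (intro mult_right_mono) (auto simp: power2_eq_square algebra_simps)
  ultimately have "t - \<epsilon> \<le> (1 - \<delta>)\<^sup>2 * t - (1 - (1 - \<delta>) ^ (r - 1))"
    using \<delta>(3) by (simp add: t_def algebra_simps)
  then have "(t - \<epsilon>) * n ^ (r - 1) \<le> ((1 - \<delta>)\<^sup>2 * t - (1 - (1 - \<delta>) ^ (r - 1))) * n ^ (r - 1)"
    by (intro mult_right_mono) (auto simp: n_def)
  then show "(turan_deg r k - \<epsilon>) * real (card (hverts H)) ^ (r - 1) \<le> hdegree H v"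
    using degree by (simp add: left_diff_distrib n_def t_def)
qed

section \<open>Deleting a vertex of small weight\<close>

lemma exp_minus_le:
  fixes z :: real
  assumes "0 \<le> z"
  shows "exp (- z) \<le> 1 - z + z\<^sup>2"
proof -
  have "exp (- z) = 1 / exp z" by (simp add: exp_minus inverse_eq_divide)
  also have "\<dots> \<le> 1 / (1 + z)" using assms exp_ge_add_one_self[of z] by (intro divide_left_mono) auto
  also have "\<dots> \<le> 1 - z + z\<^sup>2"
  proof -
    have "(1 - z + z\<^sup>2) * (1 + z) = 1 + z ^ 3"
      by (simp add: algebra_simps power2_eq_square power3_eq_cube)
    then show ?thesis using assms by (simp add: pos_divide_le_eq)
  qed
  finally show ?thesis .
qed

lemma one_minus_powr_le_exp:
  fixes y s :: real
  assumes "y \<le> 1" "0 \<le> s"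
  shows "(1 - y) powr s \<le> exp (- (s * y))"
proof -
  have "(1 - y) powr s \<le> exp (- y) powr s"
    using assms exp_ge_add_one_self[of "- y"] by (intro powr_mono2) auto
  then show ?thesis by (simp add: exp_powr_real mult.commute)
qed

lemma deletion_factor_le:
  fixes \<delta> r s y n :: real
  assumes s: "0 \<le> s" "s < r" and \<delta>: "0 < \<delta>" "\<delta> < 1"
    and n: "1 < n" "2 * r\<^sup>2 \<le> (r - s) * \<delta> * n" and y: "0 \<le> y" "y \<le> (1 - \<delta>) / n"
  shows "(1 - 1 / n) powr ((r - s) * (1 - \<delta> / 2)) * (1 - y) powr s \<le> 1 - r * y"
proof -
  define \<gamma> where "\<gamma> = (r - s) * (1 - \<delta> / 2)"
  have \<gamma>: "0 \<le> \<gamma>" "\<gamma> \<le> r - s" using s \<delta> by (auto simp: \<gamma>_def mult_left_le)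
  have y_le: "y \<le> 1 / n" using y(2) \<delta> n divide_right_mono[of "1 - \<delta>" 1 n] by linarith
  moreover have "1 / n < 1" using n by simp
  ultimately have "y \<le> 1" by linarith
  define z where "z = \<gamma> / n + s * y"
  define gain where "gain = (r - s) * \<delta> / 2 / n"
  have "0 \<le> z" using \<gamma> s y n by (simp add: z_def)
  have "z \<le> (r - s) / n + s * (1 / n)"
    unfolding z_def using \<gamma> n s y_le by (intro add_mono divide_right_mono mult_left_mono) auto
  also have "\<dots> = r / n" by (simp add: diff_divide_distrib)
  finally have "z\<^sup>2 \<le> (r / n)\<^sup>2" using \<open>0 \<le> z\<close> by (intro power_mono)
  also have "\<dots> \<le> gain"
    using n by (simp add: gain_def power2_eq_square divide_le_eq mult_ac)
  finally have z_sq: "z\<^sup>2 \<le> gain" .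
  have "(1 - 1 / n) powr \<gamma> * (1 - y) powr s \<le> exp (- (\<gamma> * (1 / n))) * exp (- (s * y))"
    using \<gamma> s n \<open>y \<le> 1\<close> by (intro mult_mono one_minus_powr_le_exp) auto
  also have "\<dots> = exp (- z)" by (simp add: z_def exp_add[symmetric])
  also have "\<dots> \<le> 1 - z + z\<^sup>2" using \<open>0 \<le> z\<close> by (rule exp_minus_le)
  also have "\<dots> \<le> 1 - r * y"
  proof -
    have "(r - s) * \<delta> / 2 = \<gamma> - (r - s) * (1 - \<delta>)" by (simp add: \<gamma>_def algebra_simps)
    then have "gain = \<gamma> / n - (r - s) * ((1 - \<delta>) / n)"
      unfolding gain_def by (metis diff_divide_distrib times_divide_eq_right)
    also have "\<dots> \<le> \<gamma> / n - (r - s) * y" using y s by (intro diff_left_mono mult_left_mono) auto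
    also have "\<dots> = z - r * y" by (simp add: z_def algebra_simps)
    finally show ?thesis using z_sq by simp
  qed
  finally show ?thesis by (simp add: \<gamma>_def)
qed

definition scaled_radius :: "nat \<Rightarrow> real \<Rightarrow> real \<Rightarrow> 'a hgraph \<Rightarrow> real" where
  "scaled_radius r p \<gamma> H = p_spectral_radius r p H / real (card (hverts H)) powr \<gamma>"

lemma scaled_radius_le_delete_vertex:
  fixes r :: nat and p \<delta> :: real
  defines "\<gamma> \<equiv> (r - r / p) * (1 - \<delta> / 2)"
  assumes H: "r_graph r H" and p: "1 < p" and r: "0 < r" and verts: "2 \<le> card (hverts H)"
    and x: "principal_eigenvector r p H x" and v: "v \<in> hverts H" and \<delta>: "0 < \<delta>" "\<delta> < 1"
    and n: "2 * (real r)\<^sup>2 \<le> (r - r / p) * \<delta> * card (hverts H)"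
    and small: "x v powr p < (1 - \<delta>) / card (hverts H)"
  shows "scaled_radius r p \<gamma> H \<le> scaled_radius r p \<gamma> (delete_vertex v H)"
proof -
  define n where "n = real (card (hverts H))"
  define l where "l = p_spectral_radius r p H"
  define l' where "l' = p_spectral_radius r p (delete_vertex v H)"
  define y where "y = x v powr p"
  have n_gt_1: "1 < n" using verts by (simp add: n_def)
  have "(1 - \<delta>) / n \<le> 1 / n" using \<delta> n_gt_1 by (intro divide_right_mono) auto
  then have "y < 1 / n" using small by (simp add: y_def n_def)
  moreover have "1 / n < 1" using n_gt_1 by simp
  ultimately have pos: "0 < (1 - y) powr (r / p)" by simp
  have "0 \<le> l" unfolding l_def using p r v by (intro p_spectral_radius_nonneg[OF H]) auto
  moreover have "r / p < r" using p r by (simp add: divide_less_eq)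
  ultimately have "l * ((1 - 1 / n) powr \<gamma> * (1 - y) powr (r / p)) \<le> l * (1 - r * y)"
    unfolding \<gamma>_def using \<delta> p n n_gt_1 small
    by (intro mult_left_mono deletion_factor_le) (auto simp: y_def n_def)
  also have "\<dots> \<le> l' * (1 - y) powr (r / p)"
    unfolding y_def l_def l'_def by (rule radius_delete_vertex_ge[OF H p r verts x v])
  finally have "l * (1 - 1 / n) powr \<gamma> \<le> l'" using pos by (simp flip: mult.assoc)
  moreover have "1 - 1 / n = (n - 1) / n" using n_gt_1 by (simp add: diff_divide_distrib)
  ultimately have "l * ((n - 1) powr \<gamma> / n powr \<gamma>) \<le> l'" by (simp add: powr_divide)
  then have "l / n powr \<gamma> \<le> l' / (n - 1) powr \<gamma>" using n_gt_1 by (simp add: pos_le_divide_eq mult_ac)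
  moreover have "real (card (hverts (delete_vertex v H))) = n - 1"
    using card_hverts_delete_vertex[OF v r_graph_finite_verts[OF H]] verts by (simp add: n_def)
  ultimately show ?thesis by (simp add: scaled_radius_def l_def l'_def n_def)
qed

section \<open>The extremal hypergraphs\<close>

definition positively_k_partite :: "nat \<Rightarrow> real \<Rightarrow> nat \<Rightarrow> 'a hgraph \<Rightarrow> bool" where
  "positively_k_partite r p k H \<longleftrightarrow>
    k_partite k H \<and> (\<exists>x. principal_eigenvector r p H x \<and> (\<forall>v\<in>hverts H. 0 < x v))"

lemma positively_k_partite_if_large_weights:
  assumes "k_partite k H" and x: "principal_eigenvector r p H x" and large: "large_weights p \<delta> H x"
    and fin: "finite (hverts H)" and \<delta>: "\<delta> < 1"
  shows "positively_k_partite r p k H"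
proof -
  have "0 < x v" if v: "v \<in> hverts H" for v
  proof -
    have "0 < card (hverts H)" using fin v by (metis card_gt_0_iff empty_iff)
    then have "0 < (1 - \<delta>) / card (hverts H)" using \<delta> by simp
    also have "\<dots> \<le> x v powr p" using large v by (simp add: large_weights_def)
    finally have "x v \<noteq> 0" by auto
    then show ?thesis using principal_eigenvectorD(1)[OF x, of v] by linarith
  qed
  then show ?thesis using assms(1) x unfolding positively_k_partite_def by blast
qed

definition radius_dense :: "nat \<Rightarrow> real \<Rightarrow> nat \<Rightarrow> real \<Rightarrow> 'a hgraph \<Rightarrow> bool" where
  "radius_dense r p k \<delta> H \<longleftrightarrow>
    (1 - \<delta>) * turan_const r k * real (card (hverts H)) powr (r - r / p) \<le> p_spectral_radius r p H"

lemma delete_vertex_free_r_graphs: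
  assumes "H \<in> free_r_graphs r F n" "v \<in> hverts H"
  shows "delete_vertex v H \<in> free_r_graphs r F (n - 1)"
  using assms r_graph_finite_verts[of r H]
  by (simp add: free_r_graphs_def r_graph_delete_vertex hgraph_free_delete_vertex
      card_hverts_delete_vertex)

definition deletable :: "nat \<Rightarrow> real \<Rightarrow> real \<Rightarrow> 'a hgraph \<Rightarrow> bool" where
  "deletable r p \<gamma> H \<longleftrightarrow>
    (\<exists>v\<in>hverts H. scaled_radius r p \<gamma> H \<le> scaled_radius r p \<gamma> (delete_vertex v H))"

lemma positively_k_partite_or_deletable:
  fixes p \<delta> :: real
  assumes H: "r_graph r H" and verts: "2 \<le> card (hverts H)" and p: "1 < p" and rk: "1 \<le> r" "r \<le> k"
    and \<delta>: "0 < \<delta>" "\<delta> < 1" "\<delta> * (2 * turan_deg r k + r) \<le> \<epsilon>"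
    and stable: "degree_dense r k \<epsilon> (card (hverts H)) H \<Longrightarrow> k_partite k H"
    and n: "2 * (real r)\<^sup>2 \<le> (r - r / p) * \<delta> * card (hverts H)" and dense: "radius_dense r p k \<delta> H"
  shows "positively_k_partite r p k H \<or> deletable r p ((r - r / p) * (1 - \<delta> / 2)) H"
proof -
  have "hverts H \<noteq> {}" using verts by auto
  then obtain x where x: "principal_eigenvector r p H x"
    using exists_principal_eigenvector[OF H _ less_imp_le[OF p]] by blast
  show ?thesis
  proof (cases "large_weights p \<delta> H x")
    case True
    have "degree_dense r k \<epsilon> (card (hverts H)) H"
      using dense
      by (intro degree_dense_if_large_weights[OF H p rk x \<delta> True]) (simp add: radius_dense_def)
    then show ?thesis
      using positively_k_partite_if_large_weights[OF stable x True r_graph_finite_verts[OF H] \<delta>(2)]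
      by blast
  next
    case False
    then obtain v where "v \<in> hverts H" "x v powr p < (1 - \<delta>) / card (hverts H)"
      by (auto simp: large_weights_def not_le)
    then show ?thesis
      using scaled_radius_le_delete_vertex[OF H p _ verts x _ \<delta>(1,2) n] rk
      by (auto simp: deletable_def)
  qed
qed

lemma exists_deletion_exponent:
  assumes rk: "2 \<le> r" "r \<le> k" and p: "1 < p"
  obtains \<delta> \<gamma> :: real where "0 < \<delta>" "\<gamma> < r - r / p"
    "\<forall>\<^sub>F n in sequentially. \<forall>H\<in>(free_r_graphs r (expanded_clique r (k + 1)) n :: 'a hgraph set).
      radius_dense r p k \<delta> H \<longrightarrow> positively_k_partite r p k H \<or> deletable r p \<gamma> H"
proof -
  obtain \<epsilon> where \<epsilon>: "0 < \<epsilon>" and stable: "\<forall>\<^sub>F n in sequentially.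
      \<forall>H\<in>(free_r_graphs r (expanded_clique r (k + 1)) n :: 'a hgraph set).
        degree_dense r k \<epsilon> n H \<longrightarrow> k_partite k H"
    using degree_stability[OF rk] by blast
  define t where "t = 2 * turan_deg r k + r"
  have t: "0 < t" using turan_deg_pos[of r k] rk by (simp add: t_def add_pos_pos)
  define \<delta> where "\<delta> = min (1 / 2) (\<epsilon> / t)"
  have \<delta>: "0 < \<delta>" "\<delta> < 1" using \<epsilon> t by (auto simp: \<delta>_def)
  have "\<delta> \<le> \<epsilon> / t" by (simp add: \<delta>_def)
  then have \<delta>_le: "\<delta> * t \<le> \<epsilon>" using t by (simp add: pos_le_divide_eq)
  define \<gamma> where "\<gamma> = (r - r / p) * (1 - \<delta> / 2)"
  have \<beta>: "0 < r - r / p" using p rk by (simp add: divide_less_eq)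
  then have "0 < (r - r / p) * \<delta>" using \<delta>(1) by (rule mult_pos_pos)
  then have "\<forall>\<^sub>F n in sequentially. 2 * (real r)\<^sup>2 \<le> (r - r / p) * \<delta> * real n"
    by (rule eventually_le_times_real)
  then have "\<forall>\<^sub>F n in sequentially. \<forall>H\<in>(free_r_graphs r (expanded_clique r (k + 1)) n :: 'a hgraph set).
      radius_dense r p k \<delta> H \<longrightarrow> positively_k_partite r p k H \<or> deletable r p \<gamma> H"
    using stable eventually_ge_at_top[of 2]
  proof eventually_elim
    case (elim n)
    show ?case
    proof (intro ballI impI)
      fix H :: "'a hgraph"
      assume H: "H \<in> free_r_graphs r (expanded_clique r (k + 1)) n" "radius_dense r p k \<delta> H"
      then show "positively_k_partite r p k H \<or> deletable r p \<gamma> H"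
        unfolding \<gamma>_def using elim p rk \<delta> \<delta>_le free_r_graphsD[OF H(1)]
        by (intro positively_k_partite_or_deletable[where \<epsilon> = \<epsilon>]) (auto simp: t_def)
    qed
  qed
  moreover have "(r - r / p) * (1 - \<delta> / 2) < (r - r / p) * 1"
    using \<beta> \<delta>(1) by (intro mult_strict_left_mono) auto
  ultimately show ?thesis using that[of \<delta> \<gamma>] \<delta>(1) by (simp add: \<gamma>_def)
qed

lemma scaled_radius_le_if_not_radius_dense:
  assumes "\<not> radius_dense r p k \<delta> H" "0 < \<delta>"
  shows "scaled_radius r p \<gamma> H \<le> turan_const r k * real (card (hverts H)) powr (r - r / p - \<gamma>)"
proof -
  have "0 \<le> turan_const r k * real (card (hverts H)) powr (r - r / p)"
    by (simp add: turan_const_def)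
  then have "(1 - \<delta>) * (turan_const r k * real (card (hverts H)) powr (r - r / p))
      \<le> 1 * (turan_const r k * real (card (hverts H)) powr (r - r / p))"
    using assms(2) by (intro mult_right_mono) auto
  then have "p_spectral_radius r p H \<le> turan_const r k * real (card (hverts H)) powr (r - r / p)"
    using assms(1) by (simp add: radius_dense_def mult.assoc)
  then show ?thesis
    unfolding scaled_radius_def powr_diff[of _ "r - r / p"] times_divide_eq_right
    by (rule divide_right_mono) simp
qed

lemma scaled_radius_le_if_k_partite:
  assumes "r_graph r H" "hverts H \<noteq> {}" "1 < p" "k_partite k H"
  shows "scaled_radius r p \<gamma> H \<le> turan_const r k * real (card (hverts H)) powr (r - r / p - \<gamma>)"
  unfolding scaled_radius_def powr_diff[of _ "r - r / p"] times_divide_eq_right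
  using k_partite_radius_le[OF assms] by (rule divide_right_mono) simp

lemma scaled_radius_le_or_deletable:
  assumes H: "r_graph r H" "hverts H \<noteq> {}" and p: "1 < p" and \<delta>: "0 < \<delta>"
    and "radius_dense r p k \<delta> H \<Longrightarrow> positively_k_partite r p k H \<or> deletable r p \<gamma> H"
  shows "scaled_radius r p \<gamma> H \<le> turan_const r k * real (card (hverts H)) powr (r - r / p - \<gamma>)
    \<or> deletable r p \<gamma> H"
  using scaled_radius_le_if_not_radius_dense[OF _ \<delta>] scaled_radius_le_if_k_partite[OF H p] assms(5)
  unfolding positively_k_partite_def by metis

lemma scaled_radius_le_by_deletion:
  fixes H :: "'a hgraph"
  assumes p: "1 < p" and \<delta>: "0 < \<delta>" and \<gamma>: "\<gamma> \<le> r - r / p" and m: "1 \<le> m" "m \<le> n"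
    and deletion: "\<forall>n\<ge>m. \<forall>H\<in>(free_r_graphs r F n :: 'a hgraph set).
      radius_dense r p k \<delta> H \<longrightarrow> positively_k_partite r p k H \<or> deletable r p \<gamma> H"
    and H: "H \<in> free_r_graphs r F n"
  shows "scaled_radius r p \<gamma> H
    \<le> max (fact r * 2 ^ m / real m powr \<gamma>) (turan_const r k * real n powr (r - r / p - \<gamma>))"
  using m(2) H
proof (induction n arbitrary: H rule: dec_induct)
  case base
  note H = free_r_graphsD[OF base]
  have "hverts H \<noteq> {}" using H(2) m by auto
  then have "p_spectral_radius r p H \<le> fact r * 2 ^ m"
    using p_spectral_radius_le_card[OF H(1), of p] p H(2) by simp
  then have "scaled_radius r p \<gamma> H \<le> fact r * 2 ^ m / real m powr \<gamma>"
    unfolding scaled_radius_def H(2) by (rule divide_right_mono) simp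
  then show ?case by simp
next
  case (step n)
  note H = free_r_graphsD[OF step.prems]
  have verts: "hverts H \<noteq> {}" using H(2) by auto
  have "radius_dense r p k \<delta> H \<Longrightarrow> positively_k_partite r p k H \<or> deletable r p \<gamma> H"
    using deletion step.prems step.hyps(1) le_SucI by blast
  then consider "scaled_radius r p \<gamma> H \<le> turan_const r k * real (Suc n) powr (r - r / p - \<gamma>)"
    | v where "v \<in> hverts H" "scaled_radius r p \<gamma> H \<le> scaled_radius r p \<gamma> (delete_vertex v H)"
    using scaled_radius_le_or_deletable[OF H(1) verts p \<delta>] unfolding H(2) deletable_def by blast
  then show ?case
  proof cases
    case (2 v)
    have "delete_vertex v H \<in> free_r_graphs r F n"
      using delete_vertex_free_r_graphs[OF step.prems 2(1)] by simp
    moreover have "turan_const r k * real n powr (r - r / p - \<gamma>)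
      \<le> turan_const r k * real (Suc n) powr (r - r / p - \<gamma>)"
      using \<gamma> by (intro mult_left_mono powr_mono2) (auto simp: turan_const_def)
    ultimately show ?thesis
      using 2(2) step.IH[of "delete_vertex v H"] unfolding le_max_iff_disj by linarith
  qed simp
qed

text \<open>The bound for partite hypergraphs tends to infinity, so that it eventually exceeds the constant
  in \<open>scaled_radius_le_by_deletion\<close>.\<close>

lemma eventually_scaled_radius_le:
  fixes \<delta> \<gamma> p :: real
  assumes p: "1 < p" and \<delta>: "0 < \<delta>" and rk: "0 < r" "r \<le> k" and \<gamma>: "\<gamma> < r - r / p"
    and deletion: "\<forall>\<^sub>F n in sequentially. \<forall>H\<in>(free_r_graphs r F n :: 'a hgraph set).
      radius_dense r p k \<delta> H \<longrightarrow> positively_k_partite r p k H \<or> deletable r p \<gamma> H"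
  shows "\<forall>\<^sub>F n in sequentially. \<forall>H\<in>(free_r_graphs r F n :: 'a hgraph set).
    scaled_radius r p \<gamma> H \<le> turan_const r k * real n powr (r - r / p - \<gamma>)"
proof -
  obtain m where m: "1 \<le> m" and deletion_from: "\<forall>n\<ge>m. \<forall>H\<in>(free_r_graphs r F n :: 'a hgraph set).
      radius_dense r p k \<delta> H \<longrightarrow> positively_k_partite r p k H \<or> deletable r p \<gamma> H"
    using eventually_conj[OF deletion eventually_ge_at_top[of 1]] unfolding eventually_sequentially
    by blast
  have "\<forall>\<^sub>F n in sequentially. fact r * 2 ^ m / real m powr \<gamma>
    \<le> turan_const r k * real n powr (r - r / p - \<gamma>)"
    using turan_const_pos[of r k] rk \<gamma> by real_asymp
  then show ?thesis
    using eventually_ge_at_top[of m]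
  proof eventually_elim
    case (elim n)
    show ?case
      using scaled_radius_le_by_deletion[OF p \<delta> less_imp_le[OF \<gamma>] m elim(2) deletion_from] elim(1)
      by (simp add: max_absorb2)
  qed
qed

lemma scaled_turan_radius_ge:
  assumes p: "1 \<le> p" and r: "0 < r" and k: "0 < k" "k \<le> n"
  shows "turan_const r k * real n powr (r - r / p - \<gamma>) * (1 - 3 ^ r * (real k / real n)\<^sup>2)
    \<le> scaled_radius r p \<gamma> (turan r n k)"
proof -
  have "turan_const r k * real n powr (r - r / p) * (1 - 3 ^ r * (real k / real n)\<^sup>2) / real n powr \<gamma>
      \<le> scaled_radius r p \<gamma> (turan r n k)"
    using turan_radius_ge[OF assms] by (simp add: scaled_radius_def divide_right_mono)
  then show ?thesis by (simp add: powr_diff[of _ "r - r / p"])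
qed

lemma scaled_radius_less_cancel:
  assumes "card (hverts G) = card (hverts H)" "0 < card (hverts H)"
  shows "scaled_radius r p \<gamma> G < scaled_radius r p \<gamma> H \<longleftrightarrow>
    p_spectral_radius r p G < p_spectral_radius r p H"
  using assms by (simp add: scaled_radius_def divide_less_cancel)

lemma radius_less_turan_radius_if_not_radius_dense:
  assumes "\<not> radius_dense r p k \<delta> H" "card (hverts H) = n" and p: "1 \<le> p" and r: "0 < r"
    and k: "0 < k" "k \<le> n" and error: "3 ^ r * (real k / real n)\<^sup>2 < \<delta>"
  shows "p_spectral_radius r p H < p_spectral_radius r p (turan r n k)"
proof -
  have "p_spectral_radius r p H < (1 - \<delta>) * (turan_const r k * real n powr (r - r / p))"
    using assms(1,2) by (simp add: radius_dense_def)
  also have "\<dots> \<le> (1 - 3 ^ r * (real k / real n)\<^sup>2) * (turan_const r k * real n powr (r - r / p))"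
    using error by (intro mult_right_mono) (auto simp: turan_const_def)
  also have "\<dots> \<le> p_spectral_radius r p (turan r n k)"
    using turan_radius_ge[OF p r k] by (simp add: mult_ac)
  finally show ?thesis .
qed

lemma radius_less_turan_radius_if_deletable:
  fixes H :: "'a hgraph"
  assumes deletable: "deletable r p \<gamma> H" and H: "H \<in> free_r_graphs r F n"
    and p: "1 \<le> p" and r: "0 < r" "r \<le> k" and n: "k \<le> n"
    and bound: "\<forall>G\<in>(free_r_graphs r F (n - 1) :: 'a hgraph set).
      scaled_radius r p \<gamma> G \<le> turan_const r k * real (n - 1) powr (r - r / p - \<gamma>)"
    and error: "real (n - 1) powr (r - r / p - \<gamma>)
      < real n powr (r - r / p - \<gamma>) * (1 - 3 ^ r * (real k / real n)\<^sup>2)"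
  shows "p_spectral_radius r p H < p_spectral_radius r p (turan r n k)"
proof -
  have k: "0 < k" using r by simp
  obtain v where v: "v \<in> hverts H" "scaled_radius r p \<gamma> H \<le> scaled_radius r p \<gamma> (delete_vertex v H)"
    using deletable by (auto simp: deletable_def)
  note v(2)
  also have "scaled_radius r p \<gamma> (delete_vertex v H)
    \<le> turan_const r k * real (n - 1) powr (r - r / p - \<gamma>)"
    using bound delete_vertex_free_r_graphs[OF H v(1)] by blast
  also have "\<dots> < turan_const r k * (real n powr (r - r / p - \<gamma>) * (1 - 3 ^ r * (real k / real n)\<^sup>2))"
    using error turan_const_pos[OF r(2) k] by simp
  also have "\<dots> \<le> scaled_radius r p \<gamma> (turan r n k)"
    using scaled_turan_radius_ge[OF p r(1) k n] by (simp add: mult.assoc)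
  finally show ?thesis
    using scaled_radius_less_cancel[of H "turan r n k"] free_r_graphsD(2)[OF H] k n by simp
qed

theorem positively_k_partite_or_radius_less:
  assumes rk: "2 \<le> r" "r \<le> k" and p: "1 < p"
  shows "\<forall>\<^sub>F n in sequentially. \<forall>H\<in>(free_r_graphs r (expanded_clique r (k + 1)) n :: 'a hgraph set).
    positively_k_partite r p k H \<or> p_spectral_radius r p H < p_spectral_radius r p (turan r n k)"
proof -
  obtain \<delta> \<gamma> :: real where \<delta>: "0 < \<delta>" and \<gamma>: "\<gamma> < r - r / p" and deletion:
    "\<forall>\<^sub>F n in sequentially. \<forall>H\<in>(free_r_graphs r (expanded_clique r (k + 1)) n :: 'a hgraph set).
      radius_dense r p k \<delta> H \<longrightarrow> positively_k_partite r p k H \<or> deletable r p \<gamma> H"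
    using exists_deletion_exponent[OF rk p] by blast
  have k: "0 < real k" using rk by simp
  have "\<forall>\<^sub>F n in sequentially. \<forall>H\<in>(free_r_graphs r (expanded_clique r (k + 1)) n :: 'a hgraph set).
      scaled_radius r p \<gamma> H \<le> turan_const r k * real n powr (r - r / p - \<gamma>)"
    using rk by (intro eventually_scaled_radius_le[OF p \<delta> _ _ \<gamma> deletion]) auto
  then have "\<forall>\<^sub>F n in sequentially.
    \<forall>H\<in>(free_r_graphs r (expanded_clique r (k + 1)) (n - 1) :: 'a hgraph set).
      scaled_radius r p \<gamma> H \<le> turan_const r k * real (n - 1) powr (r - r / p - \<gamma>)"
    by (rule eventually_compose_filterlim[OF _ filterlim_minus_const_nat_at_top])
  moreover have "\<forall>\<^sub>F n in sequentially. real (n - 1) powr (r - r / p - \<gamma>)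
      < real n powr (r - r / p - \<gamma>) * (1 - 3 ^ r * (real k / real n)\<^sup>2)"
    using \<gamma> k by real_asymp
  moreover have "\<forall>\<^sub>F n in sequentially. 3 ^ r * (real k / real n)\<^sup>2 < \<delta>" using \<delta> k by real_asymp
  ultimately show ?thesis
    using deletion eventually_ge_at_top[of k]
  proof eventually_elim
    case (elim n)
    show ?case
    proof
      fix H :: "'a hgraph" assume H: "H \<in> free_r_graphs r (expanded_clique r (k + 1)) n"
      consider "\<not> radius_dense r p k \<delta> H" | "positively_k_partite r p k H" | "deletable r p \<gamma> H"
        using elim(4) H by blast
      then show "positively_k_partite r p k H
        \<or> p_spectral_radius r p H < p_spectral_radius r p (turan r n k)"
      proof cases
        case 1
        then show ?thesis
          using radius_less_turan_radius_if_not_radius_dense[OF _ free_r_graphsD(2)[OF H]]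
            elim(3,5) p rk by auto
      next
        case 3
        then show ?thesis
          using radius_less_turan_radius_if_deletable[OF _ H _ _ rk(2) elim(5,1,2)] p rk by auto
      qed simp
    qed
  qed
qed

lemma extremal_if_positively_k_partite:
  assumes H: "r_graph r H" and verts: "hverts H \<noteq> {}" and p: "1 < p" and r: "2 \<le> r"
    and partite: "positively_k_partite r p k H"
    and pos: "0 < p_spectral_radius r p (turan r (card (hverts H)) k)"
  shows "p_spectral_radius r p H < p_spectral_radius r p (turan r (card (hverts H)) k)
    \<or> hgraph_iso H (turan r (card (hverts H)) k)"
proof -
  obtain x where x: "k_partite k H" "principal_eigenvector r p H x" "\<And>v. v \<in> hverts H \<Longrightarrow> 0 < x v"
    using partite unfolding positively_k_partite_def by blast
  have "hgraph_iso H (turan r (card (hverts H)) k)"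
    if eq: "p_spectral_radius r p H = p_spectral_radius r p (turan r (card (hverts H)) k)"
  proof (rule k_partite_radius_eq_turan_radius_imp_iso[OF H _ p r x eq])
    show "hedges H \<noteq> {}"
      using principal_eigenvectorD(3)[OF x(2)] pos eq by (auto simp: graph_form_def)
  qed
  then show ?thesis
    using k_partite_radius_le_turan_radius[OF H verts p r x(1)] by (auto simp: less_le)
qed

theorem p_spectral_turan:
  assumes rk: "2 \<le> r" "r \<le> k" and p: "1 < p"
  shows "\<forall>\<^sub>F n in sequentially. \<forall>H\<in>(free_r_graphs r (expanded_clique r (k + 1)) n :: 'a hgraph set).
    p_spectral_radius r p H \<le> p_spectral_radius r p (turan r n k) \<and>
    (p_spectral_radius r p H = p_spectral_radius r p (turan r n k) \<longleftrightarrow> hgraph_iso H (turan r n k))"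
proof -
  have "0 < real k" using rk by simp
  then have "\<forall>\<^sub>F n in sequentially. 3 ^ r * (real k / real n)\<^sup>2 < 1" by real_asymp
  then show ?thesis
    using positively_k_partite_or_radius_less[where 'a = 'a, OF assms] eventually_ge_at_top[of k]
  proof eventually_elim
    case (elim n)
    have n: "0 < n" "0 < k" "k \<le> n" using elim(3) rk by auto
    have "0 < turan_const r k * real n powr (r - r / p) * (1 - 3 ^ r * (real k / real n)\<^sup>2)"
      using elim(1) n turan_const_pos[OF rk(2)] by simp
    also have "\<dots> \<le> p_spectral_radius r p (turan r n k)" using p rk n by (intro turan_radius_ge) auto
    finally have turan_pos: "0 < p_spectral_radius r p (turan r n k)" .
    show ?case
    proof
      fix H :: "'a hgraph" assume H_free: "H \<in> free_r_graphs r (expanded_clique r (k + 1)) n"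
      note H = free_r_graphsD[OF H_free]
      have "hverts H \<noteq> {}" using H(2) n by auto
      then have "p_spectral_radius r p H < p_spectral_radius r p (turan r n k)
        \<or> hgraph_iso H (turan r n k)"
        using extremal_if_positively_k_partite[OF H(1) _ p rk(1), of k] elim(2) H_free turan_pos
        unfolding H(2) by blast
      moreover have "p_spectral_radius r p H = p_spectral_radius r p (turan r n k)"
        if "hgraph_iso H (turan r n k)"
        using n p
        by (intro p_spectral_radius_iso[OF that H(1) r_graph_turan]) (auto simp: lessThan_empty_iff)
      ultimately show "p_spectral_radius r p H \<le> p_spectral_radius r p (turan r n k) \<and>
        (p_spectral_radius r p H = p_spectral_radius r p (turan r n k) \<longleftrightarrow> hgraph_iso H (turan r n k))"
        by auto
    qed
  qed
qed

theorem theorem1p9: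
  fixes k r :: nat and p :: real
  assumes "2 \<le> r" and "r \<le> k" and "real r \<le> p"
  shows "\<exists>n0::nat. \<forall>n>n0. \<forall>H :: nat hgraph.
    r_graph r H \<and> card (hverts H) = n \<and> hgraph_free (expanded_clique r (k + 1)) H \<longrightarrow>
      p_spectral_radius r p H \<le> p_spectral_radius r p (turan r n k) \<and>
      (p_spectral_radius r p H = p_spectral_radius r p (turan r n k) \<longleftrightarrow>
         hgraph_iso H (turan r n k))"
proof -
  have "1 < p" using assms by simp
  then have "\<forall>\<^sub>F n in sequentially. \<forall>H\<in>(free_r_graphs r (expanded_clique r (k + 1)) n :: nat hgraph set).
      p_spectral_radius r p H \<le> p_spectral_radius r p (turan r n k) \<and>
      (p_spectral_radius r p H = p_spectral_radius r p (turan r n k) \<longleftrightarrow> hgraph_iso H (turan r n k))"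
    by (rule p_spectral_turan[OF assms(1,2)])
  then show ?thesis unfolding eventually_at_top_dense free_r_graphs_def by blast
qed

end
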